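(* Let $\varphi:\mathbb{D}\to\mathbb{D}$ be a holomorphic function such that there exists a parabolic semiflow $(\varphi_t)_{t\ge0}$ with $\varphi=\varphi_1$. Let $\Omega$ be its Koenigs domain. Assume that either (i) $(\varphi_t)_{t\ge0}$ is of positive hyperbolic step, $\operatorname{int}(\overline{\Omega})=\Omega$ and $\mathbb{C}\setminus\overline{\Omega}$ is connected; or (ii) $(\varphi_t)_{t\ge0}$ is of zero hyperbolic step, $\Omega$ is contained in a half-plane and $\operatorname{int}(\overline{\Omega})=\Omega$. Then $C_\varphi\in\mathcal{L}(H^p)$, $1\le p<\infty$, is strongly compact. Moreover, if $\sum_{n=1}^{\infty}\left(1-|\varphi_n(0)|\right)=\infty$, then $\{C_\varphi\}'$ is a strongly compact algebra.
   Context: $\mathbb{D}$ is the open unit disc of $\mathbb{C}$ and $\mathbb{T}$ the unit circle. For $1\le p<\infty$, $H^p$ is the Banach space of holomorphic $f:\mathbb{D}\to\mathbb{C}$ with $\|f\|_{H^p}=\left(\sup_{0<r<1}\int_0^{2\pi}|f(re^{i\theta})|^p\,d\theta\right)^{1/p}<\infty$. For holomorphic $\varphi:\mathbb{D}\to\mathbb{D}$, $C_\varphi f=f\circ\varphi$, a bounded operator on $H^p$. For a complex Banach space $X$, $\mathcal{L}(X)$ is the algebra of bounded linear operators on $X$, and for $T\in\mathcal{L}(X)$, $\{T\}'=\{A\in\mathcal{L}(X):AT=TA\}$. An algebra $\mathcal{A}\subset\mathcal{L}(X)$ is strongly compact if every (norm-)bounded subset of $\mathcal{A}$ is relatively compact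 in the strong operator topology. An operator $T\in\mathcal{L}(X)$ is strongly compact if $\operatorname{alg}(T)=\{q(T): q \text{ a complex polynomial}\}$ is a strongly compact algebra. Semiflows. A holomorphic semiflow is a family $(\varphi_t)_{t\ge0}$ of holomorphic self-maps of $\mathbb{D}$ with $\varphi_0(z)=z$, $\varphi_{t+s}=\varphi_t\circ\varphi_s$ for all $t,s\geq 0$, and $\varphi_t\to\varphi_s$ uniformly on compact subsets of $\mathbb{D}$ as $t\to s$. (In particular, $\varphi_n$ is the $n$-th iterate of $\varphi=\varphi_1$ for $n\in\mathbb{N}$.) It is elliptic if $\varphi_{t_0}(z_0)=z_0$ for some $t_0>0$ and $z_0\in\mathbb{D}$. If it is not elliptic, there is a unique $\tau\in\mathbb{T}$ (the Denjoy–Wolff point) such that $\varphi_t\to\tau$ uniformly on compact subsets as $t\to\infty$, and there is $\alpha\le 0$ such that $\varphi_t'$ has non-tangential limit $e^{t\alpha}$ at $\tau$ for all $t\geq 0$; the semiflow is hyperbolic if $\alpha<0$ and parabolic if $\alpha=0$. A parabolic semiflow is of positive hyperbolic step if for some $z\in\mathbb{D}$ the limit $\lim_{t\to+\infty}k_{\mathbb{D}}(\varphi_t(z),\varphi_{t+1}(z))$ is positive, where $k_{\mathbb{D}}$ is the hyperbolic distance in $\mathbb{D}$; otherwise it is of zero hyperbolic step. For a non-elliptic semiflow there is a univalent function $h:\mathbb{D}\to\mathbb{C}$ (the Koenigs function), unique up to an additive constant, with $\varphi_t(z)=h^{-1}(h(z)+t)$ for all $z\in\mathbb{D}$, $t\ge0$.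 The Koenigs domain is $\Omega=h(\mathbb{D})$. Interior and closure are taken in $\mathbb{C}$. *)

theory Defs
  imports "HOL-Complex_Analysis.Complex_Analysis" "HOL-Computational_Algebra.Polynomial"
begin

abbreviation unit_disc :: "complex set" ("\<D>")
  where "\<D> \<equiv> ball 0 1"

section \<open>Operators on normed spaces of functions\<close>

text \<open>
  Since \<open>H\<^sup>p\<close> depends on the real parameter \<open>p\<close>, it cannot be a type. A normed space is
  therefore given by a carrier \<open>X\<close> of complex-valued functions, with the pointwise vector space
  operations, and a norm \<open>N\<close> on \<open>X\<close>. Operators on \<open>X\<close> are functions that are \<open>undefined\<close> off
  \<open>X\<close>, so that equality of operators is equality of HOL functions.
\<close>

definition bounded_operators ::
  "('a \<Rightarrow> complex) set \<Rightarrow> (('a \<Rightarrow> complex) \<Rightarrow> real) \<Rightarrow> (('a \<Rightarrow> complex) \<Rightarrow> ('a \<Rightarrow> complex)) set" where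
  "bounded_operators X N =
    {T \<in> X \<rightarrow>\<^sub>E X.
       (\<forall>f\<in>X. \<forall>g\<in>X. T (\<lambda>z. f z + g z) = (\<lambda>z. T f z + T g z)) \<and>
       (\<forall>c. \<forall>f\<in>X. T (\<lambda>z. c * f z) = (\<lambda>z. c * T f z)) \<and>
       (\<exists>M. \<forall>f\<in>X. N (T f) \<le> M * N f)}"

definition norm_topology ::
  "('a \<Rightarrow> complex) set \<Rightarrow> (('a \<Rightarrow> complex) \<Rightarrow> real) \<Rightarrow> ('a \<Rightarrow> complex) topology" where
  "norm_topology X N = Metric_space.mtopology X (\<lambda>f g. N (\<lambda>z. f z - g z))"

text \<open>
  The strong operator topology is the topology of pointwise convergence on \<open>X\<close>, i.e. the one
  inherited from the product topology on \<open>X \<rightarrow>\<^sub>E X\<close>.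
\<close>
definition strong_operator_topology ::
  "('a \<Rightarrow> complex) set \<Rightarrow> (('a \<Rightarrow> complex) \<Rightarrow> real)
    \<Rightarrow> (('a \<Rightarrow> complex) \<Rightarrow> ('a \<Rightarrow> complex)) topology" where
  "strong_operator_topology X N =
    subtopology (product_topology (\<lambda>_. norm_topology X N) X) (bounded_operators X N)"

definition operator_algebra ::
  "('a \<Rightarrow> complex) set \<Rightarrow> (('a \<Rightarrow> complex) \<Rightarrow> real)
    \<Rightarrow> (('a \<Rightarrow> complex) \<Rightarrow> ('a \<Rightarrow> complex)) set \<Rightarrow> bool" where
  "operator_algebra X N \<A> \<longleftrightarrow>
    \<A> \<noteq> {} \<and> \<A> \<subseteq> bounded_operators X N \<and>
    (\<forall>A\<in>\<A>. \<forall>B\<in>\<A>. (\<lambda>f\<in>X. \<lambda>z. A f z + B f z) \<in> \<A>) \<and>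
    (\<forall>c. \<forall>A\<in>\<A>. (\<lambda>f\<in>X. \<lambda>z. c * A f z) \<in> \<A>) \<and>
    (\<forall>A\<in>\<A>. \<forall>B\<in>\<A>. compose X A B \<in> \<A>)"

definition norm_bounded ::
  "('a \<Rightarrow> complex) set \<Rightarrow> (('a \<Rightarrow> complex) \<Rightarrow> real)
    \<Rightarrow> (('a \<Rightarrow> complex) \<Rightarrow> ('a \<Rightarrow> complex)) set \<Rightarrow> bool" where
  "norm_bounded X N S \<longleftrightarrow> (\<exists>M. \<forall>T\<in>S. \<forall>f\<in>X. N (T f) \<le> M * N f)"

definition strongly_compact_algebra ::
  "('a \<Rightarrow> complex) set \<Rightarrow> (('a \<Rightarrow> complex) \<Rightarrow> real)
    \<Rightarrow> (('a \<Rightarrow> complex) \<Rightarrow> ('a \<Rightarrow> complex)) set \<Rightarrow> bool" where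
  "strongly_compact_algebra X N \<A> \<longleftrightarrow>
    operator_algebra X N \<A> \<and>
    (\<forall>S. S \<subseteq> \<A> \<and> norm_bounded X N S \<longrightarrow>
       compactin (strong_operator_topology X N) (strong_operator_topology X N closure_of S))"

definition poly_operator ::
  "('a \<Rightarrow> complex) set \<Rightarrow> complex poly \<Rightarrow> (('a \<Rightarrow> complex) \<Rightarrow> ('a \<Rightarrow> complex))
    \<Rightarrow> ('a \<Rightarrow> complex) \<Rightarrow> ('a \<Rightarrow> complex)" where
  "poly_operator X q T = (\<lambda>f\<in>X. \<lambda>z. \<Sum>i\<le>degree q. coeff q i * (T ^^ i) f z)"

definition generated_algebra ::
  "('a \<Rightarrow> complex) set \<Rightarrow> (('a \<Rightarrow> complex) \<Rightarrow> ('a \<Rightarrow> complex))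
    \<Rightarrow> (('a \<Rightarrow> complex) \<Rightarrow> ('a \<Rightarrow> complex)) set" where
  "generated_algebra X T = range (\<lambda>q. poly_operator X q T)"

definition strongly_compact_operator ::
  "('a \<Rightarrow> complex) set \<Rightarrow> (('a \<Rightarrow> complex) \<Rightarrow> real)
    \<Rightarrow> (('a \<Rightarrow> complex) \<Rightarrow> ('a \<Rightarrow> complex)) \<Rightarrow> bool" where
  "strongly_compact_operator X N T \<longleftrightarrow>
    T \<in> bounded_operators X N \<and> strongly_compact_algebra X N (generated_algebra X T)"

definition commutant ::
  "('a \<Rightarrow> complex) set \<Rightarrow> (('a \<Rightarrow> complex) \<Rightarrow> real)
    \<Rightarrow> (('a \<Rightarrow> complex) \<Rightarrow> ('a \<Rightarrow> complex)) \<Rightarrow> (('a \<Rightarrow> complex) \<Rightarrow> ('a \<Rightarrow> complex)) set" where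
  "commutant X N T = {A \<in> bounded_operators X N. compose X A T = compose X T A}"

section \<open>Hardy spaces and composition operators\<close>

definition hardy_mean :: "real \<Rightarrow> (complex \<Rightarrow> complex) \<Rightarrow> real \<Rightarrow> real" where
  "hardy_mean p f r = integral {0..2 * pi} (\<lambda>\<theta>. norm (f (rcis r \<theta>)) powr p)"

text \<open>Functions on the disc are represented by their extension by zero.\<close>
definition hardy_space :: "real \<Rightarrow> (complex \<Rightarrow> complex) set" where
  "hardy_space p =
    {f. f holomorphic_on \<D> \<and> (\<forall>z. z \<notin> \<D> \<longrightarrow> f z = 0) \<and> bdd_above (hardy_mean p f ` {0<..<1})}"

definition hardy_norm :: "real \<Rightarrow> (complex \<Rightarrow> complex) \<Rightarrow> real" where
  "hardy_norm p f = (SUP r\<in>{0<..<1}. hardy_mean p f r) powr (1 / p)"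

definition composition_operator ::
  "real \<Rightarrow> (complex \<Rightarrow> complex) \<Rightarrow> (complex \<Rightarrow> complex) \<Rightarrow> (complex \<Rightarrow> complex)" where
  "composition_operator p \<phi> = (\<lambda>f\<in>hardy_space p. \<lambda>z. if z \<in> \<D> then f (\<phi> z) else 0)"

section \<open>Holomorphic semiflows of the disc\<close>

text \<open>Only the values \<open>\<Phi> t z\<close> with \<open>t \<ge> 0\<close> and \<open>z \<in> \<D>\<close> are meaningful.\<close>
definition holomorphic_semiflow :: "(real \<Rightarrow> complex \<Rightarrow> complex) \<Rightarrow> bool" where
  "holomorphic_semiflow \<Phi> \<longleftrightarrow>
    (\<forall>t\<ge>0. \<Phi> t holomorphic_on \<D> \<and> \<Phi> t ` \<D> \<subseteq> \<D>) \<and>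
    (\<forall>z\<in>\<D>. \<Phi> 0 z = z) \<and>
    (\<forall>t\<ge>0. \<forall>s\<ge>0. \<forall>z\<in>\<D>. \<Phi> (t + s) z = \<Phi> t (\<Phi> s z)) \<and>
    (\<forall>s\<ge>0. \<forall>K. compact K \<and> K \<subseteq> \<D> \<longrightarrow> uniform_limit K \<Phi> (\<Phi> s) (at s within {0..}))"

definition elliptic :: "(real \<Rightarrow> complex \<Rightarrow> complex) \<Rightarrow> bool" where
  "elliptic \<Phi> \<longleftrightarrow> (\<exists>t>0. \<exists>z\<in>\<D>. \<Phi> t z = z)"

definition denjoy_wolff_point :: "(real \<Rightarrow> complex \<Rightarrow> complex) \<Rightarrow> complex \<Rightarrow> bool" where
  "denjoy_wolff_point \<Phi> \<tau> \<longleftrightarrow>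
    norm \<tau> = 1 \<and> (\<forall>K. compact K \<and> K \<subseteq> \<D> \<longrightarrow> uniform_limit K \<Phi> (\<lambda>_. \<tau>) at_top)"

definition nontangential_limit :: "(complex \<Rightarrow> complex) \<Rightarrow> complex \<Rightarrow> complex \<Rightarrow> bool" where
  "nontangential_limit f \<tau> l \<longleftrightarrow>
    (\<forall>M>1. (f \<longlongrightarrow> l) (at \<tau> within {z \<in> \<D>. norm (\<tau> - z) < M * (1 - norm z)}))"

definition has_spectral_value :: "(real \<Rightarrow> complex \<Rightarrow> complex) \<Rightarrow> real \<Rightarrow> bool" where
  "has_spectral_value \<Phi> \<alpha> \<longleftrightarrow>
    (\<exists>\<tau>. denjoy_wolff_point \<Phi> \<tau> \<and>
      (\<forall>t\<ge>0. nontangential_limit (deriv (\<Phi> t)) \<tau> (of_real (exp (t * \<alpha>)))))"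

definition parabolic_semiflow :: "(real \<Rightarrow> complex \<Rightarrow> complex) \<Rightarrow> bool" where
  "parabolic_semiflow \<Phi> \<longleftrightarrow>
    holomorphic_semiflow \<Phi> \<and> \<not> elliptic \<Phi> \<and> has_spectral_value \<Phi> 0"

definition hyperbolic_distance :: "complex \<Rightarrow> complex \<Rightarrow> real" where
  "hyperbolic_distance z w = artanh (norm (Moebius_function 0 w z))"

definition positive_hyperbolic_step :: "(real \<Rightarrow> complex \<Rightarrow> complex) \<Rightarrow> bool" where
  "positive_hyperbolic_step \<Phi> \<longleftrightarrow>
    (\<exists>z\<in>\<D>. \<exists>L>0. ((\<lambda>t. hyperbolic_distance (\<Phi> t z) (\<Phi> (t + 1) z)) \<longlongrightarrow> L) at_top)"

abbreviation zero_hyperbolic_step :: "(real \<Rightarrow> complex \<Rightarrow> complex) \<Rightarrow> bool" where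
  "zero_hyperbolic_step \<Phi> \<equiv> \<not> positive_hyperbolic_step \<Phi>"

definition koenigs_function :: "(real \<Rightarrow> complex \<Rightarrow> complex) \<Rightarrow> (complex \<Rightarrow> complex) \<Rightarrow> bool" where
  "koenigs_function \<Phi> h \<longleftrightarrow>
    h holomorphic_on \<D> \<and> inj_on h \<D> \<and>
    (\<forall>z\<in>\<D>. \<forall>t\<ge>0. h z + of_real t \<in> h ` \<D> \<and> \<Phi> t z = inv_into \<D> h (h z + of_real t))"

definition half_plane :: "complex set \<Rightarrow> bool" where
  "half_plane H \<longleftrightarrow> (\<exists>a b. a \<noteq> 0 \<and> H = {z. a \<bullet> z < b})"

end

theory Submission
  imports Defs
begin

text \<open>
  An algebra of bounded operators that has a total set of common eigenvectors is strongly compact: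
  every orbit of a bounded subset is totally bounded, and Tychonoff's theorem applies.

  After an affine change of variable \<open>F = b - cnj a * h\<close> maps the disc univalently into the right
  half-plane; the functions \<open>exp (- l * F)\<close> with \<open>l \<ge> 0\<close> are eigenvectors of \<open>C\<^sub>\<phi>\<close>.
  They are total in \<open>H\<^sup>p\<close>: the bounded functions in the closure \<open>M\<close> of their span form an
  algebra which contains \<open>1 / (F - w)\<close> first for \<open>Re w < 0\<close> (Laplace transform) and then, by moving
  the pole, for every \<open>w\<close> off the closure of the Koenigs domain. Hence \<open>M\<close> contains \<open>\<psi> \<circ> G\<close>, where
  \<open>G = 1 / (F + 1)\<close> and \<open>\<psi>\<close> is a Riemann map of any simply connected neighbourhood of the closure of
  \<open>G(\<D>)\<close>. Letting these neighbourhoods shrink, \<open>\<psi> \<circ> G\<close> tends to the identity, so \<open>M\<close> contains the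
  polynomials.

  If the orbit of \<open>0\<close> is not a Blaschke sequence, then an eigenfunction is determined by its value at
  \<open>0\<close>, the eigenspaces are one-dimensional, and the same eigenvectors are common to the commutant.
\<close>

section \<open>Common eigenvectors and strong compactness\<close>

text \<open>The two cases feed one argument. A positive step forces the Koenigs domain into a
  half-plane with horizontal boundary; with zero step the given half-plane cannot be horizontal, and
  pushing exterior points to the left shows that the exterior of the domain is connected. The
  connected exterior lets the pole of the resolvent travel, and the equation between the domain and
  the interior of its closure places a limit of inverse Riemann maps inside the domain and not
  merely in its closure.

  The obstacle is the boundary, which may be very irregular: the maps
  \<open>\<psi> \<circ> G\<close> can be controlled only inside the disc. Norm convergence is
  recovered from a single number. A self-map \<open>g\<close> of the disc with
  \<open>g 0 = 0\<close> has the form \<open>z * q z\<close> with \<open>q\<close> bounded by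
  \<open>1\<close>, and if \<open>norm (q 0)\<close> is close to \<open>1\<close>, then
  \<open>q\<close> is close to a unimodular constant in H^2, hence, being bounded, in every H^p. The
  same criterion controls the Riemann sums of the Laplace transform.\<close>

inductive_set fun_span :: "('a \<Rightarrow> complex) set \<Rightarrow> ('a \<Rightarrow> complex) set"
  for E :: "('a \<Rightarrow> complex) set" where
  zero: "(\<lambda>z. 0) \<in> fun_span E"
| base: "e \<in> E \<Longrightarrow> e \<in> fun_span E"
| add: "f \<in> fun_span E \<Longrightarrow> g \<in> fun_span E \<Longrightarrow> (\<lambda>z. f z + g z) \<in> fun_span E"
| scale: "f \<in> fun_span E \<Longrightarrow> (\<lambda>z. c * f z) \<in> fun_span E"

text \<open>Nonnegativity and invariance under sign change are demanded off the carrier as well,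
  because \<open>Metric_space\<close> asks for a nonnegative symmetric distance on the whole type;
  the other norm laws hold on \<open>X\<close> only.\<close>

locale banach_function_space =
  fixes X :: "('a \<Rightarrow> complex) set" and N :: "('a \<Rightarrow> complex) \<Rightarrow> real"
  assumes zero_mem: "(\<lambda>z. 0) \<in> X"
    and add_mem: "f \<in> X \<Longrightarrow> g \<in> X \<Longrightarrow> (\<lambda>z. f z + g z) \<in> X"
    and scale_mem: "f \<in> X \<Longrightarrow> (\<lambda>z. c * f z) \<in> X"
    and N_nonneg: "0 \<le> N f"
    and N_minus: "N (\<lambda>z. - f z) = N f"
    and N_triangle: "f \<in> X \<Longrightarrow> g \<in> X \<Longrightarrow> N (\<lambda>z. f z + g z) \<le> N f + N g"
    and N_scale: "f \<in> X \<Longrightarrow> N (\<lambda>z. c * f z) = norm c * N f"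
    and N_eq_0: "f \<in> X \<Longrightarrow> N f = 0 \<Longrightarrow> f = (\<lambda>z. 0)"
    and complete: "Metric_space.mcomplete X (\<lambda>f g. N (\<lambda>z. f z - g z))"
begin

abbreviation d :: "('a \<Rightarrow> complex) \<Rightarrow> ('a \<Rightarrow> complex) \<Rightarrow> real" where
  "d f g \<equiv> N (\<lambda>z. f z - g z)"

lemma diff_mem: "f \<in> X \<Longrightarrow> g \<in> X \<Longrightarrow> (\<lambda>z. f z - g z) \<in> X"
  using add_mem[OF _ scale_mem[of g "-1"]] by simp

lemma N_zero: "N (\<lambda>z. 0) = 0"
  using N_scale[OF zero_mem, of 0] by simp

lemma d_triangle:
  assumes "f \<in> X" "g \<in> X" "k \<in> X" shows "d f k \<le> d f g + d g k"
  using N_triangle[OF diff_mem[OF assms(1,2)] diff_mem[OF assms(2,3)]] by simp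

lemma d_commute: "d f g = d g f"
  using N_minus[of "\<lambda>z. f z - g z"] by simp

lemma d_eq_0:
  assumes "f \<in> X" "g \<in> X" "d f g = 0" shows "f = g"
  using N_eq_0[OF diff_mem[OF assms(1,2)] assms(3)] by (simp add: fun_eq_iff)

lemma N_le_d:
  assumes "f \<in> X" "g \<in> X" shows "N f \<le> d f g + N g"
  using N_triangle[OF diff_mem[OF assms(1,2)] assms(2)] by simp

end

sublocale banach_function_space \<subseteq> metr: Metric_space X "\<lambda>f g. N (\<lambda>z. f z - g z)"
  by unfold_locales (use d_commute d_triangle d_eq_0 N_zero N_nonneg in auto)

context banach_function_space
begin

lemma norm_topology_eq: "norm_topology X N = metr.mtopology"
  by (simp add: norm_topology_def)

lemma bounded_operatorsD:
  assumes "T \<in> bounded_operators X N"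
  shows "f \<in> X \<Longrightarrow> T f \<in> X"
    and "f \<in> X \<Longrightarrow> g \<in> X \<Longrightarrow> T (\<lambda>z. f z + g z) = (\<lambda>z. T f z + T g z)"
    and "f \<in> X \<Longrightarrow> T (\<lambda>z. c * f z) = (\<lambda>z. c * T f z)"
    and "f \<in> X \<Longrightarrow> g \<in> X \<Longrightarrow> T (\<lambda>z. f z - g z) = (\<lambda>z. T f z - T g z)"
    and "T (\<lambda>z. 0) = (\<lambda>z. 0)"
proof -
  have 1: "\<And>f. f \<in> X \<Longrightarrow> T f \<in> X"
    and 2: "\<And>f g. f \<in> X \<Longrightarrow> g \<in> X \<Longrightarrow> T (\<lambda>z. f z + g z) = (\<lambda>z. T f z + T g z)"
    and 3: "\<And>f c. f \<in> X \<Longrightarrow> T (\<lambda>z. c * f z) = (\<lambda>z. c * T f z)"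
    using assms by (auto simp: bounded_operators_def)
  show "f \<in> X \<Longrightarrow> T f \<in> X"
    and "f \<in> X \<Longrightarrow> g \<in> X \<Longrightarrow> T (\<lambda>z. f z + g z) = (\<lambda>z. T f z + T g z)"
    and "f \<in> X \<Longrightarrow> T (\<lambda>z. c * f z) = (\<lambda>z. c * T f z)"
    by (fact 1 2 3)+
  show "f \<in> X \<Longrightarrow> g \<in> X \<Longrightarrow> T (\<lambda>z. f z - g z) = (\<lambda>z. T f z - T g z)"
    using 2[of f "\<lambda>z. (-1) * g z"] 3[of g "-1"] scale_mem[of g "-1"] by simp
  show "T (\<lambda>z. 0) = (\<lambda>z. 0)"
    using 3[OF zero_mem, of 0] by simp
qed

lemma fun_span_mem: "g \<in> fun_span E \<Longrightarrow> E \<subseteq> X \<Longrightarrow> g \<in> X"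
  by (induction rule: fun_span.induct) (auto intro: zero_mem add_mem scale_mem)

text \<open>Total boundedness with centres not required to lie in the set.\<close>
definition precompact :: "('a \<Rightarrow> complex) set \<Rightarrow> bool" where
  "precompact S \<longleftrightarrow> S \<subseteq> X \<and> (\<forall>\<epsilon>>0. \<exists>C. finite C \<and> C \<subseteq> X \<and> (\<forall>f\<in>S. \<exists>c\<in>C. d f c < \<epsilon>))"

lemma precompact_subset_carrier: "precompact S \<Longrightarrow> S \<subseteq> X"
  unfolding precompact_def by (rule conjunct1)

lemma precompactE:
  assumes "precompact S" "\<epsilon> > 0"
  obtains C where "finite C" "C \<subseteq> X" "\<And>f. f \<in> S \<Longrightarrow> \<exists>c\<in>C. d f c < \<epsilon>"
proof -
  have "\<forall>\<epsilon>>0. \<exists>C. finite C \<and> C \<subseteq> X \<and> (\<forall>f\<in>S. \<exists>c\<in>C. d f c < \<epsilon>)"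
    using assms(1) unfolding precompact_def by (rule conjunct2)
  with assms(2) show thesis using that by (elim allE impE exE) auto
qed

text \<open>\<open>R\<close> need only lie inside the sum of the two sets: an orbit of
  \<open>f + g\<close> applies one operator to both summands and is in general smaller than the sum
  of the two orbits.\<close>

lemma precompact_add:
  assumes "precompact S" "precompact S'"
    and "\<And>k. k \<in> R \<Longrightarrow> \<exists>f\<in>S. \<exists>g\<in>S'. k = (\<lambda>z. f z + g z)"
  shows "precompact R"
  unfolding precompact_def
proof (intro conjI allI impI)
  have SX: "S \<subseteq> X" "S' \<subseteq> X" using assms(1,2) precompact_subset_carrier by auto
  show "R \<subseteq> X"
  proof
    fix k assume "k \<in> R"
    with assms(3) obtain f g where "f \<in> S" "g \<in> S'" "k = (\<lambda>z. f z + g z)" by blast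
    thus "k \<in> X" using SX by (auto intro!: add_mem)
  qed
  fix \<epsilon> :: real assume e: "\<epsilon> > 0"
  obtain C where C: "finite C" "C \<subseteq> X" "\<And>f. f \<in> S \<Longrightarrow> \<exists>c\<in>C. d f c < \<epsilon>/2"
    using precompactE[OF assms(1), of "\<epsilon>/2"] e by auto
  obtain C' where C': "finite C'" "C' \<subseteq> X" "\<And>f. f \<in> S' \<Longrightarrow> \<exists>c\<in>C'. d f c < \<epsilon>/2"
    using precompactE[OF assms(2), of "\<epsilon>/2"] e by auto
  show "\<exists>C. finite C \<and> C \<subseteq> X \<and> (\<forall>f\<in>R. \<exists>c\<in>C. d f c < \<epsilon>)"
  proof (intro exI conjI ballI)
    let ?C = "(\<lambda>(c,c') z. c z + c' z) ` (C \<times> C')"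
    show "finite ?C" using C C' by auto
    show "?C \<subseteq> X"
    proof (clarsimp)
      fix c c' assume "c \<in> C" "c' \<in> C'"
      thus "(\<lambda>z. c z + c' z) \<in> X" using C(2) C'(2) by (intro add_mem) auto
    qed
    fix k assume "k \<in> R"
    with assms(3) obtain f g where fg: "f \<in> S" "g \<in> S'" "k = (\<lambda>z. f z + g z)" by blast
    obtain c c' where c: "c \<in> C" "d f c < \<epsilon>/2" "c' \<in> C'" "d g c' < \<epsilon>/2"
      using C(3) C'(3) fg by meson
    have mem: "f \<in> X" "g \<in> X" "c \<in> X" "c' \<in> X" using fg c SX C(2) C'(2) by auto
    have "d k (\<lambda>z. c z + c' z) = N (\<lambda>z. (f z - c z) + (g z - c' z))"
      by (rule arg_cong[of _ _ N]) (auto simp: fg)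
    hence "d k (\<lambda>z. c z + c' z) \<le> d f c + d g c'"
      using N_triangle[OF diff_mem diff_mem, OF mem(1,3,2,4)] by simp
    hence "d k (\<lambda>z. c z + c' z) < \<epsilon>" using c by simp
    thus "\<exists>c\<in>?C. d k c < \<epsilon>"
      using c by (intro bexI[of _ "\<lambda>z. c z + c' z"] image_eqI[of _ _ "(c, c')"]) auto
  qed
qed

lemma precompact_scale:
  assumes "precompact S" shows "precompact ((\<lambda>f z. c * f z) ` S)"
  unfolding precompact_def
proof (intro conjI allI impI)
  have SX: "S \<subseteq> X" using assms by (rule precompact_subset_carrier)
  thus "(\<lambda>f z. c * f z) ` S \<subseteq> X" by (intro image_subsetI scale_mem) blast
  fix \<epsilon> :: real assume e: "\<epsilon> > 0"
  have pos: "norm c + 1 > 0" by (smt (verit) norm_ge_zero)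
  have e': "\<epsilon> / (norm c + 1) > 0" using e pos by simp
  obtain C where C: "finite C" "C \<subseteq> X" "\<And>f. f \<in> S \<Longrightarrow> \<exists>k\<in>C. d f k < \<epsilon> / (norm c + 1)"
    using precompactE[OF assms e'] by auto
  show "\<exists>C. finite C \<and> C \<subseteq> X \<and> (\<forall>f\<in>(\<lambda>f z. c * f z) ` S. \<exists>c\<in>C. d f c < \<epsilon>)"
  proof (intro exI conjI ballI)
    let ?C = "(\<lambda>f z. c * f z) ` C"
    show "finite ?C" using C by simp
    show "?C \<subseteq> X" using C(2) by (intro image_subsetI scale_mem) blast
    fix k assume "k \<in> (\<lambda>f z. c * f z) ` S"
    then obtain f where f: "f \<in> S" "k = (\<lambda>z. c * f z)" by auto
    obtain u where u: "u \<in> C" "d f u < \<epsilon> / (norm c + 1)" using C(3) f by meson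
    have "d k (\<lambda>z. c * u z) = norm c * d f u"
      using N_scale[OF diff_mem[of f u], of c] f u SX C by (auto simp: algebra_simps)
    also have "\<dots> \<le> (norm c + 1) * d f u" using N_nonneg by (simp add: mult_right_mono)
    also have "\<dots> < \<epsilon>" using u(2) pos by (simp add: field_simps)
    finally show "\<exists>c\<in>?C. d k c < \<epsilon>" using u by (intro bexI[of _ "\<lambda>z. c * u z"]) auto
  qed
qed

text \<open>Closed discs of scalars are compact, so a bounded piece of a complex line is totally
  bounded. The orbit of an eigenvector lies in such a piece.\<close>

lemma precompact_line:
  assumes "e \<in> X" shows "precompact ((\<lambda>c z. c * e z) ` cball 0 M)"
  unfolding precompact_def
proof (intro conjI allI impI)
  show "(\<lambda>c z. c * e z) ` cball 0 M \<subseteq> X" using assms by (intro image_subsetI scale_mem)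
  fix \<epsilon> :: real assume e: "\<epsilon> > 0"
  have pos: "N e + 1 > 0" using N_nonneg[of e] by simp
  have "\<epsilon> / (N e + 1) > 0" using e pos by simp
  moreover have "\<forall>r>0. \<exists>K. finite K \<and> cball (0::complex) M \<subseteq> (\<Union>x\<in>K. ball x r)"
    using compact_eq_totally_bounded[of "cball (0::complex) M"] by simp
  ultimately obtain K where K: "finite K" "cball (0::complex) M \<subseteq> (\<Union>x\<in>K. ball x (\<epsilon> / (N e + 1)))"
    by blast
  show "\<exists>C. finite C \<and> C \<subseteq> X \<and> (\<forall>f\<in>(\<lambda>c z. c * e z) ` cball 0 M. \<exists>c\<in>C. d f c < \<epsilon>)"
  proof (intro exI conjI ballI)
    let ?C = "(\<lambda>c z. c * e z) ` K"
    show "finite ?C" using K by simp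
    show "?C \<subseteq> X" using assms by (intro image_subsetI scale_mem)
    fix k assume "k \<in> (\<lambda>c z. c * e z) ` cball 0 M"
    then obtain c where c: "c \<in> cball 0 M" "k = (\<lambda>z. c * e z)" by auto
    then obtain x where x: "x \<in> K" "dist x c < \<epsilon> / (N e + 1)" using K by auto
    have "d k (\<lambda>z. x * e z) = norm (c - x) * N e"
      using N_scale[OF assms, of "c - x"] c by (simp add: algebra_simps)
    also have "\<dots> \<le> norm (c - x) * (N e + 1)" by (simp add: mult_left_mono)
    also have "\<dots> < \<epsilon>" using x pos by (simp add: field_simps dist_norm norm_minus_commute)
    finally show "\<exists>c\<in>?C. d k c < \<epsilon>" using x by (intro bexI[of _ "\<lambda>z. x * e z"]) auto
  qed
qed

lemma precompact_subset:
  assumes "precompact S" "R \<subseteq> S" shows "precompact R"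
  unfolding precompact_def
proof (intro conjI allI impI)
  show "R \<subseteq> X" using assms(2) precompact_subset_carrier[OF assms(1)] by (rule subset_trans)
  fix \<epsilon> :: real assume e: "\<epsilon> > 0"
  obtain C where C: "finite C" "C \<subseteq> X" "\<And>f. f \<in> S \<Longrightarrow> \<exists>c\<in>C. d f c < \<epsilon>"
    using precompactE[OF assms(1) e] by auto
  show "\<exists>C. finite C \<and> C \<subseteq> X \<and> (\<forall>f\<in>R. \<exists>c\<in>C. d f c < \<epsilon>)"
    using C assms(2) by (intro exI[of _ C] conjI ballI) (auto dest: subsetD)
qed

text \<open>Each \<open>\<epsilon>\<close> may use its own approximating set. For the orbit of
  \<open>f\<close> this will be the orbit of a nearby element of the span.\<close>

lemma precompact_approx:
  assumes "S \<subseteq> X" "\<And>\<epsilon>. \<epsilon> > 0 \<Longrightarrow> \<exists>R. precompact R \<and> (\<forall>f\<in>S. \<exists>g\<in>R. d f g < \<epsilon>)"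
  shows "precompact S"
  unfolding precompact_def
proof (intro conjI allI impI)
  show "S \<subseteq> X" by fact
  fix \<epsilon> :: real assume e: "\<epsilon> > 0"
  then obtain R where R: "precompact R" "\<And>f. f \<in> S \<Longrightarrow> \<exists>g\<in>R. d f g < \<epsilon>/2"
    using assms(2)[of "\<epsilon>/2"] by auto
  then obtain C where C: "finite C" "C \<subseteq> X" "\<And>f. f \<in> R \<Longrightarrow> \<exists>c\<in>C. d f c < \<epsilon>/2"
    using precompactE[OF R(1), of "\<epsilon>/2"] e by auto
  have "\<exists>c\<in>C. d f c < \<epsilon>" if f: "f \<in> S" for f
  proof -
    obtain g where g: "g \<in> R" "d f g < \<epsilon>/2" using R f by meson
    obtain c where c: "c \<in> C" "d g c < \<epsilon>/2" using C g by meson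
    have "d f c \<le> d f g + d g c"
      using f g(1) c(1) assms(1) C(2) precompact_subset_carrier[OF R(1)]
      by (intro d_triangle) auto
    hence "d f c < \<epsilon>" using g(2) c(2) by simp
    thus ?thesis using c(1) by (rule bexI)
  qed
  thus "\<exists>C. finite C \<and> C \<subseteq> X \<and> (\<forall>f\<in>S. \<exists>c\<in>C. d f c < \<epsilon>)" using C by blast
qed

lemma precompact_imp_compact_closure:
  assumes "precompact S" shows "compactin metr.mtopology (metr.mtopology closure_of S)"
proof -
  have SX: "S \<subseteq> X" using assms by (rule precompact_subset_carrier)
  have "\<exists>K. finite K \<and> K \<subseteq> S \<and> S \<subseteq> (\<Union>x\<in>K. metr.mball x \<epsilon>)" if e: "\<epsilon> > 0" for \<epsilon>
  proof -
    obtain C where C: "finite C" "C \<subseteq> X" "\<And>f. f \<in> S \<Longrightarrow> \<exists>c\<in>C. d f c < \<epsilon>/2"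
      using precompactE[OF assms, of "\<epsilon>/2"] e by auto
    \<comment> \<open>\<open>mtotally_bounded\<close> wants its centres in \<open>S\<close>. Centres
      close to no point of \<open>S\<close> are dropped, and every other one is moved to such a
      point, which doubles the radius.\<close>
    define C' where "C' = {c\<in>C. \<exists>f\<in>S. d f c < \<epsilon>/2}"
    have "\<forall>c\<in>C'. \<exists>f. f \<in> S \<and> d f c < \<epsilon>/2" by (auto simp: C'_def)
    from bchoice[OF this] obtain k where k: "\<And>c. c \<in> C' \<Longrightarrow> k c \<in> S \<and> d (k c) c < \<epsilon>/2"
      by blast
    show ?thesis
    proof (intro exI conjI subsetI)
      show "finite (k ` C')" using C by (simp add: C'_def)
      show "\<And>x. x \<in> k ` C' \<Longrightarrow> x \<in> S" using k by auto
      fix f assume f: "f \<in> S"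
      then obtain c where c: "c \<in> C" "d f c < \<epsilon>/2" using C by meson
      hence c': "c \<in> C'" using f by (auto simp: C'_def)
      have "d (k c) f \<le> d (k c) c + d c f" using k[OF c'] f c C SX by (intro d_triangle) auto
      also have "\<dots> < \<epsilon>" using k[OF c'] c d_commute[of c f] by simp
      finally show "f \<in> (\<Union>x\<in>k ` C'. metr.mball x \<epsilon>)" using k[OF c'] c' f SX by auto
    qed
  qed
  hence "metr.mtotally_bounded S" by (simp add: metr.mtotally_bounded_def)
  thus ?thesis using metr.mtotally_bounded_eq_compact_closure_of[OF complete] by blast
qed

text \<open>Restricting the finitely many coordinates in \<open>J\<close> to balls around the values
  of \<open>T\<close> gives an open neighbourhood of \<open>T\<close> in the product, which
  therefore meets \<open>S\<close>.\<close>

lemma product_closure_approx: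
  assumes T: "T \<in> product_topology (\<lambda>_. metr.mtopology) X closure_of S"
    and J: "finite J" "J \<subseteq> X" and e: "\<epsilon> > 0"
  shows "\<exists>A\<in>S. \<forall>f\<in>J. d (A f) (T f) < \<epsilon> \<and> A f \<in> X"
proof -
  let ?P = "product_topology (\<lambda>_. metr.mtopology) X"
  have Ttop: "T \<in> topspace ?P" using T by (simp add: in_closure_of)
  hence TX: "\<And>f. f \<in> X \<Longrightarrow> T f \<in> X" by auto
  let ?U = "PiE X (\<lambda>f. if f \<in> J then metr.mball (T f) \<epsilon> else X)"
  have "openin ?P ?U"
    unfolding openin_PiE_gen
  proof (intro disjI2 conjI ballI)
    show "finite {i \<in> X. (if i \<in> J then metr.mball (T i) \<epsilon> else X) \<noteq> topspace metr.mtopology}"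
      by (rule finite_subset[OF _ J(1)]) auto
  next
    fix i assume "i \<in> X"
    thus "openin metr.mtopology (if i \<in> J then metr.mball (T i) \<epsilon> else X)"
      using openin_topspace[of metr.mtopology] by auto
  qed
  moreover have "T \<in> ?U" using Ttop TX e by (auto simp: PiE_iff N_zero)
  ultimately obtain A where A: "A \<in> S" "A \<in> ?U" using T by (auto simp: in_closure_of)
  have "d (A f) (T f) < \<epsilon> \<and> A f \<in> X" if f: "f \<in> J" for f
  proof -
    have "A f \<in> metr.mball (T f) \<epsilon>" using A(2) f J(2) by (auto simp: PiE_iff dest!: bspec[of _ _ f])
    thus ?thesis using d_commute[of "A f" "T f"] by simp
  qed
  thus ?thesis using A(1) by blast
qed

text \<open>Additivity, homogeneity and the norm bound each involve at most three values of an
  operator, so they survive pointwise limits; the bound does so because \<open>M\<close> is common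
  to all of \<open>S\<close>. This makes the closure in the product agree with the closure in the
  strong operator topology.\<close>

lemma product_closure_bounded_operators:
  assumes S: "S \<subseteq> bounded_operators X N" and M: "\<And>A f. A \<in> S \<Longrightarrow> f \<in> X \<Longrightarrow> N (A f) \<le> M * N f"
  shows "product_topology (\<lambda>_. metr.mtopology) X closure_of S \<subseteq> bounded_operators X N"
proof
  fix T assume T: "T \<in> product_topology (\<lambda>_. metr.mtopology) X closure_of S"
  hence TE: "T \<in> X \<rightarrow>\<^sub>E X" by (auto simp: in_closure_of)
  hence TX: "\<And>f. f \<in> X \<Longrightarrow> T f \<in> X" by auto
  have "T (\<lambda>z. f z + g z) = (\<lambda>z. T f z + T g z)" if fg: "f \<in> X" "g \<in> X" for f g
  proof -
    have le: "d (T (\<lambda>z. f z + g z)) (\<lambda>z. T f z + T g z) \<le> \<epsilon>" if e: "\<epsilon> > 0" for \<epsilon>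
    proof -
      obtain A where A: "A \<in> S" "\<And>k. k \<in> {f, g, \<lambda>z. f z + g z} \<Longrightarrow> d (A k) (T k) < \<epsilon>/3 \<and> A k \<in> X"
        using product_closure_approx[OF T, of "{f, g, \<lambda>z. f z + g z}" "\<epsilon>/3"] fg add_mem e by auto
      have Aadd: "A (\<lambda>z. f z + g z) = (\<lambda>z. A f z + A g z)"
        using bounded_operatorsD(2) A(1) S fg by blast
      have AX: "A f \<in> X" "A g \<in> X" using A(2) by auto
      have "d (T (\<lambda>z. f z + g z)) (\<lambda>z. T f z + T g z) \<le>
          d (T (\<lambda>z. f z + g z)) (\<lambda>z. A f z + A g z) + d (\<lambda>z. A f z + A g z) (\<lambda>z. T f z + T g z)"
        by (intro d_triangle TX add_mem fg AX)
      moreover have "d (\<lambda>z. A f z + A g z) (\<lambda>z. T f z + T g z) \<le> d (A f) (T f) + d (A g) (T g)"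
        using N_triangle[OF diff_mem[OF AX(1) TX[OF fg(1)]] diff_mem[OF AX(2) TX[OF fg(2)]]]
        by (simp add: algebra_simps)
      moreover have "d (T (\<lambda>z. f z + g z)) (\<lambda>z. A f z + A g z) < \<epsilon>/3"
        using A(2)[of "\<lambda>z. f z + g z"] Aadd d_commute[of "T (\<lambda>z. f z + g z)"] by simp
      moreover have "d (A f) (T f) < \<epsilon>/3" "d (A g) (T g) < \<epsilon>/3" using A(2) by auto
      ultimately show ?thesis by linarith
    qed
    have "d (T (\<lambda>z. f z + g z)) (\<lambda>z. T f z + T g z) \<le> 0"
      by (rule field_le_epsilon) (use le in auto)
    thus ?thesis using N_nonneg by (intro d_eq_0 TX add_mem fg) (simp add: order_antisym)
  qed
  moreover have "T (\<lambda>z. c * f z) = (\<lambda>z. c * T f z)" if f: "f \<in> X" for c f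
  proof -
    have le: "d (T (\<lambda>z. c * f z)) (\<lambda>z. c * T f z) \<le> \<epsilon>" if e: "\<epsilon> > 0" for \<epsilon>
    proof -
      have pos: "norm c + 1 > 0" by (smt (verit) norm_ge_zero)
      define \<delta> where "\<delta> = \<epsilon> / (norm c + 1) / 2"
      have d0: "\<delta> > 0" using e pos by (simp add: \<delta>_def)
      have dd: "(norm c + 1) * \<delta> = \<epsilon> / 2" using pos by (simp add: \<delta>_def field_simps)
      have dle: "\<delta> \<le> \<epsilon> / 2" unfolding dd[symmetric] using d0 by (simp add: algebra_simps)
      obtain A where A: "A \<in> S" "\<And>k. k \<in> {f, \<lambda>z. c * f z} \<Longrightarrow> d (A k) (T k) < \<delta> \<and> A k \<in> X"
        using product_closure_approx[OF T, of "{f, \<lambda>z. c * f z}" \<delta>] f scale_mem d0 by auto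
      have Ac: "A (\<lambda>z. c * f z) = (\<lambda>z. c * A f z)"
        using bounded_operatorsD(3) A(1) S f by blast
      have AX: "A f \<in> X" using A(2) by auto
      have "d (T (\<lambda>z. c * f z)) (\<lambda>z. c * T f z) \<le>
          d (T (\<lambda>z. c * f z)) (\<lambda>z. c * A f z) + d (\<lambda>z. c * A f z) (\<lambda>z. c * T f z)"
        by (intro d_triangle TX scale_mem f AX)
      moreover have "d (\<lambda>z. c * A f z) (\<lambda>z. c * T f z) = norm c * d (A f) (T f)"
        using N_scale[OF diff_mem[OF AX(1) TX[OF f]], of c] by (simp add: algebra_simps)
      moreover have "d (T (\<lambda>z. c * f z)) (\<lambda>z. c * A f z) < \<delta>"
        using A(2)[of "\<lambda>z. c * f z"] Ac d_commute[of "T (\<lambda>z. c * f z)"] by simp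
      moreover have "norm c * d (A f) (T f) \<le> norm c * \<delta>"
        using A(2)[of f] by (intro mult_left_mono) auto
      ultimately show ?thesis using dd e by (simp add: algebra_simps)
    qed
    have "d (T (\<lambda>z. c * f z)) (\<lambda>z. c * T f z) \<le> 0"
      by (rule field_le_epsilon) (use le in auto)
    thus ?thesis using N_nonneg by (intro d_eq_0 TX scale_mem f) (simp add: order_antisym)
  qed
  moreover have "N (T f) \<le> M * N f" if f: "f \<in> X" for f
  proof (rule field_le_epsilon)
    fix \<epsilon> :: real assume e: "\<epsilon> > 0"
    obtain A where A: "A \<in> S" "d (A f) (T f) < \<epsilon>" "A f \<in> X"
      using product_closure_approx[OF T, of "{f}" \<epsilon>] f e by auto
    have "N (T f) \<le> d (T f) (A f) + N (A f)" by (intro N_le_d TX f A)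
    thus "N (T f) \<le> M * N f + \<epsilon>" using A(2) d_commute[of "T f"] M[OF A(1) f] by simp
  qed
  ultimately show "T \<in> bounded_operators X N" using TE unfolding bounded_operators_def by blast
qed

theorem strongly_compact_algebra_common_eigenvectors:
  assumes alg: "operator_algebra X N \<A>" and EX: "E \<subseteq> X"
    and eig: "\<And>A e. A \<in> \<A> \<Longrightarrow> e \<in> E \<Longrightarrow> \<exists>c. A e = (\<lambda>z. c * e z)"
    and total: "\<And>f \<epsilon>. f \<in> X \<Longrightarrow> \<epsilon> > 0 \<Longrightarrow> \<exists>g\<in>fun_span E. d f g < \<epsilon>"
  shows "strongly_compact_algebra X N \<A>"
  unfolding strongly_compact_algebra_def
proof (intro conjI allI impI alg)
  fix S assume "S \<subseteq> \<A> \<and> norm_bounded X N S"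
  then obtain M0 where SA: "S \<subseteq> \<A>" and M0: "\<And>A f. A \<in> S \<Longrightarrow> f \<in> X \<Longrightarrow> N (A f) \<le> M0 * N f"
    by (auto simp: norm_bounded_def)
  define M where "M = \<bar>M0\<bar> + 1"
  have Mpos: "M > 0" by (simp add: M_def)
  have M: "N (A f) \<le> M * N f" if "A \<in> S" "f \<in> X" for A f
    using M0[OF that] mult_right_mono[of M0 M "N f"] N_nonneg[of f] unfolding M_def by linarith
  have SB: "S \<subseteq> bounded_operators X N" using alg SA by (auto simp: operator_algebra_def)
  have SX: "A f \<in> X" if "A \<in> S" "f \<in> X" for A f
    using bounded_operatorsD(1) SB that by blast
  have orbit: "precompact ((\<lambda>A. A g) ` S)" if "g \<in> fun_span E" for g
    using that
  proof induction
    case zero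
    have "(\<lambda>A. A (\<lambda>z. 0)) ` S \<subseteq> (\<lambda>c z. c * (0::complex)) ` cball 0 0"
      using bounded_operatorsD(5) SB by auto
    thus ?case using precompact_subset[OF precompact_line[OF zero_mem, of 0]] by auto
  next
    case (base e)
    have "(\<lambda>A. A e) ` S \<subseteq> (\<lambda>c z. c * e z) ` cball 0 M"
    proof
      fix k assume "k \<in> (\<lambda>A. A e) ` S"
      then obtain A where A: "A \<in> S" "k = A e" by auto
      obtain c where c: "A e = (\<lambda>z. c * e z)" using eig SA A base by blast
      have eX: "e \<in> X" using EX base by auto
      have le: "norm c * N e \<le> M * N e" using M[OF A(1) eX] c N_scale[OF eX, of c] by simp
      show "k \<in> (\<lambda>c z. c * e z) ` cball 0 M"
      \<comment> \<open>The bound on \<open>c\<close> comes from dividing by \<open>N e\<close>. If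
        \<open>N e = 0\<close>, then \<open>e\<close> vanishes and \<open>c\<close> carries no
        information, so the scalar \<open>0\<close> represents \<open>A e\<close>.\<close>
      proof (cases "N e = 0")
        case True
        hence "k = (\<lambda>z. 0 * e z)" using A c N_eq_0[OF eX] by auto
        thus ?thesis using Mpos by (intro image_eqI[of _ _ 0]) auto
      next
        case False
        hence "norm c \<le> M" using le N_nonneg[of e] by simp
        thus ?thesis using A c by auto
      qed
    qed
    thus ?case using precompact_subset precompact_line EX base by blast
  next
    case (add f g)
    show ?case
    proof (rule precompact_add[OF add.IH])
      fix k assume "k \<in> (\<lambda>A. A (\<lambda>z. f z + g z)) ` S"
      then obtain A where A: "A \<in> S" "k = A (\<lambda>z. f z + g z)" by auto
      hence "k = (\<lambda>z. A f z + A g z)"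
        using bounded_operatorsD(2) SB fun_span_mem[OF _ EX] add.hyps by blast
      thus "\<exists>f\<in>(\<lambda>A. A f) ` S. \<exists>g\<in>(\<lambda>A. A g) ` S. k = (\<lambda>z. f z + g z)" using A by blast
    qed
  next
    case (scale f c)
    have "(\<lambda>A. A (\<lambda>z. c * f z)) ` S \<subseteq> (\<lambda>f z. c * f z) ` ((\<lambda>A. A f) ` S)"
    proof
      fix k assume "k \<in> (\<lambda>A. A (\<lambda>z. c * f z)) ` S"
      then obtain A where A: "A \<in> S" "k = A (\<lambda>z. c * f z)" by auto
      hence "k = (\<lambda>z. c * A f z)"
        using bounded_operatorsD(3) SB fun_span_mem[OF _ EX] scale.hyps by blast
      thus "k \<in> (\<lambda>f z. c * f z) ` ((\<lambda>A. A f) ` S)" using A by blast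
    qed
    thus ?case using precompact_scale[OF scale.IH] precompact_subset by blast
  qed
  have orbit: "precompact ((\<lambda>A. A f) ` S)" if f: "f \<in> X" for f
  proof (rule precompact_approx)
    show "(\<lambda>A. A f) ` S \<subseteq> X" using SX f by auto
    fix \<epsilon> :: real assume e: "\<epsilon> > 0"
    obtain g where g: "g \<in> fun_span E" "d f g < \<epsilon> / M" using total[OF f, of "\<epsilon> / M"] e Mpos by auto
    have gX: "g \<in> X" by (rule fun_span_mem[OF g(1) EX])
    have "d (A f) (A g) < \<epsilon>" if A: "A \<in> S" for A
    proof -
      have "d (A f) (A g) = N (A (\<lambda>z. f z - g z))"
        using bounded_operatorsD(4)[of A f g] SB A f gX by auto
      also have "\<dots> \<le> M * d f g" by (intro M A diff_mem f gX)
      also have "\<dots> < \<epsilon>" using g Mpos by (simp add: field_simps)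
      finally show ?thesis .
    qed
    thus "\<exists>R. precompact R \<and> (\<forall>f\<in>(\<lambda>A. A f) ` S. \<exists>g\<in>R. d f g < \<epsilon>)"
      using orbit[OF g(1)] by blast
  qed
  define K where "K f = metr.mtopology closure_of ((\<lambda>A. A f) ` S)" for f
  have Kc: "compactin metr.mtopology (K f)" if "f \<in> X" for f
    using precompact_imp_compact_closure[OF orbit[OF that]] by (simp add: K_def)
  let ?P = "product_topology (\<lambda>_. metr.mtopology) X"
  \<comment> \<open>Tychonoff's theorem for the closures of the orbits. The product of these compact
    sets is also closed, because a product of metric spaces is Hausdorff.\<close>
  have cP: "compactin ?P (PiE X K)" using Kc by (simp add: compactin_PiE)
  have sub: "S \<subseteq> PiE X K"
  proof
    fix A assume A: "A \<in> S"
    have "A \<in> X \<rightarrow>\<^sub>E X" using SB A by (auto simp: bounded_operators_def)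
    moreover have "A f \<in> K f" if "f \<in> X" for f
      unfolding K_def using SX A that
      by (intro subsetD[OF closure_of_subset]) auto
    ultimately show "A \<in> PiE X K" by (auto simp: PiE_iff)
  qed
  have "closedin ?P (PiE X K)"
    by (rule compactin_imp_closedin[OF _ cP])
      (simp add: Hausdorff_space_product_topology metr.Hausdorff_space_mtopology)
  hence "?P closure_of S \<subseteq> PiE X K" using sub by (simp add: closure_of_minimal)
  hence comp: "compactin ?P (?P closure_of S)"
    using closed_compactin[OF cP] closedin_closure_of by blast
  have clB: "?P closure_of S \<subseteq> bounded_operators X N"
    using product_closure_bounded_operators[OF SB, of M] M by blast
  \<comment> \<open>The closure in the product already consists of bounded operators, so passing to
    the subspace loses no limit point.\<close>
  have "strong_operator_topology X N closure_of S = bounded_operators X N \<inter> ?P closure_of S"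
    unfolding strong_operator_topology_def norm_topology_eq closure_of_subtopology
    using SB by (simp add: Int_absorb1)
  also have "\<dots> = ?P closure_of S" using clB by blast
  finally show "compactin (strong_operator_topology X N) (strong_operator_topology X N closure_of S)"
    using comp clB by (simp add: strong_operator_topology_def norm_topology_eq compactin_subtopology)
qed

end

section \<open>Hardy means and subordination\<close>

lemma rcis_sphere: "0 \<le> r \<Longrightarrow> rcis r \<theta> \<in> sphere 0 r"
  by (simp add: rcis_def norm_mult)

lemma norm_rcis: "norm (rcis r \<theta>) = \<bar>r\<bar>"
  by (simp add: rcis_def norm_mult)

lemma continuous_on_rcis [continuous_intros]: "continuous_on S (rcis r)"
  unfolding rcis_def[abs_def] by (intro continuous_intros)

lemma continuous_on_rcis_compose:
  assumes "continuous_on (sphere 0 r) f" "0 \<le> r"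
  shows "continuous_on S (\<lambda>\<theta>. f (rcis r \<theta>))"
  by (rule continuous_on_compose2[OF assms(1) continuous_on_rcis])
    (use rcis_sphere[OF assms(2)] in auto)

lemma continuous_on_norm_powr:
  fixes f :: "'a::topological_space \<Rightarrow> complex"
  assumes "continuous_on S f" "0 < p"
  shows "continuous_on S (\<lambda>x. norm (f x) powr p)"
  using assms by (intro continuous_on_powr' continuous_intros) auto

lemma integrable_hardy_mean:
  fixes f :: "complex \<Rightarrow> complex"
  assumes "continuous_on (sphere 0 r) f" "0 \<le> r" "0 < p"
  shows "(\<lambda>\<theta>. norm (f (rcis r \<theta>)) powr p) integrable_on {0..2 * pi}"
  by (intro integrable_continuous_interval continuous_on_norm_powr continuous_on_rcis_compose[of r f] assms)

text \<open>Holds for every function, since a non-integrable integrand has integral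
  \<open>0\<close>.\<close>

lemma hardy_mean_nonneg: "0 \<le> hardy_mean p f r"
  unfolding hardy_mean_def
  by (cases "(\<lambda>\<theta>. norm (f (rcis r \<theta>)) powr p) integrable_on {0..2 * pi}")
    (auto simp: not_integrable_integral intro: integral_nonneg)

lemma hardy_mean_cong:
  assumes "0 \<le> r" "\<And>z. norm z = r \<Longrightarrow> norm (f z) = norm (g z)"
  shows "hardy_mean p f r = hardy_mean p g r"
  unfolding hardy_mean_def
  by (rule integral_cong) (use assms rcis_sphere[OF assms(1)] in auto)

lemma hardy_mean_mono:
  assumes "continuous_on (sphere 0 r) f" "continuous_on (sphere 0 r) g" "0 \<le> r" "0 < p"
    and "\<And>z. norm z = r \<Longrightarrow> norm (f z) \<le> norm (g z)"
  shows "hardy_mean p f r \<le> hardy_mean p g r"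
  unfolding hardy_mean_def
  by (intro integral_le integrable_hardy_mean assms powr_mono2)
    (use assms in \<open>auto simp: norm_rcis\<close>)

lemma hardy_mean_cmult:
  "hardy_mean p (\<lambda>z. c * f z) r = norm c powr p * hardy_mean p f r"
  unfolding hardy_mean_def by (simp add: norm_mult powr_mult)

lemma hardy_mean_le_bound:
  assumes "continuous_on (sphere 0 r) f" "0 \<le> r" "0 < p"
    and "\<And>z. norm z = r \<Longrightarrow> norm (f z) \<le> B"
  shows "hardy_mean p f r \<le> 2 * pi * B powr p"
proof -
  have "integral {0..2*pi} (\<lambda>\<theta>. norm (f (rcis r \<theta>)) powr p) \<le> integral {0..2*pi} (\<lambda>\<theta>. B powr p)"
    by (intro integral_le integrable_hardy_mean assms powr_mono2)
      (use assms in \<open>auto simp: norm_rcis\<close>)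
  thus ?thesis by (simp add: hardy_mean_def)
qed

section \<open>Convexity of powers and Minkowski's inequality\<close>

text \<open>A convex function lies above its tangents. The endpoint \<open>x = 0\<close> is checked
  by hand because the derivative is taken within the open half-line. Jensen's inequality is used
  below in this tangent form, for two points and for the Poisson kernel.\<close>

lemma powr_tangent:
  fixes x m p :: real
  assumes "0 \<le> x" "0 < m" "1 \<le> p"
  shows "m powr p + p * m powr (p - 1) * (x - m) \<le> x powr p"
proof (cases "x = 0")
  case True
  have "m powr p = m powr (p - 1) * m" using assms by (simp add: powr_diff)
  hence "m powr p + p * m powr (p - 1) * (x - m) = (1 - p) * m powr p"
    using True by (simp add: algebra_simps)
  also have "\<dots> \<le> 0" using assms by (simp add: mult_nonpos_nonneg)
  finally show ?thesis using True by simp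
next
  case False
  have "x powr p - m powr p \<ge> (p * m powr (p - 1)) * (x - m)"
  proof (rule convex_on_imp_above_tangent[OF powr_convex[OF assms(3)], of m])
    show "((\<lambda>x. x powr p) has_real_derivative p * m powr (p - 1)) (at m within {0<..})"
      using assms by (auto intro!: derivative_eq_intros)
  qed (use assms False in \<open>auto simp: interior_open\<close>)
  thus ?thesis by simp
qed

text \<open>The tangent at the mean bounds both powers from below, and in the weighted sum its
  linear terms cancel.\<close>

lemma powr_convex_combination:
  fixes s t a b p :: real
  assumes "0 \<le> s" "0 \<le> t" "0 \<le> a" "0 \<le> b" "a + b = 1" "1 \<le> p"
  shows "(a * s + b * t) powr p \<le> a * s powr p + b * t powr p"
proof (cases "a * s + b * t = 0")
  case True
  thus ?thesis using assms by simp
next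
  case False
  define m where "m = a * s + b * t"
  have m: "m > 0" using False assms unfolding m_def by (smt (verit) mult_nonneg_nonneg)
  have "a * (m powr p + p * m powr (p - 1) * (s - m)) + b * (m powr p + p * m powr (p - 1) * (t - m))
      \<le> a * s powr p + b * t powr p"
    by (intro add_mono mult_left_mono powr_tangent assms m)
  moreover have "a * (m powr p + p * m powr (p - 1) * (s - m)) + b * (m powr p + p * m powr (p - 1) * (t - m))
      = (a + b) * m powr p + p * m powr (p - 1) * ((a * s + b * t) - (a + b) * m)"
    by (simp add: algebra_simps)
  ultimately show ?thesis using assms by (simp add: m_def)
qed

text \<open>\<open>norm (f z + g z) / (A + B)\<close> is at most the convex combination of
  \<open>norm (f z) / A\<close> and \<open>norm (g z) / B\<close> with weights
  \<open>A / (A + B)\<close> and \<open>B / (A + B)\<close>. Positive upper bounds \<open>A\<close>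
  and \<open>B\<close> in place of the norms avoid division by zero.\<close>

lemma hardy_mean_minkowski:
  assumes f: "continuous_on (sphere 0 r) f" and g: "continuous_on (sphere 0 r) g"
    and r: "0 \<le> r" and p: "1 \<le> p" and A: "0 < A" "hardy_mean p f r \<le> A powr p"
    and B: "0 < B" "hardy_mean p g r \<le> B powr p"
  shows "hardy_mean p (\<lambda>z. f z + g z) r \<le> (A + B) powr p"
proof -
  let ?a = "A / (A + B)" and ?b = "B / (A + B)"
  have p0: "0 < p" using p by simp
  have ab: "?a + ?b = 1" "0 \<le> ?a" "0 \<le> ?b" using A B by (simp_all add: add_divide_distrib[symmetric])
  have pt: "norm (f z + g z) powr p \<le>
      (A + B) powr p * (?a * (norm (f z) powr p / A powr p) + ?b * (norm (g z) powr p / B powr p))" for z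
  proof -
    have "norm (f z + g z) \<le> norm (f z) + norm (g z)" by (rule norm_triangle_ineq)
    also have "\<dots> = (A + B) * (?a * (norm (f z) / A) + ?b * (norm (g z) / B))"
    proof -
      have "A + B \<noteq> 0" using A B by simp
      moreover have "A / (A + B) * (x / A) = x / (A + B)" "B / (A + B) * (x / B) = x / (A + B)" for x
        using A B by auto
      ultimately show ?thesis by (simp add: add_divide_distrib[symmetric])
    qed
    finally have "norm (f z + g z) powr p \<le> ((A + B) * (?a * (norm (f z) / A) + ?b * (norm (g z) / B))) powr p"
      using p0 by (intro powr_mono2) auto
    also have "\<dots> = (A + B) powr p * (?a * (norm (f z) / A) + ?b * (norm (g z) / B)) powr p"
      using A B by (simp add: powr_mult)
    also have "\<dots> \<le> (A + B) powr p * (?a * (norm (f z) / A) powr p + ?b * (norm (g z) / B) powr p)"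
      using A B p ab by (intro mult_left_mono powr_convex_combination) auto
    finally show ?thesis using A B by (simp add: powr_divide)
  qed
  have I: "(\<lambda>\<theta>. norm (f (rcis r \<theta>)) powr p) integrable_on {0..2 * pi}"
    "(\<lambda>\<theta>. norm (g (rcis r \<theta>)) powr p) integrable_on {0..2 * pi}"
    using integrable_hardy_mean f g r p0 by blast+
  have "hardy_mean p (\<lambda>z. f z + g z) r \<le> integral {0..2*pi} (\<lambda>\<theta>. (A + B) powr p *
      (?a * (norm (f (rcis r \<theta>)) powr p / A powr p) + ?b * (norm (g (rcis r \<theta>)) powr p / B powr p)))"
    unfolding hardy_mean_def
    by (intro integral_le integrable_hardy_mean continuous_intros f g r p0 pt
        integrable_on_mult_right integrable_add integrable_on_divide I)
  also have "\<dots> = (A + B) powr p * (?a * (hardy_mean p f r / A powr p) + ?b * (hardy_mean p g r / B powr p))"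
    unfolding hardy_mean_def
    by (subst integral_mult_right, subst integral_add)
      (auto intro!: integrable_on_mult_right integrable_on_divide I simp del: times_divide_eq_left)
  also have "\<dots> \<le> (A + B) powr p * (?a * 1 + ?b * 1)"
    using A B by (intro mult_left_mono add_mono) (auto simp: divide_le_eq)
  also have "\<dots> = (A + B) powr p" using ab(1) by simp
  finally show ?thesis .
qed

text \<open>The pointwise estimate compares with twice the larger summand. The constant is worse
  than in Minkowski's inequality, but no roots of means appear, so approximation errors can be
  tracked as \<open>p\<close>-th powers.\<close>

lemma hardy_mean_add_le:
  assumes f: "continuous_on (sphere 0 r) f" and g: "continuous_on (sphere 0 r) g"
    and r: "0 \<le> r" and p: "0 < p"
  shows "hardy_mean p (\<lambda>z. f z + g z) r \<le> 2 powr p * (hardy_mean p f r + hardy_mean p g r)"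
proof -
  have pt: "norm (a + b) powr p \<le> 2 powr p * (norm a powr p + norm b powr p)" for a b :: complex
  proof -
    have "norm (a + b) \<le> 2 * max (norm a) (norm b)"
      using norm_triangle_ineq[of a b] by simp
    hence "norm (a + b) powr p \<le> (2 * max (norm a) (norm b)) powr p"
      using p by (intro powr_mono2) auto
    also have "\<dots> = 2 powr p * max (norm a) (norm b) powr p" by (simp add: powr_mult)
    also have "\<dots> \<le> 2 powr p * (norm a powr p + norm b powr p)"
      by (intro mult_left_mono) (auto simp: max_def)
    finally show ?thesis .
  qed
  have I: "(\<lambda>\<theta>. norm (f (rcis r \<theta>)) powr p) integrable_on {0..2 * pi}"
    "(\<lambda>\<theta>. norm (g (rcis r \<theta>)) powr p) integrable_on {0..2 * pi}"
    using integrable_hardy_mean f g r p by blast+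
  have "hardy_mean p (\<lambda>z. f z + g z) r \<le> integral {0..2*pi} (\<lambda>\<theta>. 2 powr p *
      (norm (f (rcis r \<theta>)) powr p + norm (g (rcis r \<theta>)) powr p))"
    unfolding hardy_mean_def
    by (intro integral_le integrable_hardy_mean continuous_intros f g r p pt
        integrable_on_mult_right integrable_add I)
  also have "\<dots> = 2 powr p * (hardy_mean p f r + hardy_mean p g r)"
    unfolding hardy_mean_def by (simp add: integral_add[OF I])
  finally show ?thesis .
qed

lemma hardy_mean_tendsto:
  assumes F: "\<And>n. continuous_on (sphere 0 r) (F n)"
    and u: "uniform_limit (sphere 0 r) F f sequentially"
    and r: "0 \<le> r" and p: "0 < p"
  shows "(\<lambda>n. hardy_mean p (F n) r) \<longlonglongrightarrow> hardy_mean p f r"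
proof -
  have f: "continuous_on (sphere 0 r) f"
    by (rule uniform_limit_theorem[OF _ u]) (auto simp: F)
  have "compact (f ` sphere 0 r)" by (intro compact_continuous_image f) simp
  then obtain B where B: "\<And>z. norm z = r \<Longrightarrow> norm (f z) \<le> B"
    by (metis bounded_iff compact_imp_bounded dist_0_norm imageI mem_sphere)
  obtain m where m: "\<And>n z. n \<ge> m \<Longrightarrow> norm z = r \<Longrightarrow> norm (F n z - f z) < 1"
    using uniform_limitD[OF u, of 1] unfolding eventually_sequentially dist_norm
    by (metis dist_0_norm mem_sphere zero_less_one)
  \<comment> \<open>From index \<open>m\<close> on the functions are within \<open>1\<close> of
    \<open>f\<close>, so the shifted sequence has the constant dominating function
    \<open>(B + 1) powr p\<close>.\<close>
  have "(\<lambda>n. hardy_mean p (F (n + m)) r) \<longlonglongrightarrow> hardy_mean p f r"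
    unfolding hardy_mean_def
  proof (rule dominated_convergence(2)[where h = "\<lambda>_. (B + 1) powr p"])
    show "(\<lambda>\<theta>. norm (F (n + m) (rcis r \<theta>)) powr p) integrable_on {0..2 * pi}" for n
      by (rule integrable_hardy_mean[OF F r p])
    show "(\<lambda>_. (B + 1) powr p) integrable_on {0..2 * pi}"
      by (simp add: integrable_const_ivl)
    show "norm (norm (F (n + m) (rcis r \<theta>)) powr p) \<le> (B + 1) powr p" if "\<theta> \<in> {0..2*pi}" for n \<theta>
    proof -
      have nz: "norm (rcis r \<theta>) = r" using r by (simp add: norm_rcis)
      have "norm (F (n + m) (rcis r \<theta>)) \<le> norm (F (n + m) (rcis r \<theta>) - f (rcis r \<theta>)) + norm (f (rcis r \<theta>))"
        by (metis diff_add_cancel norm_triangle_ineq)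
      also have "\<dots> \<le> B + 1" using m[of "n + m", OF _ nz] B[OF nz] by simp
      finally show ?thesis using p by (auto intro: powr_mono2)
    qed
    show "(\<lambda>n. norm (F (n + m) (rcis r \<theta>)) powr p) \<longlonglongrightarrow> norm (f (rcis r \<theta>)) powr p"
      if "\<theta> \<in> {0..2*pi}" for \<theta>
    proof -
      have "(\<lambda>n. F n (rcis r \<theta>)) \<longlonglongrightarrow> f (rcis r \<theta>)"
        using tendsto_uniform_limitI[OF u] rcis_sphere[OF r] by blast
      hence "(\<lambda>n. F (n + m) (rcis r \<theta>)) \<longlonglongrightarrow> f (rcis r \<theta>)" by (rule LIMSEQ_ignore_initial_segment)
      thus ?thesis using p by (intro tendsto_powr' tendsto_intros) auto
    qed
  qed
  thus ?thesis by (rule LIMSEQ_offset)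
qed

section \<open>Cauchy and Poisson formulas on circles\<close>

lemma Cauchy_circle_integral:
  fixes f :: "complex \<Rightarrow> complex"
  assumes "continuous_on (cball 0 R) f" "f holomorphic_on ball 0 R" "norm z < R"
  shows "((\<lambda>\<theta>. f (rcis R \<theta>) * (rcis R \<theta> / (rcis R \<theta> - z))) has_integral 2 * pi * f z) {0..2 * pi}"
proof -
  have "((\<lambda>u. f u / (u - z)) has_contour_integral 2 * of_real pi * \<i> * f z) (circlepath 0 R)"
    by (rule Cauchy_integral_circlepath) (use assms in auto)
  hence "((\<lambda>t. f (rcis R t) / (rcis R t - z) * R * \<i> * cis t) has_integral 2 * of_real pi * \<i> * f z) {0..2*pi}"
    unfolding circlepath_def by (subst (asm) has_contour_integral_part_circlepath_iff) (auto simp: rcis_def)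
  hence "((\<lambda>t. (f (rcis R t) / (rcis R t - z) * R * \<i> * cis t) * (-\<i>)) has_integral (2 * of_real pi * \<i> * f z) * (-\<i>)) {0..2*pi}"
    by (rule has_integral_mult_left)
  thus ?thesis by (simp add: rcis_def algebra_simps)
qed

lemma mean_value_circle:
  fixes f :: "complex \<Rightarrow> complex"
  assumes "continuous_on (cball 0 R) f" "f holomorphic_on ball 0 R" "0 < R"
  shows "((\<lambda>\<theta>. f (rcis R \<theta>)) has_integral 2 * pi * f 0) {0..2 * pi}"
proof -
  have *: "rcis R \<theta> \<noteq> 0" for \<theta> using assms(3) by simp
  show ?thesis using Cauchy_circle_integral[OF assms(1,2), of 0] assms(3) * by simp
qed

text \<open>Normalized to have integral \<open>2 * pi\<close> over the period, in accordance with
  \<open>hardy_mean\<close>, which carries no factor \<open>1 / (2 * pi)\<close>.\<close>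

definition poisson_kernel :: "real \<Rightarrow> complex \<Rightarrow> real \<Rightarrow> real" where
  "poisson_kernel R w \<theta> = (R\<^sup>2 - (norm w)\<^sup>2) / (norm (rcis R \<theta> - w))\<^sup>2"

lemma poisson_kernel_nonneg: "norm w < R \<Longrightarrow> 0 \<le> poisson_kernel R w \<theta>"
  unfolding poisson_kernel_def by (simp add: power_mono)

text \<open>For fixed \<open>\<theta>\<close> the kernel is thereby the real part of a holomorphic
  function of \<open>w\<close>, so it can be averaged over \<open>w\<close> by the mean value
  property.\<close>

lemma poisson_kernel_eq_Re:
  assumes "norm w < R"
  shows "poisson_kernel R w \<theta> = Re ((rcis R \<theta> + w) / (rcis R \<theta> - w))"
proof -
  let ?\<zeta> = "rcis R \<theta>"
  have n: "(norm ?\<zeta>)\<^sup>2 = R\<^sup>2" by (simp add: norm_rcis)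
  have "Re ((?\<zeta> + w) / (?\<zeta> - w)) = Re ((?\<zeta> + w) * cnj (?\<zeta> - w)) / (norm (?\<zeta> - w))\<^sup>2"
    by (subst complex_div_cnj) (simp only: Re_divide_of_real)
  also have "Re ((?\<zeta> + w) * cnj (?\<zeta> - w)) = (norm ?\<zeta>)\<^sup>2 - (norm w)\<^sup>2"
    unfolding cmod_power2 by (simp add: power2_eq_square algebra_simps)
  finally show ?thesis by (simp add: poisson_kernel_def n)
qed

text \<open>Harnack's upper bound: the numerator is \<open>(R + norm w) * (R - norm w)\<close>, and
  the denominator is at least \<open>(R - norm w)\<^sup>2\<close>.\<close>

lemma poisson_kernel_le:
  assumes "norm w < R"
  shows "poisson_kernel R w \<theta> \<le> (R + norm w) / (R - norm w)"
proof -
  have R: "0 < R" using assms norm_ge_zero[of w] by linarith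
  have "R - norm w \<le> norm (rcis R \<theta> - w)"
    using norm_triangle_ineq2[of "rcis R \<theta>" w] R by (simp add: norm_rcis)
  hence "(R - norm w)\<^sup>2 \<le> (norm (rcis R \<theta> - w))\<^sup>2" using assms by (intro power_mono) auto
  hence "poisson_kernel R w \<theta> \<le> (R\<^sup>2 - (norm w)\<^sup>2) / (R - norm w)\<^sup>2"
    unfolding poisson_kernel_def using assms
    by (intro divide_left_mono) (auto simp: power_mono intro!: mult_pos_pos)
  also have "\<dots> = (R + norm w) / (R - norm w)"
  proof -
    have "R\<^sup>2 - (norm w)\<^sup>2 = (R + norm w) * (R - norm w)"
      by (simp add: power2_eq_square algebra_simps)
    thus ?thesis using assms by (simp add: power2_eq_square)
  qed
  finally show ?thesis .
qed

lemma continuous_on_poisson_kernel: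
  assumes "continuous_on S w" "\<And>x. x \<in> S \<Longrightarrow> norm (w x) < R" "continuous_on S \<theta>"
  shows "continuous_on S (\<lambda>x. poisson_kernel R (w x) (\<theta> x))"
proof -
  have "rcis R (\<theta> x) \<noteq> w x" if "x \<in> S" for x
  proof
    assume "rcis R (\<theta> x) = w x"
    hence "norm (w x) = \<bar>R\<bar>" using norm_rcis[of R "\<theta> x"] by simp
    thus False using assms(2)[OF that] by simp
  qed
  moreover have "continuous_on S (\<lambda>x. rcis R (\<theta> x))"
    by (rule continuous_on_compose2[OF continuous_on_rcis assms(3)]) auto
  ultimately show ?thesis
    unfolding poisson_kernel_def by (intro continuous_intros assms) auto
qed

text \<open>Cauchy's formula applied to \<open>u \<mapsto> f u (R\<^sup>2 - \<bar>z\<bar>\<^sup>2) / (R\<^sup>2 - cnj z u)\<close>.\<close>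
lemma Poisson_formula:
  fixes f :: "complex \<Rightarrow> complex"
  assumes f: "continuous_on (cball 0 R) f" "f holomorphic_on ball 0 R" and z: "norm z < R"
  shows "((\<lambda>\<theta>. of_real (poisson_kernel R z \<theta>) * f (rcis R \<theta>)) has_integral 2 * pi * f z) {0..2 * pi}"
proof -
  have R: "0 < R" using z norm_ge_zero[of z] by linarith
  let ?g = "\<lambda>u. f u * (of_real (R\<^sup>2 - (norm z)\<^sup>2) / (of_real (R\<^sup>2) - cnj z * u))"
  have nz: "of_real (R\<^sup>2) - cnj z * u \<noteq> 0" if "norm u \<le> R" for u
  proof
    assume "of_real (R\<^sup>2) - cnj z * u = 0"
    hence "norm (cnj z * u) = R\<^sup>2" by (metis eq_iff_diff_eq_0 norm_of_real abs_power2 power2_abs)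
    hence "R * R = norm z * norm u" by (simp add: norm_mult power2_eq_square)
    also have "\<dots> \<le> norm z * R" using that by (simp add: mult_left_mono)
    also have "\<dots> < R * R" using z R by simp
    finally show False by simp
  qed
  have "continuous_on (cball 0 R) ?g"
    by (intro continuous_intros f) (use nz in auto)
  moreover have "?g holomorphic_on ball 0 R"
    by (intro holomorphic_intros f) (use nz in auto)
  ultimately have "((\<lambda>\<theta>. ?g (rcis R \<theta>) * (rcis R \<theta> / (rcis R \<theta> - z))) has_integral 2 * pi * ?g z) {0..2 * pi}"
    using Cauchy_circle_integral[of R ?g z] z by blast
  moreover have "?g z = f z"
  proof -
    have "cnj z * z = of_real ((norm z)\<^sup>2)" by (metis complex_norm_square mult.commute)
    thus ?thesis using nz[of z] z by simp
  qed
  moreover have "?g (rcis R \<theta>) * (rcis R \<theta> / (rcis R \<theta> - z)) = of_real (poisson_kernel R z \<theta>) * f (rcis R \<theta>)" for \<theta>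
  proof -
    let ?\<zeta> = "rcis R \<theta>"
    have \<zeta>: "norm ?\<zeta> = R" using R by (simp add: norm_rcis)
    have R2: "of_real (R\<^sup>2) = ?\<zeta> * cnj ?\<zeta>" by (metis \<zeta> complex_norm_square of_real_power)
    have nz': "?\<zeta> \<noteq> 0" "?\<zeta> \<noteq> z" using \<zeta> R z by auto
    \<comment> \<open>On the circle \<open>R\<^sup>2\<close> equals
      \<open>?\<zeta> * cnj ?\<zeta>\<close>, which turns the auxiliary factor times the Cauchy
      kernel into the Poisson kernel.\<close>
    have "of_real (R\<^sup>2) - cnj z * ?\<zeta> = ?\<zeta> * cnj (?\<zeta> - z)" unfolding R2 by (simp add: algebra_simps)
    hence "?g ?\<zeta> * (?\<zeta> / (?\<zeta> - z)) = f ?\<zeta> * of_real (R\<^sup>2 - (norm z)\<^sup>2) / (cnj (?\<zeta> - z) * (?\<zeta> - z))"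
      using nz' by simp
    also have "cnj (?\<zeta> - z) * (?\<zeta> - z) = of_real ((norm (?\<zeta> - z))\<^sup>2)"
      by (metis complex_norm_square mult.commute)
    finally show ?thesis by (simp add: poisson_kernel_def)
  qed
  ultimately show ?thesis by (simp only:)
qed

lemma poisson_kernel_integral:
  assumes "norm z < R"
  shows "(poisson_kernel R z has_integral 2 * pi) {0..2 * pi}"
  using has_integral_linear[OF Poisson_formula[of R "\<lambda>_. 1" z] bounded_linear_Re] assms
  by (simp add: o_def)

text \<open>Jensen's inequality for the measure given by the kernel: the tangent of the power at
  \<open>m = norm (f z)\<close> is integrated, and its linear part contributes nonnegatively since
  \<open>2 * pi * m\<close> is at most the Poisson integral of \<open>norm f\<close>. The case
  \<open>m = 0\<close> is separate because the tangent is taken at a positive point.\<close>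

lemma Poisson_inequality:
  fixes f :: "complex \<Rightarrow> complex"
  assumes f: "continuous_on (cball 0 R) f" "f holomorphic_on ball 0 R" and z: "norm z < R"
    and p: "1 \<le> p"
  shows "2 * pi * norm (f z) powr p \<le> integral {0..2*pi} (\<lambda>\<theta>. poisson_kernel R z \<theta> * norm (f (rcis R \<theta>)) powr p)"
proof -
  have R: "0 < R" using z norm_ge_zero[of z] by linarith
  have fs: "continuous_on (sphere 0 R) f"
    using continuous_on_subset[OF f(1)] by (simp add: sphere_cball)
  have cP: "continuous_on {0..2*pi} (poisson_kernel R z)"
    using continuous_on_poisson_kernel[of "{0..2*pi}" "\<lambda>_. z" R "\<lambda>x. x"] z by simp
  have cf: "continuous_on {0..2*pi} (\<lambda>\<theta>. f (rcis R \<theta>))"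
    by (rule continuous_on_rcis_compose[OF fs]) (use R in simp)
  define m where "m = norm (f z)"
  show ?thesis
  proof (cases "m = 0")
    case True
    have "0 \<le> integral {0..2*pi} (\<lambda>\<theta>. poisson_kernel R z \<theta> * norm (f (rcis R \<theta>)) powr p)"
      by (intro integral_nonneg integrable_continuous_interval continuous_intros cP continuous_on_norm_powr cf mult_nonneg_nonneg poisson_kernel_nonneg z)
        (use p in auto)
    thus ?thesis using True by (simp add: m_def)
  next
    case False
    hence m: "m > 0" by (simp add: m_def)
    let ?I = "integral {0..2*pi} (\<lambda>\<theta>. poisson_kernel R z \<theta> * norm (f (rcis R \<theta>)))"
    have i1: "(\<lambda>\<theta>. poisson_kernel R z \<theta> * norm (f (rcis R \<theta>))) integrable_on {0..2*pi}"
      by (intro integrable_continuous_interval continuous_intros cP cf)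
    have "norm (integral {0..2*pi} (\<lambda>\<theta>. of_real (poisson_kernel R z \<theta>) * f (rcis R \<theta>))) \<le> ?I"
      by (intro integral_norm_bound_integral has_integral_integrable[OF Poisson_formula[OF f z]] i1)
        (simp add: norm_mult poisson_kernel_nonneg[OF z])
    hence I: "2 * pi * m \<le> ?I"
      using integral_unique[OF Poisson_formula[OF f z]] by (simp add: m_def norm_mult)
    have "((\<lambda>\<theta>. (m powr p - p * m powr (p - 1) * m) * poisson_kernel R z \<theta> + p * m powr (p - 1) * (poisson_kernel R z \<theta> * norm (f (rcis R \<theta>))))
      has_integral (m powr p - p * m powr (p - 1) * m) * (2 * pi) + p * m powr (p - 1) * ?I) {0..2*pi}"
      by (intro has_integral_add has_integral_mult_right poisson_kernel_integral z integrable_integral i1)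
    hence "(m powr p - p * m powr (p - 1) * m) * (2 * pi) + p * m powr (p - 1) * ?I
      \<le> integral {0..2*pi} (\<lambda>\<theta>. poisson_kernel R z \<theta> * norm (f (rcis R \<theta>)) powr p)"
    proof (rule has_integral_le)
      show "((\<lambda>\<theta>. poisson_kernel R z \<theta> * norm (f (rcis R \<theta>)) powr p) has_integral
        integral {0..2*pi} (\<lambda>\<theta>. poisson_kernel R z \<theta> * norm (f (rcis R \<theta>)) powr p)) {0..2*pi}"
        by (intro integrable_integral integrable_continuous_interval continuous_intros cP continuous_on_norm_powr cf)
          (use p in auto)
      fix \<theta>
      have "poisson_kernel R z \<theta> * (m powr p + p * m powr (p - 1) * (norm (f (rcis R \<theta>)) - m)) \<le>
        poisson_kernel R z \<theta> * norm (f (rcis R \<theta>)) powr p"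
        by (intro mult_left_mono powr_tangent m p poisson_kernel_nonneg z) auto
      thus "(m powr p - p * m powr (p - 1) * m) * poisson_kernel R z \<theta> + p * m powr (p - 1) * (poisson_kernel R z \<theta> * norm (f (rcis R \<theta>)))
        \<le> poisson_kernel R z \<theta> * norm (f (rcis R \<theta>)) powr p"
        by (simp add: algebra_simps)
    qed
    moreover have "p * m powr (p - 1) * (2 * pi * m) \<le> p * m powr (p - 1) * ?I"
      using p by (intro mult_left_mono I) auto
    ultimately show ?thesis by (simp add: m_def algebra_simps)
  qed
qed

text \<open>\<open>norm (f (\<phi> z)) powr p\<close> is dominated by a Poisson integral of
  \<open>norm f powr p\<close>. Averaging over the circle of radius \<open>r\<close> and exchanging
  the integrals leaves the average of the kernel, which is its value at \<open>\<phi> 0\<close>, and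
  Harnack's bound finishes. With two radii all functions are continuous up to the circles.\<close>

theorem Littlewood_subordination:
  assumes f: "continuous_on (cball 0 R) f" "f holomorphic_on ball 0 R"
    and \<phi>: "continuous_on (cball 0 r) \<phi>" "\<phi> holomorphic_on ball 0 r" "0 < r"
    and less: "\<And>z. norm z \<le> r \<Longrightarrow> norm (\<phi> z) < R" and p: "1 \<le> p"
  shows "hardy_mean p (\<lambda>z. f (\<phi> z)) r \<le> (R + norm (\<phi> 0)) / (R - norm (\<phi> 0)) * hardy_mean p f R"
proof -
  have "norm (\<phi> 0) < R" using less \<phi>(3) by simp
  hence R: "0 < R" using norm_ge_zero[of "\<phi> 0"] by linarith
  have nr: "norm (rcis r t) = r" for t using \<phi>(3) by (simp add: norm_rcis)
  have fs: "continuous_on (sphere 0 R) f"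
    using continuous_on_subset[OF f(1)] by (simp add: sphere_cball)
  have \<phi>s: "continuous_on (sphere 0 r) \<phi>"
    using continuous_on_subset[OF \<phi>(1)] by (simp add: sphere_cball)
  have cf: "continuous_on S (\<lambda>\<theta>. f (rcis R \<theta>))" for S
    by (rule continuous_on_rcis_compose[OF fs]) (use R in simp)
  have c\<phi>: "continuous_on S (\<lambda>t. \<phi> (rcis r t))" for S
    by (rule continuous_on_rcis_compose[OF \<phi>s]) (use \<phi> in simp)
  have cf\<phi>: "continuous_on (sphere 0 r) (\<lambda>z. f (\<phi> z))"
    by (rule continuous_on_compose2[OF f(1) \<phi>s]) (auto intro: less_imp_le[OF less])
  let ?K = "\<lambda>t \<theta>. poisson_kernel R (\<phi> (rcis r t)) \<theta> * norm (f (rcis R \<theta>)) powr p"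
  have cP: "continuous_on S (\<lambda>x. poisson_kernel R (\<phi> (rcis r (fst x))) (snd x))" for S
    by (intro continuous_on_poisson_kernel continuous_on_compose2[OF c\<phi> continuous_on_fst] continuous_intros)
      (use \<phi>(3) in \<open>auto simp: nr intro!: less\<close>)
  have "continuous_on S (\<lambda>x. f (rcis R (snd x)))" for S :: "(real \<times> real) set"
    by (rule continuous_on_compose2[OF cf[of UNIV]]) (auto intro: continuous_intros)
  hence cK: "continuous_on S (\<lambda>x. ?K (fst x) (snd x))" for S
    by (intro continuous_intros cP continuous_on_norm_powr) (use p in auto)
  have swap: "integral {0..2*pi} (\<lambda>t. integral {0..2*pi} (?K t)) = integral {0..2*pi} (\<lambda>\<theta>. integral {0..2*pi} (\<lambda>t. ?K t \<theta>))"
    using integral_swap_continuous[of 0 0 "2*pi" "2*pi" ?K] cK by (simp add: case_prod_beta')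
  have outer: "(\<lambda>t. integral {0..2*pi} (?K t)) integrable_on {0..2*pi}"
    using integral_integrable_2dim[of 0 0 "2*pi" "2*pi" "\<lambda>x. ?K (fst x) (snd x)"] cK by simp
  have inner: "integral {0..2*pi} (\<lambda>t. ?K t \<theta>) = 2 * pi * poisson_kernel R (\<phi> 0) \<theta> * norm (f (rcis R \<theta>)) powr p" for \<theta>
  proof -
    let ?u = "\<lambda>z. (rcis R \<theta> + \<phi> z) / (rcis R \<theta> - \<phi> z)"
    have nz: "rcis R \<theta> \<noteq> \<phi> z" if "norm z \<le> r" for z
      using less[OF that] R norm_rcis[of R \<theta>] by (metis abs_of_pos less_irrefl)
    have "((\<lambda>t. ?u (rcis r t)) has_integral 2 * pi * ?u 0) {0..2*pi}"
      by (rule mean_value_circle) (intro continuous_intros holomorphic_intros \<phi>; use nz \<phi> in auto)+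
    moreover have "Re (complex_of_real c * w) = c * Re w" for c w by simp
    ultimately have "((\<lambda>t. Re (?u (rcis r t))) has_integral 2 * pi * Re (?u 0)) {0..2*pi}"
      using has_integral_linear[OF _ bounded_linear_Re] unfolding o_def by metis
    hence "((\<lambda>t. poisson_kernel R (\<phi> (rcis r t)) \<theta>) has_integral 2 * pi * poisson_kernel R (\<phi> 0) \<theta>) {0..2*pi}"
      using poisson_kernel_eq_Re less \<phi>(3) nr by simp
    hence "((\<lambda>t. ?K t \<theta>) has_integral 2 * pi * poisson_kernel R (\<phi> 0) \<theta> * norm (f (rcis R \<theta>)) powr p) {0..2*pi}"
      by (rule has_integral_mult_left)
    thus ?thesis by (rule integral_unique)
  qed
  have "2 * pi * hardy_mean p (\<lambda>z. f (\<phi> z)) r = integral {0..2*pi} (\<lambda>t. 2 * pi * norm (f (\<phi> (rcis r t))) powr p)"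
    by (simp add: hardy_mean_def)
  also have "\<dots> \<le> integral {0..2*pi} (\<lambda>t. integral {0..2*pi} (?K t))"
    by (intro integral_le outer integrable_on_mult_right integrable_hardy_mean[of _ "\<lambda>z. f (\<phi> z)"] cf\<phi> Poisson_inequality f p)
      (use \<phi> p nr less in auto)
  also have "\<dots> = integral {0..2*pi} (\<lambda>\<theta>. 2 * pi * poisson_kernel R (\<phi> 0) \<theta> * norm (f (rcis R \<theta>)) powr p)"
    unfolding swap inner ..
  also have "\<dots> \<le> integral {0..2*pi} (\<lambda>\<theta>. 2 * pi * ((R + norm (\<phi> 0)) / (R - norm (\<phi> 0))) * norm (f (rcis R \<theta>)) powr p)"
  proof (rule integral_le)
    have "continuous_on {0..2*pi} (\<lambda>\<theta>. poisson_kernel R (\<phi> 0) \<theta>)"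
      using \<phi>(3) by (intro continuous_on_poisson_kernel continuous_intros less) auto
    thus "(\<lambda>\<theta>. 2 * pi * poisson_kernel R (\<phi> 0) \<theta> * norm (f (rcis R \<theta>)) powr p) integrable_on {0..2*pi}"
      by (intro integrable_continuous_interval continuous_intros continuous_on_norm_powr cf) (use p in auto)
    show "(\<lambda>\<theta>. 2 * pi * ((R + norm (\<phi> 0)) / (R - norm (\<phi> 0))) * norm (f (rcis R \<theta>)) powr p) integrable_on {0..2*pi}"
      by (intro integrable_continuous_interval continuous_intros continuous_on_norm_powr cf) (use p less[of 0] \<phi>(3) in auto)
    have "norm (\<phi> 0) < R" using less \<phi>(3) by simp
    thus "2 * pi * poisson_kernel R (\<phi> 0) \<theta> * norm (f (rcis R \<theta>)) powr p
        \<le> 2 * pi * ((R + norm (\<phi> 0)) / (R - norm (\<phi> 0))) * norm (f (rcis R \<theta>)) powr p" for \<theta>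
      by (intro mult_right_mono mult_left_mono poisson_kernel_le) auto
  qed
  also have "\<dots> = 2 * pi * ((R + norm (\<phi> 0)) / (R - norm (\<phi> 0)) * hardy_mean p f R)"
    by (simp add: hardy_mean_def)
  finally show ?thesis by (rule mult_left_le_imp_le) simp
qed

section \<open>The Hardy space as a Banach space\<close>

lemma holomorphic_on_disc_continuous:
  assumes "f holomorphic_on \<D>" "r < 1"
  shows "continuous_on (sphere 0 r) f" "continuous_on (cball 0 r) f"
  by (rule holomorphic_on_imp_continuous_on[OF holomorphic_on_subset[OF assms(1)]]; use assms(2) in auto)+

text \<open>Subordination for the identity map, where the factor is \<open>1\<close> because the
  origin is fixed. It asks for a strict inequality of radii, so equal radii are separated.\<close>

lemma hardy_mean_radius_mono:
  assumes f: "continuous_on (cball 0 R) f" "f holomorphic_on ball 0 R"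
    and "0 < s" "s \<le> R" "1 \<le> p"
  shows "hardy_mean p f s \<le> hardy_mean p f R"
proof (cases "s = R")
  case False
  have "hardy_mean p (\<lambda>z. f (id z)) s \<le> (R + norm (id 0 :: complex)) / (R - norm (id 0 :: complex)) * hardy_mean p f R"
    by (rule Littlewood_subordination[OF f]) (use assms False in auto)
  thus ?thesis using assms by simp
qed simp

lemma hardy_mean_radius_mono_disc:
  assumes "f holomorphic_on \<D>" "0 < s" "s \<le> R" "R < 1" "1 \<le> p"
  shows "hardy_mean p f s \<le> hardy_mean p f R"
  by (rule hardy_mean_radius_mono)
    (use assms holomorphic_on_disc_continuous[of f R] holomorphic_on_subset[of f \<D> "ball 0 R"] in auto)

text \<open>The Poisson inequality on the circle of radius halfway between \<open>s\<close> and
  \<open>1\<close>. The kernel is at most \<open>4 / (1 - s)\<close> there, and the remaining factor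
  \<open>4 / (2 * pi)\<close> is at most \<open>1\<close>.\<close>

lemma hardy_point_bound:
  assumes f: "f holomorphic_on \<D>" and B: "\<And>r. 0 < r \<Longrightarrow> r < 1 \<Longrightarrow> hardy_mean p f r \<le> B"
    and z: "norm z \<le> s" "s < 1" and p: "1 \<le> p"
  shows "norm (f z) powr p \<le> B / (1 - s)"
proof -
  define R where "R = (1 + s) / 2"
  have "0 \<le> s" using z norm_ge_zero[of z] by linarith
  hence R: "0 < R" "s < R" "R < 1" using z by (auto simp: R_def)
  have zR: "norm z < R" using z R by simp
  have "2 * pi * norm (f z) powr p \<le> integral {0..2*pi} (\<lambda>\<theta>. poisson_kernel R z \<theta> * norm (f (rcis R \<theta>)) powr p)"
    by (rule Poisson_inequality[OF holomorphic_on_disc_continuous(2)[OF f R(3)] holomorphic_on_subset[OF f] zR p])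
      (use R in auto)
  also have "\<dots> \<le> integral {0..2*pi} (\<lambda>\<theta>. 4 / (1 - s) * norm (f (rcis R \<theta>)) powr p)"
  proof (rule integral_le)
    have cf: "continuous_on {0..2*pi} (\<lambda>\<theta>. f (rcis R \<theta>))"
      by (rule continuous_on_rcis_compose[OF holomorphic_on_disc_continuous(1)[OF f R(3)]]) (use R in simp)
    have cP: "continuous_on {0..2*pi} (poisson_kernel R z)"
      using continuous_on_poisson_kernel[of "{0..2*pi}" "\<lambda>_. z" R "\<lambda>x. x"] zR by simp
    show "(\<lambda>\<theta>. poisson_kernel R z \<theta> * norm (f (rcis R \<theta>)) powr p) integrable_on {0..2*pi}"
      "(\<lambda>\<theta>. 4 / (1 - s) * norm (f (rcis R \<theta>)) powr p) integrable_on {0..2*pi}"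
      by (intro integrable_continuous_interval continuous_intros cP continuous_on_norm_powr cf; use p z in simp)+
    fix \<theta>
    have "poisson_kernel R z \<theta> \<le> (R + norm z) / (R - norm z)" by (rule poisson_kernel_le[OF zR])
    also have "\<dots> \<le> 2 / ((1 - s) / 2)" using z R by (intro frac_le) (auto simp: R_def field_simps)
    finally show "poisson_kernel R z \<theta> * norm (f (rcis R \<theta>)) powr p \<le> 4 / (1 - s) * norm (f (rcis R \<theta>)) powr p"
      by (intro mult_right_mono) auto
  qed
  also have "\<dots> = 4 / (1 - s) * hardy_mean p f R" by (simp add: hardy_mean_def)
  also have "\<dots> \<le> 4 / (1 - s) * B" using z B[of R] R by (intro mult_left_mono) auto
  finally have *: "2 * pi * norm (f z) powr p \<le> 4 * (B / (1 - s))" by simp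
  have "B \<ge> 0" using B[of R] R hardy_mean_nonneg[of p f R] by linarith
  hence "4 * (B / (1 - s)) \<le> 2 * pi * (B / (1 - s))"
    using pi_ge_two z by (intro mult_right_mono) auto
  with * have "2 * pi * norm (f z) powr p \<le> 2 * pi * (B / (1 - s))" by linarith
  thus ?thesis by (rule mult_left_le_imp_le) simp
qed

lemma hardy_spaceI:
  assumes "f holomorphic_on \<D>" "\<And>z. z \<notin> \<D> \<Longrightarrow> f z = 0"
    and "\<And>r. 0 < r \<Longrightarrow> r < 1 \<Longrightarrow> hardy_mean p f r \<le> C"
  shows "f \<in> hardy_space p"
  using assms by (auto simp: hardy_space_def intro!: bdd_aboveI[of _ C])

lemma hardy_spaceD:
  assumes "f \<in> hardy_space p"
  shows "f holomorphic_on \<D>" "\<And>z. z \<notin> \<D> \<Longrightarrow> f z = 0"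
  using assms by (auto simp: hardy_space_def)

lemma hardy_norm_le:
  assumes "\<And>r. 0 < r \<Longrightarrow> r < 1 \<Longrightarrow> hardy_mean p f r \<le> A powr p" "0 \<le> A" "0 < p"
  shows "hardy_norm p f \<le> A"
proof -
  have "0 \<le> hardy_mean p f (1/2)" by (rule hardy_mean_nonneg)
  also have "\<dots> \<le> (SUP r\<in>{0<..<1}. hardy_mean p f r)"
    by (rule cSUP_upper) (use assms(1) in \<open>auto intro!: bdd_aboveI[of _ "A powr p"]\<close>)
  finally have "0 \<le> (SUP r\<in>{0<..<1}. hardy_mean p f r)" .
  moreover have "(SUP r\<in>{0<..<1}. hardy_mean p f r) \<le> A powr p"
    by (rule cSUP_least) (use assms(1) in auto)
  ultimately have "hardy_norm p f \<le> (A powr p) powr (1 / p)"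
    unfolding hardy_norm_def using assms(3) by (intro powr_mono2) auto
  thus ?thesis using assms by (simp add: powr_powr)
qed

lemma hardy_mean_le_norm:
  assumes "f \<in> hardy_space p" "0 < r" "r < 1" "0 < p"
  shows "hardy_mean p f r \<le> hardy_norm p f powr p"
proof -
  have bdd: "bdd_above (hardy_mean p f ` {0<..<1})" using assms(1) by (simp add: hardy_space_def)
  have "hardy_mean p f r \<le> (SUP r\<in>{0<..<1}. hardy_mean p f r)"
    by (rule cSUP_upper[OF _ bdd]) (use assms in auto)
  moreover from this have "0 \<le> (SUP r\<in>{0<..<1}. hardy_mean p f r)"
    using hardy_mean_nonneg[of p f r] by linarith
  ultimately show ?thesis using assms(4) by (simp add: hardy_norm_def powr_powr)
qed

lemma hardy_norm_point_bound:
  assumes f: "f \<in> hardy_space p" and z: "norm z \<le> s" "s < 1" and p: "1 \<le> p"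
  shows "norm (f z) \<le> (1 / (1 - s)) powr (1 / p) * hardy_norm p f"
proof -
  have "norm (f z) powr p \<le> hardy_norm p f powr p / (1 - s)"
    by (rule hardy_point_bound[OF hardy_spaceD(1)[OF f] _ z p])
      (use hardy_mean_le_norm[OF f] p in auto)
  hence "(norm (f z) powr p) powr (1 / p) \<le> (hardy_norm p f powr p / (1 - s)) powr (1 / p)"
    using p by (intro powr_mono2) auto
  also have "\<dots> = (1 / (1 - s)) powr (1 / p) * hardy_norm p f"
  proof -
    have "0 \<le> hardy_norm p f" by (simp add: hardy_norm_def)
    thus ?thesis using p z by (simp add: powr_divide powr_powr)
  qed
  finally show ?thesis using p by (simp add: powr_powr)
qed

lemma hardy_space_add:
  assumes f: "f \<in> hardy_space p" and g: "g \<in> hardy_space p" and p: "1 \<le> p"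
  shows "(\<lambda>z. f z + g z) \<in> hardy_space p" "hardy_norm p (\<lambda>z. f z + g z) \<le> hardy_norm p f + hardy_norm p g"
proof -
  have nn: "0 \<le> hardy_norm p f" "0 \<le> hardy_norm p g" by (simp_all add: hardy_norm_def)
  \<comment> \<open>Minkowski's inequality is available for positive bounds, so each norm is
    enlarged by \<open>\<epsilon>\<close>; letting \<open>\<epsilon>\<close> tend to
    \<open>0\<close> restores the norms.\<close>
  have *: "hardy_mean p (\<lambda>z. f z + g z) r \<le> (hardy_norm p f + hardy_norm p g + 2 * \<epsilon>) powr p"
    if "0 < r" "r < 1" "0 < \<epsilon>" for r \<epsilon>
  proof -
    have "hardy_mean p f r \<le> (hardy_norm p f + \<epsilon>) powr p"
      by (rule order_trans[OF hardy_mean_le_norm[OF f that(1,2)] powr_mono2]) (use p that nn in auto)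
    moreover have "hardy_mean p g r \<le> (hardy_norm p g + \<epsilon>) powr p"
      by (rule order_trans[OF hardy_mean_le_norm[OF g that(1,2)] powr_mono2]) (use p that nn in auto)
    ultimately have "hardy_mean p (\<lambda>z. f z + g z) r \<le> ((hardy_norm p f + \<epsilon>) + (hardy_norm p g + \<epsilon>)) powr p"
      using that nn p hardy_spaceD(1)[OF f] hardy_spaceD(1)[OF g]
      by (intro hardy_mean_minkowski holomorphic_on_disc_continuous(1)) auto
    thus ?thesis by (simp add: algebra_simps)
  qed
  show "(\<lambda>z. f z + g z) \<in> hardy_space p"
    by (rule hardy_spaceI[where C = "(hardy_norm p f + hardy_norm p g + 2 * 1) powr p"])
      (use *[where \<epsilon> = 1] hardy_spaceD[OF f] hardy_spaceD[OF g] in \<open>auto intro: holomorphic_intros\<close>)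
  show "hardy_norm p (\<lambda>z. f z + g z) \<le> hardy_norm p f + hardy_norm p g"
  proof (rule field_le_epsilon)
    fix \<epsilon> :: real assume "\<epsilon> > 0"
    thus "hardy_norm p (\<lambda>z. f z + g z) \<le> hardy_norm p f + hardy_norm p g + \<epsilon>"
      using *[of _ "\<epsilon>/2"] p nn by (intro hardy_norm_le) auto
  qed
qed

lemma hardy_space_scale:
  assumes f: "f \<in> hardy_space p" and p: "1 \<le> p"
  shows "(\<lambda>z. c * f z) \<in> hardy_space p" "hardy_norm p (\<lambda>z. c * f z) = norm c * hardy_norm p f"
proof -
  have le: "hardy_mean p (\<lambda>z. c * f z) r \<le> (norm c * hardy_norm p f) powr p"
    if "f \<in> hardy_space p" "0 < r" "r < 1" for r c f
    using hardy_mean_le_norm[OF that] p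
    by (simp add: hardy_mean_cmult powr_mult hardy_norm_def mult_left_mono)
  have mem: "(\<lambda>z. c * f z) \<in> hardy_space p" if f: "f \<in> hardy_space p" for c f
    by (rule hardy_spaceI[where C = "(norm c * hardy_norm p f) powr p"])
      (use le[OF f] hardy_spaceD[OF f] in \<open>auto intro: holomorphic_intros\<close>)
  have nle: "hardy_norm p (\<lambda>z. c * f z) \<le> norm c * hardy_norm p f" if f: "f \<in> hardy_space p" for c f
    by (rule hardy_norm_le) (use le[OF f] p in \<open>auto simp: hardy_norm_def\<close>)
  show "(\<lambda>z. c * f z) \<in> hardy_space p" by (rule mem[OF f])
  show "hardy_norm p (\<lambda>z. c * f z) = norm c * hardy_norm p f"
  proof (cases "c = 0")
    case True
    have "hardy_norm p (\<lambda>z. 0 * f z) \<ge> 0" by (simp add: hardy_norm_def)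
    thus ?thesis using nle[OF f, of 0] True by simp
  next
    case False
    have "hardy_norm p f \<le> norm (1 / c) * hardy_norm p (\<lambda>z. c * f z)"
      using nle[OF mem[OF f], of "1 / c" c] False by simp
    hence "norm c * hardy_norm p f \<le> hardy_norm p (\<lambda>z. c * f z)"
      using False by (simp add: norm_divide field_simps)
    thus ?thesis using nle[OF f, of c] by simp
  qed
qed

lemma hardy_space_diff:
  assumes f: "f \<in> hardy_space p" and g: "g \<in> hardy_space p" and p: "1 \<le> p"
  shows "(\<lambda>z. f z - g z) \<in> hardy_space p"
proof -
  have "(\<lambda>z. f z + (-1) * g z) \<in> hardy_space p"
    by (rule hardy_space_add(1)[OF f hardy_space_scale(1)[OF g p] p])
  thus ?thesis by simp
qed

lemma hardy_norm_minus: "hardy_norm p (\<lambda>z. - f z) = hardy_norm p f"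
  by (simp add: hardy_norm_def hardy_mean_def)

lemma hardy_mean_limit_le:
  assumes F: "\<And>n. F n holomorphic_on \<D>" and u: "uniform_limit (sphere 0 r) F f sequentially"
    and le: "\<And>n. hardy_mean p (F n) r \<le> C" and r: "0 \<le> r" "r < 1" and p: "0 < p"
  shows "hardy_mean p f r \<le> C"
  by (rule LIMSEQ_le_const2[OF hardy_mean_tendsto[OF holomorphic_on_disc_continuous(1)[OF F r(2)] u r(1) p]])
    (use le in auto)

lemma locally_uniform_limit_holomorphic:
  assumes F: "\<And>n. F n holomorphic_on \<D>"
    and u: "\<And>s. s < 1 \<Longrightarrow> uniform_limit (cball 0 s) F f sequentially"
  shows "f holomorphic_on \<D>"
proof (rule holomorphic_uniform_sequence[OF _ F])
  fix z :: complex assume z: "z \<in> \<D>"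
  define e where "e = (1 - norm z) / 2"
  have "cball z e \<subseteq> cball 0 (norm z + e)"
    using norm_triangle_sub by (auto simp: subset_iff dist_norm norm_minus_commute) (smt (verit) norm_triangle_sub)
  moreover have "norm z + e < 1" using z by (simp add: e_def field_simps)
  ultimately have "uniform_limit (cball z e) F f sequentially"
    "cball z e \<subseteq> \<D>" using u uniform_limit_on_subset by (blast, force)
  moreover have "0 < e" using z by (simp add: e_def)
  ultimately show "\<exists>d>0. cball z d \<subseteq> \<D> \<and> uniform_limit (cball z d) F f sequentially" by blast
qed auto

text \<open>Point evaluations are bounded, so a Cauchy sequence converges uniformly on smaller
  closed discs. On each circle the bound for \<open>\<sigma> n - \<sigma> m\<close> passes to the
  limit in \<open>m\<close>, with a constant independent of the circle.\<close>

lemma hardy_space_complete: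
  fixes \<sigma> :: "nat \<Rightarrow> complex \<Rightarrow> complex"
  assumes p: "1 \<le> p"
    and mem: "\<And>n. \<sigma> n \<in> hardy_space p"
    and Cau: "\<And>\<epsilon>. \<epsilon> > 0 \<Longrightarrow> \<exists>N. \<forall>m\<ge>N. \<forall>n\<ge>N. hardy_norm p (\<lambda>z. \<sigma> m z - \<sigma> n z) < \<epsilon>"
  shows "\<exists>f\<in>hardy_space p. \<forall>\<epsilon>>0. \<exists>N. \<forall>n\<ge>N. hardy_norm p (\<lambda>z. \<sigma> n z - f z) < \<epsilon>"
proof -
  have p0: "0 < p" using p by simp
  note diff = hardy_space_diff[OF _ _ p]
  define f where "f z = lim (\<lambda>n. \<sigma> n z)" for z
  have u: "uniform_limit (cball 0 s) \<sigma> f sequentially" if s: "s < 1" for s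
  proof -
    have "uniformly_Cauchy_on (cball 0 s) \<sigma>"
      unfolding uniformly_Cauchy_on_def
    proof (intro allI impI)
      fix e :: real assume e: "e > 0"
      define K where "K = (1 / (1 - s)) powr (1 / p)"
      have K: "K > 0" using s by (simp add: K_def)
      obtain N where N: "\<And>m n. m \<ge> N \<Longrightarrow> n \<ge> N \<Longrightarrow> hardy_norm p (\<lambda>z. \<sigma> m z - \<sigma> n z) < e / K"
        using Cau[of "e / K"] e K by auto
      have "dist (\<sigma> m z) (\<sigma> n z) < e" if "z \<in> cball 0 s" "m \<ge> N" "n \<ge> N" for m n z
      proof -
        have "norm (\<sigma> m z - \<sigma> n z) \<le> K * hardy_norm p (\<lambda>z. \<sigma> m z - \<sigma> n z)"
          unfolding K_def using hardy_norm_point_bound[OF diff[OF mem mem], of z s] that s p by simp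
        also have "\<dots> < e" using N[OF that(2,3)] K by (simp add: field_simps)
        finally show ?thesis by (simp add: dist_norm)
      qed
      thus "\<exists>M. \<forall>x\<in>cball 0 s. \<forall>m\<ge>M. \<forall>n\<ge>M. dist (\<sigma> m x) (\<sigma> n x) < e" by blast
    qed
    thus ?thesis
      using Cauchy_uniformly_convergent uniformly_convergent_uniform_limit_iff unfolding f_def by blast
  qed
  have hol\<sigma>: "\<sigma> n holomorphic_on \<D>" for n using hardy_spaceD(1)[OF mem] .
  have hol: "f holomorphic_on \<D>" by (rule locally_uniform_limit_holomorphic[OF hol\<sigma> u])
  have out: "f z = 0" if "z \<notin> \<D>" for z
    using hardy_spaceD(2)[OF mem that] by (simp add: f_def)
  have key: "hardy_mean p (\<lambda>z. \<sigma> n z - f z) r \<le> \<epsilon> powr p"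
    if "\<And>m. m \<ge> N \<Longrightarrow> hardy_norm p (\<lambda>z. \<sigma> n z - \<sigma> m z) < \<epsilon>" "0 < r" "r < 1" for n N \<epsilon> r
  proof (rule hardy_mean_limit_le[where F = "\<lambda>m z. \<sigma> n z - \<sigma> (m + N) z"])
    have "uniform_limit (sphere 0 r) \<sigma> f sequentially"
      by (rule uniform_limit_on_subset[OF u[OF that(3)]]) auto
    hence "uniform_limit (sphere 0 r) (\<lambda>m. \<sigma> (m + N)) f sequentially"
      using filterlim_compose[OF _ filterlim_add_const_nat_at_top[of N]] by fastforce
    thus "uniform_limit (sphere 0 r) (\<lambda>m z. \<sigma> n z - \<sigma> (m + N) z) (\<lambda>z. \<sigma> n z - f z) sequentially"
      by (intro uniform_limit_intros)
    show "hardy_mean p (\<lambda>z. \<sigma> n z - \<sigma> (m + N) z) r \<le> \<epsilon> powr p" for m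
    proof -
      have "hardy_mean p (\<lambda>z. \<sigma> n z - \<sigma> (m + N) z) r \<le> hardy_norm p (\<lambda>z. \<sigma> n z - \<sigma> (m + N) z) powr p"
        by (rule hardy_mean_le_norm[OF diff[OF mem mem] that(2,3) p0])
      also have "\<dots> \<le> \<epsilon> powr p"
        using that(1)[of "m + N"] p0 by (intro powr_mono2) (auto simp: hardy_norm_def)
      finally show ?thesis .
    qed
  qed (use that p0 hol\<sigma> in \<open>auto intro: holomorphic_intros\<close>)
  have "f \<in> hardy_space p"
  proof -
    obtain N where N: "\<And>m n. m \<ge> N \<Longrightarrow> n \<ge> N \<Longrightarrow> hardy_norm p (\<lambda>z. \<sigma> m z - \<sigma> n z) < 1"
      using Cau[of 1] by auto
    have "(\<lambda>z. \<sigma> N z - f z) \<in> hardy_space p"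
      by (rule hardy_spaceI[where C = "1 powr p"])
        (use key[of N N 1] N hol hol\<sigma>[of N] out hardy_spaceD(2)[OF mem] in \<open>auto intro: holomorphic_intros\<close>)
    from diff[OF mem[of N] this] show ?thesis by simp
  qed
  moreover have "\<exists>N. \<forall>n\<ge>N. hardy_norm p (\<lambda>z. \<sigma> n z - f z) < \<epsilon>" if e: "\<epsilon> > 0" for \<epsilon>
  proof -
    obtain N where N: "\<And>m n. m \<ge> N \<Longrightarrow> n \<ge> N \<Longrightarrow> hardy_norm p (\<lambda>z. \<sigma> m z - \<sigma> n z) < \<epsilon> / 2"
      using Cau[of "\<epsilon> / 2"] e by auto
    have "hardy_norm p (\<lambda>z. \<sigma> n z - f z) \<le> \<epsilon> / 2" if "n \<ge> N" for n
      by (rule hardy_norm_le) (use key[of N n "\<epsilon>/2"] N[OF that] e p0 in auto)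
    thus ?thesis using e by (intro exI[of _ N]) force
  qed
  ultimately show ?thesis by blast
qed

theorem banach_function_space_hardy:
  assumes p: "1 \<le> p" shows "banach_function_space (hardy_space p) (hardy_norm p)"
proof -
  have zero: "(\<lambda>z. 0) \<in> hardy_space p"
    by (rule hardy_spaceI[where C = 0]) (use p in \<open>auto simp: hardy_mean_def\<close>)
  have eq0: "f = (\<lambda>z. 0)" if f: "f \<in> hardy_space p" "hardy_norm p f = 0" for f
  proof
    fix z show "f z = 0"
    proof (cases "z \<in> \<D>")
      case True
      thus ?thesis using hardy_norm_point_bound[OF f(1), of z "norm z"] p f(2) by simp
    qed (use hardy_spaceD(2)[OF f(1)] in simp)
  qed
  have d0: "hardy_norm p (\<lambda>z. 0) = 0"
    using hardy_space_scale(2)[OF zero p, of 0] by simp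
  note diff = hardy_space_diff[OF _ _ p]
  interpret M: Metric_space "hardy_space p" "\<lambda>f g. hardy_norm p (\<lambda>z. f z - g z)"
  proof
    show "hardy_norm p (\<lambda>z. x z - y z) = hardy_norm p (\<lambda>z. y z - x z)" for x y
      using hardy_norm_minus[of p "\<lambda>z. x z - y z"] by simp
    show "hardy_norm p (\<lambda>z. x z - y z) = 0 \<longleftrightarrow> x = y" if "x \<in> hardy_space p" "y \<in> hardy_space p" for x y
    proof
      assume "hardy_norm p (\<lambda>z. x z - y z) = 0"
      from fun_cong[OF eq0[OF diff[OF that] this]] show "x = y" by (intro ext) simp
    qed (simp add: d0)
    show "hardy_norm p (\<lambda>w. x w - z w) \<le> hardy_norm p (\<lambda>z. x z - y z) + hardy_norm p (\<lambda>w. y w - z w)"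
      if "x \<in> hardy_space p" "y \<in> hardy_space p" "z \<in> hardy_space p" for x y z
      using hardy_space_add(2)[OF diff[OF that(1,2)] diff[OF that(2,3)] p] by simp
  qed (simp add: hardy_norm_def)
  have "M.mcomplete"
    unfolding M.mcomplete_def
  proof (intro allI impI)
    fix \<sigma> assume \<sigma>: "M.MCauchy \<sigma>"
    have mem: "\<sigma> n \<in> hardy_space p" for n
      using \<sigma> unfolding M.MCauchy_def by (meson rangeI subsetD)
    have "\<forall>\<epsilon>>0. \<exists>N. \<forall>m n. N \<le> m \<longrightarrow> N \<le> n \<longrightarrow> hardy_norm p (\<lambda>z. \<sigma> m z - \<sigma> n z) < \<epsilon>"
      using \<sigma> unfolding M.MCauchy_def by (rule conjunct2)
    hence "\<exists>N. \<forall>m\<ge>N. \<forall>n\<ge>N. hardy_norm p (\<lambda>z. \<sigma> m z - \<sigma> n z) < \<epsilon>" if "\<epsilon> > 0" for \<epsilon>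
      using that by meson
    from hardy_space_complete[OF p mem this]
    obtain f where f: "f \<in> hardy_space p"
      "\<forall>\<epsilon>>0. \<exists>N. \<forall>n\<ge>N. hardy_norm p (\<lambda>z. \<sigma> n z - f z) < \<epsilon>" by auto
    show "\<exists>x. limitin M.mtopology \<sigma> x sequentially"
      unfolding M.limit_metric_sequentially using f mem by (intro exI[of _ f]) simp
  qed
  thus ?thesis
    by (intro banach_function_space.intro zero hardy_space_add hardy_space_scale hardy_norm_minus eq0 p)
      (simp_all add: hardy_norm_def)
qed

theorem composition_operator_bounded:
  assumes p: "1 \<le> p" and \<phi>: "\<phi> holomorphic_on \<D>" "\<phi> ` \<D> \<subseteq> \<D>"
  shows "composition_operator p \<phi> \<in> bounded_operators (hardy_space p) (hardy_norm p)"
proof -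
  have p0: "0 < p" using p by simp
  define a where "a = norm (\<phi> 0)"
  have a: "0 \<le> a" "a < 1" using \<phi>(2) by (auto simp: a_def image_subset_iff)
  define M where "M = (4 / (1 - a)) powr (1 / p)"
  let ?T = "\<lambda>f z. if z \<in> \<D> then f (\<phi> z) else 0"
  have mean: "hardy_mean p (?T f) r \<le> (M * hardy_norm p f) powr p"
    if f: "f \<in> hardy_space p" and r: "0 < r" "r < 1" for f r
  proof -
    have c\<phi>: "continuous_on (cball 0 r) \<phi>" by (rule holomorphic_on_disc_continuous(2)[OF \<phi>(1) r(2)])
    have "compact ((\<lambda>z. norm (\<phi> z)) ` cball 0 r)" by (intro compact_continuous_image continuous_intros c\<phi>) simp
    then obtain w where w: "w \<in> cball 0 r" "\<And>z. z \<in> cball 0 r \<Longrightarrow> norm (\<phi> z) \<le> norm (\<phi> w)"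
      using continuous_attains_sup[of "cball 0 r" "\<lambda>z. norm (\<phi> z)"] c\<phi> r
      by (force intro: continuous_intros)
    have w1: "norm (\<phi> w) < 1" using w(1) \<phi>(2) r by (auto simp: image_subset_iff)
    \<comment> \<open>Larger than the maximum \<open>norm (\<phi> w)\<close> of
      \<open>\<phi>\<close> on the closed disc of radius \<open>r\<close>, as subordination
      requires, and at least \<open>(1 + a) / 2\<close>, which bounds the factor by
      \<open>4 / (1 - a)\<close> for every \<open>r\<close>.\<close>
    define R where "R = max ((1 + norm (\<phi> w)) / 2) ((1 + a) / 2)"
    have R: "R < 1" "norm (\<phi> w) < R" "(1 - a) / 2 \<le> R - a" "a < R"
      using w1 a by (auto simp: R_def max_def field_simps)
    have "hardy_mean p (?T f) r = hardy_mean p (\<lambda>z. f (\<phi> z)) r"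
      by (rule hardy_mean_cong) (use r in auto)
    also have "\<dots> \<le> (R + norm (\<phi> 0)) / (R - norm (\<phi> 0)) * hardy_mean p f R"
    proof (rule Littlewood_subordination)
      show "continuous_on (cball 0 R) f" by (rule holomorphic_on_disc_continuous(2)[OF hardy_spaceD(1)[OF f] R(1)])
      show "f holomorphic_on ball 0 R" "\<phi> holomorphic_on ball 0 r"
        by (rule holomorphic_on_subset[OF hardy_spaceD(1)[OF f]] holomorphic_on_subset[OF \<phi>(1)];
            use R r in auto)+
      show "norm (\<phi> z) < R" if "norm z \<le> r" for z
        using w(2)[of z] R(2) that by simp
    qed (use c\<phi> r p in auto)
    also have "\<dots> \<le> 4 / (1 - a) * (hardy_norm p f powr p)"
    proof (rule mult_mono)
      have "(R + norm (\<phi> 0)) / (R - norm (\<phi> 0)) \<le> 2 / ((1 - a) / 2)"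
        using R a by (intro frac_le) (auto simp: a_def)
      thus "(R + norm (\<phi> 0)) / (R - norm (\<phi> 0)) \<le> 4 / (1 - a)" by simp
      show "hardy_mean p f R \<le> hardy_norm p f powr p"
        by (rule hardy_mean_le_norm[OF f _ R(1) p0]) (use R a in auto)
    qed (use a hardy_mean_nonneg in auto)
    also have "\<dots> = (M * hardy_norm p f) powr p"
      using a p by (simp add: M_def powr_mult powr_powr hardy_norm_def)
    finally show ?thesis .
  qed
  have mem: "?T f \<in> hardy_space p" if f: "f \<in> hardy_space p" for f
  proof (rule hardy_spaceI[OF _ _ mean[OF f]])
    have "(\<lambda>z. f (\<phi> z)) holomorphic_on \<D>"
      using holomorphic_on_compose_gen[OF \<phi>(1) hardy_spaceD(1)[OF f] \<phi>(2)] by (simp add: o_def)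
    thus "?T f holomorphic_on \<D>" by (rule holomorphic_transform) simp
  qed auto
  have bd: "hardy_norm p (?T f) \<le> M * hardy_norm p f" if f: "f \<in> hardy_space p" for f
    by (rule hardy_norm_le[OF mean[OF f]]) (auto simp: M_def hardy_norm_def p0)
  show ?thesis
    unfolding bounded_operators_def composition_operator_def
  proof (intro CollectI conjI ballI allI)
    show "restrict ?T (hardy_space p) \<in> hardy_space p \<rightarrow>\<^sub>E hardy_space p"
      using mem by (simp add: restrict_PiE_iff)
    show "\<exists>M. \<forall>f\<in>hardy_space p. hardy_norm p (restrict ?T (hardy_space p) f) \<le> M * hardy_norm p f"
      using bd by (intro exI[of _ M]) simp
    fix f assume f: "f \<in> hardy_space p"
    show "restrict ?T (hardy_space p) (\<lambda>z. c * f z) = (\<lambda>z. c * restrict ?T (hardy_space p) f z)" for c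
      using hardy_space_scale(1)[OF f p, of c] f by (simp add: fun_eq_iff)
    fix g assume g: "g \<in> hardy_space p"
    show "restrict ?T (hardy_space p) (\<lambda>z. f z + g z) =
        (\<lambda>z. restrict ?T (hardy_space p) f z + restrict ?T (hardy_space p) g z)"
      using hardy_space_add(1)[OF f g p] f g by (simp add: fun_eq_iff)
  qed
qed

section \<open>Convergence in Hardy means\<close>

text \<open>Bounds the \<open>p\<close>-th power of the norm and sees values in the disc only, so
  functions need not be extended by zero. Convergence in H^p is expressed below by such bounds on
  differences.\<close>

definition hardy_bound :: "real \<Rightarrow> (complex \<Rightarrow> complex) \<Rightarrow> real \<Rightarrow> bool" where
  "hardy_bound p f C \<longleftrightarrow> (\<forall>r. 0 < r \<longrightarrow> r < 1 \<longrightarrow> hardy_mean p f r \<le> C)"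

lemma hardy_boundD: "hardy_bound p f C \<Longrightarrow> 0 < r \<Longrightarrow> r < 1 \<Longrightarrow> hardy_mean p f r \<le> C"
  by (simp add: hardy_bound_def)

lemma hardy_bound_cong:
  assumes "\<And>z. z \<in> \<D> \<Longrightarrow> norm (f z) = norm (g z)" "hardy_bound p f C"
  shows "hardy_bound p g C"
  unfolding hardy_bound_def
proof (intro allI impI)
  fix r :: real assume r: "0 < r" "r < 1"
  have "hardy_mean p g r = hardy_mean p f r"
    by (rule hardy_mean_cong) (use assms(1) r in auto)
  thus "hardy_mean p g r \<le> C" using hardy_boundD[OF assms(2) r] by simp
qed

lemma hardy_bound_nonneg: "hardy_bound p f C \<Longrightarrow> 0 \<le> C"
  using hardy_boundD[of p f C "1/2"] hardy_mean_nonneg[of p f "1/2"] by simp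

lemma hardy_bound_add:
  assumes "f holomorphic_on \<D>" "g holomorphic_on \<D>" "hardy_bound p f A" "hardy_bound p g B" "0 < p"
  shows "hardy_bound p (\<lambda>z. f z + g z) (2 powr p * (A + B))"
  unfolding hardy_bound_def
proof (intro allI impI)
  fix r :: real assume r: "0 < r" "r < 1"
  have "hardy_mean p (\<lambda>z. f z + g z) r \<le> 2 powr p * (hardy_mean p f r + hardy_mean p g r)"
    by (rule hardy_mean_add_le) (use assms r holomorphic_on_disc_continuous in auto)
  also have "\<dots> \<le> 2 powr p * (A + B)"
    by (intro mult_left_mono add_mono hardy_boundD assms r) auto
  finally show "hardy_mean p (\<lambda>z. f z + g z) r \<le> 2 powr p * (A + B)" .
qed

lemma hardy_bound_cmult:
  assumes "hardy_bound p f A" shows "hardy_bound p (\<lambda>z. c * f z) (norm c powr p * A)"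
  using assms by (auto simp: hardy_bound_def hardy_mean_cmult intro!: mult_left_mono)

lemma hardy_bound_mult_bounded:
  assumes "f holomorphic_on \<D>" "g holomorphic_on \<D>" "\<And>z. z \<in> \<D> \<Longrightarrow> norm (g z) \<le> B"
    and "hardy_bound p f A" "0 < p"
  shows "hardy_bound p (\<lambda>z. g z * f z) (B powr p * A)"
  unfolding hardy_bound_def
proof (intro allI impI)
  fix r :: real assume r: "0 < r" "r < 1"
  have B: "0 \<le> B" using order_trans[OF norm_ge_zero assms(3)[of 0]] by simp
  have "hardy_mean p (\<lambda>z. g z * f z) r \<le> hardy_mean p (\<lambda>z. of_real B * f z) r"
  proof (rule hardy_mean_mono)
    fix z :: complex assume "norm z = r"
    hence "norm (g z) \<le> B" using assms(3) r by simp
    thus "norm (g z * f z) \<le> norm (of_real B * f z)" using B by (simp add: norm_mult mult_right_mono)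
  qed (use assms r in \<open>auto intro!: holomorphic_intros holomorphic_on_disc_continuous\<close>)
  also have "\<dots> \<le> B powr p * A"
    using hardy_boundD[OF hardy_bound_cmult[OF assms(4)] r, of "of_real B"] B by simp
  finally show "hardy_mean p (\<lambda>z. g z * f z) r \<le> B powr p * A" .
qed

lemma hardy_bound_uniform:
  assumes "f holomorphic_on \<D>" "\<And>z. z \<in> \<D> \<Longrightarrow> norm (f z) \<le> B" "0 < p"
  shows "hardy_bound p f (2 * pi * B powr p)"
  unfolding hardy_bound_def using assms
  by (intro allI impI hardy_mean_le_bound holomorphic_on_disc_continuous) auto

section \<open>Contractions close to the constant one\<close>

lemma hardy_mean_two_minus_one:
  assumes q: "q holomorphic_on \<D>" "\<And>z. z \<in> \<D> \<Longrightarrow> norm (q z) \<le> 1" and r: "0 < r" "r < 1"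
  shows "hardy_mean 2 (\<lambda>z. q z - 1) r \<le> 4 * pi * (1 - Re (q 0))"
proof -
  have c: "continuous_on (cball 0 r) q" by (rule holomorphic_on_disc_continuous(2)[OF q(1) r(2)])
  have "((\<lambda>\<theta>. q (rcis r \<theta>)) has_integral 2 * pi * q 0) {0..2*pi}"
    by (rule mean_value_circle[OF c holomorphic_on_subset[OF q(1)]]) (use r in auto)
  from has_integral_linear[OF this bounded_linear_Re]
  have m: "((\<lambda>\<theta>. Re (q (rcis r \<theta>))) has_integral Re (complex_of_real (2 * pi) * q 0)) {0..2*pi}"
    unfolding o_def by simp
  have "Re (complex_of_real (2 * pi) * q 0) = 2 * pi * Re (q 0)" by (simp del: of_real_mult)
  with m have m: "((\<lambda>\<theta>. Re (q (rcis r \<theta>))) has_integral 2 * pi * Re (q 0)) {0..2*pi}" by simp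
  have "((\<lambda>\<theta>. 2 - 2 * Re (q (rcis r \<theta>))) has_integral 2 * (2 * pi) - 2 * (2 * pi * Re (q 0))) {0..2*pi}"
    using has_integral_diff[OF has_integral_const_real[of "2::real" 0 "2*pi"] has_integral_mult_right[OF m, of 2]]
    by (simp add: algebra_simps)
  moreover have "((\<lambda>\<theta>. norm (q (rcis r \<theta>) - 1) powr 2) has_integral hardy_mean 2 (\<lambda>z. q z - 1) r) {0..2*pi}"
    unfolding hardy_mean_def using q r
    by (intro integrable_integral integrable_hardy_mean[where f = "\<lambda>z. q z - 1"] continuous_intros holomorphic_on_disc_continuous) auto
  moreover have "norm (q (rcis r \<theta>) - 1) powr 2 \<le> 2 - 2 * Re (q (rcis r \<theta>))" for \<theta>
  proof -
    let ?w = "q (rcis r \<theta>)"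
    have w: "norm ?w \<le> 1" by (rule q(2)) (use r in \<open>simp add: norm_rcis\<close>)
    have "norm (?w - 1) powr 2 = (norm (?w - 1))\<^sup>2" by simp
    also have "\<dots> = (norm ?w)\<^sup>2 + 1 - 2 * Re ?w"
      unfolding cmod_power2 by (simp add: power2_eq_square algebra_simps)
    also have "\<dots> \<le> 2 - 2 * Re ?w" using power_mono[OF w, of 2] by simp
    finally show ?thesis .
  qed
  ultimately have "hardy_mean 2 (\<lambda>z. q z - 1) r \<le> 2 * (2 * pi) - 2 * (2 * pi * Re (q 0))"
    by (meson has_integral_le)
  thus ?thesis by (simp add: algebra_simps)
qed

text \<open>Up to \<open>\<delta>\<close> the first term is enough; beyond it
  \<open>x powr p\<close> is at most \<open>B powr p\<close>, and
  \<open>x\<^sup>2 / \<delta>\<^sup>2\<close> is at least \<open>1\<close>. For functions bounded by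
  \<open>B\<close> this converts smallness in H^2 into smallness in H^p.\<close>

lemma powr_le_add_square:
  fixes x B \<delta> p :: real
  assumes "0 \<le> x" "x \<le> B" "0 < \<delta>" "0 < p"
  shows "x powr p \<le> \<delta> powr p + B powr p / \<delta>\<^sup>2 * x powr 2"
proof (cases "x \<le> \<delta>")
  case True
  hence "x powr p \<le> \<delta> powr p" using assms by (intro powr_mono2) auto
  moreover have "0 \<le> B powr p / \<delta>\<^sup>2 * x powr 2" by simp
  ultimately show ?thesis by linarith
next
  case False
  have "x powr p \<le> B powr p * 1" using assms by (auto intro: powr_mono2)
  also have "1 \<le> x\<^sup>2 / \<delta>\<^sup>2" using False assms by (simp add: power_mono)
  hence "B powr p * 1 \<le> B powr p * (x\<^sup>2 / \<delta>\<^sup>2)" by (intro mult_left_mono) auto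
  also have "\<dots> = B powr p / \<delta>\<^sup>2 * x powr 2" using assms by simp
  finally show ?thesis using powr_ge_zero[of \<delta> p] by linarith
qed

text \<open>The only convergence criterion behind the totality of the exponentials. It goes through \<open>H\<^sup>2\<close>,
  where \<open>norm (q - 1)^2 \<le> 2 - 2 * Re q\<close> and the mean of \<open>Re q\<close> is \<open>Re (q 0)\<close>.\<close>
lemma hardy_bound_contraction_near_one:
  assumes p: "0 < p" and \<epsilon>: "0 < \<epsilon>"
  shows "\<exists>\<eta>>0. \<forall>q. q holomorphic_on \<D> \<longrightarrow> (\<forall>z\<in>\<D>. norm (q z) \<le> 1) \<longrightarrow> 1 - Re (q 0) < \<eta> \<longrightarrow>
    hardy_bound p (\<lambda>z. q z - 1) \<epsilon>"
proof -
  \<comment> \<open>Over the period \<open>\<delta> powr p\<close> contributes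
    \<open>\<epsilon> / 2\<close>. Since \<open>norm (q z - 1)\<close> is at most \<open>2\<close>,
    \<open>K\<close> is the coefficient of the square, and \<open>\<eta>\<close> limits the
    contribution of the square to another \<open>\<epsilon> / 2\<close>.\<close>
  define \<delta> where "\<delta> = (\<epsilon> / (4 * pi)) powr (1 / p)"
  have \<delta>: "\<delta> > 0" "\<delta> powr p = \<epsilon> / (4 * pi)" using p \<epsilon> by (auto simp: \<delta>_def powr_powr)
  define K where "K = 2 powr p / \<delta>\<^sup>2"
  have K: "K > 0" using \<delta> by (simp add: K_def)
  define \<eta> where "\<eta> = \<epsilon> / (2 * K * (4 * pi))"
  have \<eta>: "\<eta> > 0" using \<epsilon> K by (simp add: \<eta>_def)
  have "hardy_bound p (\<lambda>z. q z - 1) \<epsilon>"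
    if q: "q holomorphic_on \<D>" "\<forall>z\<in>\<D>. norm (q z) \<le> 1" "1 - Re (q 0) < \<eta>" for q
    unfolding hardy_bound_def
  proof (intro allI impI)
    fix r :: real assume r: "0 < r" "r < 1"
    have c: "continuous_on (sphere 0 r) (\<lambda>z. q z - 1)"
      by (intro continuous_intros holomorphic_on_disc_continuous q r)
    have I: "(\<lambda>\<theta>. norm (q (rcis r \<theta>) - 1) powr 2) integrable_on {0..2*pi}"
      by (rule integrable_hardy_mean[OF c]) (use r in auto)
    have "hardy_mean p (\<lambda>z. q z - 1) r \<le> integral {0..2*pi} (\<lambda>\<theta>. \<delta> powr p + K * norm (q (rcis r \<theta>) - 1) powr 2)"
      unfolding hardy_mean_def
    proof (rule integral_le)
      show "(\<lambda>\<theta>. norm (q (rcis r \<theta>) - 1) powr p) integrable_on {0..2 * pi}"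
        by (rule integrable_hardy_mean[OF c]) (use r p in auto)
      show "(\<lambda>\<theta>. \<delta> powr p + K * norm (q (rcis r \<theta>) - 1) powr 2) integrable_on {0..2 * pi}"
        by (intro integrable_add integrable_on_mult_right I integrable_const_ivl)
      fix \<theta>
      have "norm (q (rcis r \<theta>)) \<le> 1" using q(2) r by (simp add: norm_rcis)
      hence "norm (q (rcis r \<theta>) - 1) \<le> 2"
        using norm_triangle_ineq4[of "q (rcis r \<theta>)" 1] by simp
      thus "norm (q (rcis r \<theta>) - 1) powr p \<le> \<delta> powr p + K * norm (q (rcis r \<theta>) - 1) powr 2"
        unfolding K_def using \<delta> p by (intro powr_le_add_square) auto
    qed
    also have "\<dots> = integral {0..2*pi} (\<lambda>\<theta>. \<delta> powr p) + K * hardy_mean 2 (\<lambda>z. q z - 1) r"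
      unfolding hardy_mean_def
      by (subst integral_add) (auto intro: integrable_on_mult_right I[unfolded powr_numeral[OF norm_ge_zero]] simp: integrable_const_ivl)
    also have "integral {0..2*pi} (\<lambda>\<theta>. \<delta> powr p) = \<epsilon> / 2" by (simp add: \<delta>(2))
    also have "K * hardy_mean 2 (\<lambda>z. q z - 1) r \<le> K * (4 * pi * (1 - Re (q 0)))"
      using K q r by (intro mult_left_mono hardy_mean_two_minus_one) auto
    also have "\<dots> \<le> K * (4 * pi * \<eta>)" using K q(3) by (intro mult_left_mono) auto
    also have "\<dots> = \<epsilon> / 2" using K by (simp add: \<eta>_def)
    finally show "hardy_mean p (\<lambda>z. q z - 1) r \<le> \<epsilon>" by simp
  qed
  thus ?thesis using \<eta> by blast
qed

section \<open>Clarkson's inequality and radial dilations\<close>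

lemma powr_superadditive:
  fixes x y s :: real
  assumes "0 \<le> x" "0 \<le> y" "1 \<le> s"
  shows "x powr s + y powr s \<le> (x + y) powr s"
proof (cases "x + y = 0")
  case False
  hence pos: "x + y > 0" using assms by linarith
  have *: "t powr s \<le> (x + y) powr s * (t / (x + y))" if "0 \<le> t" "t \<le> x + y" for t
  proof -
    have "t powr s = (x + y) powr s * (t / (x + y)) powr s"
      using pos that by (simp add: powr_divide)
    also have "(t / (x + y)) powr s \<le> (t / (x + y)) powr 1"
      using that pos assms by (intro powr_mono') auto
    also have "\<dots> = t / (x + y)" using that pos by simp
    finally show ?thesis by (simp add: mult_left_mono)
  qed
  have "x powr s + y powr s \<le> (x + y) powr s * (x / (x + y)) + (x + y) powr s * (y / (x + y))"
    by (intro add_mono *) (use assms in auto)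
  also have "\<dots> = (x + y) powr s * ((x + y) / (x + y))"
    by (simp only: add_divide_distrib distrib_left)
  finally show ?thesis using pos by simp
qed (use assms in \<open>auto simp: add_nonneg_eq_0_iff\<close>)

text \<open>The parallelogram law raised to the power \<open>s = q / 2\<close>, which is at least
  \<open>1\<close>: superadditivity of the power separates the left side, convexity the right
  side.\<close>

lemma Clarkson_inequality:
  fixes a b :: complex
  assumes "2 \<le> q"
  shows "norm (a + b) powr q + norm (a - b) powr q \<le> 2 powr (q - 1) * (norm a powr q + norm b powr q)"
proof -
  define s where "s = q / 2"
  have s: "1 \<le> s" using assms by (simp add: s_def)
  have sq: "x powr q = (x\<^sup>2) powr s" if "0 \<le> x" for x :: real
    using that by (simp add: s_def powr_powr flip: powr_numeral)
  have par: "(norm (a + b))\<^sup>2 + (norm (a - b))\<^sup>2 = 4 * (1/2 * (norm a)\<^sup>2 + 1/2 * (norm b)\<^sup>2)"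
    unfolding cmod_power2 by (simp add: power2_eq_square algebra_simps)
  have "norm (a + b) powr q + norm (a - b) powr q \<le> ((norm (a + b))\<^sup>2 + (norm (a - b))\<^sup>2) powr s"
    using powr_superadditive[OF _ _ s] by (simp add: sq)
  also have "\<dots> = 4 powr s * (1/2 * (norm a)\<^sup>2 + 1/2 * (norm b)\<^sup>2) powr s"
    unfolding par by (rule powr_mult; simp)
  also have "\<dots> \<le> 4 powr s * (1/2 * ((norm a)\<^sup>2) powr s + 1/2 * ((norm b)\<^sup>2) powr s)"
    using s by (intro mult_left_mono powr_convex_combination) auto
  also have "4 powr s = 2 powr q"
    using sq[of 2] by simp
  also have "2 powr q * (1/2 * ((norm a)\<^sup>2) powr s + 1/2 * ((norm b)\<^sup>2) powr s) =
    2 powr (q - 1) * (norm a powr q + norm b powr q)"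
    by (simp add: sq powr_diff algebra_simps)
  finally show ?thesis .
qed

lemma hardy_mean_Clarkson:
  assumes "continuous_on (sphere 0 r) f" "continuous_on (sphere 0 r) g" "0 \<le> r" "2 \<le> q"
  shows "hardy_mean q (\<lambda>z. f z + g z) r + hardy_mean q (\<lambda>z. f z - g z) r
    \<le> 2 powr (q - 1) * (hardy_mean q f r + hardy_mean q g r)"
proof -
  have q: "0 < q" using assms by simp
  have I: "(\<lambda>\<theta>. norm (k (rcis r \<theta>)) powr q) integrable_on {0..2 * pi}"
    if "continuous_on (sphere 0 r) k" for k :: "complex \<Rightarrow> complex"
    by (rule integrable_hardy_mean[OF that assms(3) q])
  have I1: "(\<lambda>\<theta>. norm (f (rcis r \<theta>) + g (rcis r \<theta>)) powr q) integrable_on {0..2 * pi}"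
    and I2: "(\<lambda>\<theta>. norm (f (rcis r \<theta>) - g (rcis r \<theta>)) powr q) integrable_on {0..2 * pi}"
    using I[of "\<lambda>z. f z + g z"] I[of "\<lambda>z. f z - g z"] assms by (auto intro: continuous_intros)
  have "hardy_mean q (\<lambda>z. f z + g z) r + hardy_mean q (\<lambda>z. f z - g z) r =
    integral {0..2*pi} (\<lambda>\<theta>. norm (f (rcis r \<theta>) + g (rcis r \<theta>)) powr q + norm (f (rcis r \<theta>) - g (rcis r \<theta>)) powr q)"
    unfolding hardy_mean_def by (rule integral_add[OF I1 I2, symmetric])
  also have "\<dots> \<le> integral {0..2*pi} (\<lambda>\<theta>. 2 powr (q - 1) * (norm (f (rcis r \<theta>)) powr q + norm (g (rcis r \<theta>)) powr q))"
    by (intro integral_le integrable_add I1 I2 integrable_on_mult_right I assms Clarkson_inequality)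
  also have "\<dots> = 2 powr (q - 1) * (hardy_mean q f r + hardy_mean q g r)"
    unfolding hardy_mean_def by (simp add: integral_add I assms)
  finally show ?thesis .
qed

lemma hardy_mean_dilation:
  "hardy_mean p (\<lambda>z. f (of_real \<rho> * z)) r = hardy_mean p f (\<rho> * r)"
  unfolding hardy_mean_def by (simp add: rcis_def mult.assoc)

lemma dilation_holomorphic:
  assumes "f holomorphic_on \<D>" "0 \<le> \<rho>" "\<rho> \<le> 1"
  shows "(\<lambda>z. f (of_real \<rho> * z)) holomorphic_on \<D>"
proof -
  have "\<rho> * norm z < 1" if "norm z < 1" for z :: complex
    using mult_right_mono[OF assms(3) norm_ge_zero[of z]] that by linarith
  hence "(f \<circ> (\<lambda>z. of_real \<rho> * z)) holomorphic_on \<D>"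
    using assms(2) by (intro holomorphic_on_compose_gen[OF _ assms(1)])
      (auto intro!: holomorphic_intros simp: norm_mult)
  thus ?thesis by (simp add: o_def)
qed

lemma dilation_uniform_limit:
  assumes f: "f holomorphic_on \<D>" and \<rho>: "\<And>n. 0 \<le> \<rho> n" "\<And>n. \<rho> n \<le> 1" "\<rho> \<longlonglongrightarrow> 1" and r: "0 \<le> r" "r < 1"
  shows "uniform_limit (cball 0 r) (\<lambda>n z. f (of_real (\<rho> n) * z)) f sequentially"
proof (rule uniform_limitI)
  fix e :: real assume e: "e > 0"
  have "uniformly_continuous_on (cball 0 r) f"
    by (intro compact_uniformly_continuous holomorphic_on_disc_continuous(2)[OF f r(2)]) simp
  then obtain d where d: "d > 0" "\<And>x y. x \<in> cball 0 r \<Longrightarrow> y \<in> cball 0 r \<Longrightarrow> dist y x < d \<Longrightarrow> dist (f y) (f x) < e"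
    using e unfolding uniformly_continuous_on_def by metis
  have "eventually (\<lambda>n. dist (\<rho> n) 1 < d) sequentially" using \<rho>(3) d(1) by (rule tendstoD)
  thus "\<forall>\<^sub>F n in sequentially. \<forall>x\<in>cball 0 r. dist (f (of_real (\<rho> n) * x)) (f x) < e"
  proof eventually_elim
    case (elim n)
    show ?case
    proof
      fix x :: complex assume x: "x \<in> cball 0 r"
      have "norm (of_real (\<rho> n) * x) \<le> norm x"
        using \<rho>(1,2)[of n] by (simp add: norm_mult mult_left_le_one_le)
      hence "of_real (\<rho> n) * x \<in> cball 0 r" using x by simp
      moreover have "dist (of_real (\<rho> n) * x) x = \<bar>\<rho> n - 1\<bar> * norm x"
      proof -
        have "of_real (\<rho> n) * x - x = of_real (\<rho> n - 1) * x" by (simp add: algebra_simps)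
        thus ?thesis by (simp only: dist_norm norm_mult norm_of_real)
      qed
      moreover have "\<bar>\<rho> n - 1\<bar> * norm x \<le> \<bar>\<rho> n - 1\<bar>" using x r by (simp add: mult_left_le)
      ultimately show "dist (f (of_real (\<rho> n) * x)) (f x) < e"
        using elim x by (intro d(2)) (auto simp: dist_real_def)
    qed
  qed
qed

text \<open>Uniform convexity. Both \<open>f\<close> and its dilations have means at most
  \<open>m\<close>, while on one fixed circle the mean of their sum comes close to
  \<open>2 powr q * m\<close>; Clarkson's inequality then leaves little room for the difference.
  Means grow with the radius, so this lower estimate extends to all larger circles.\<close>

lemma dilation_converges_of_two_le:
  assumes f: "f holomorphic_on \<D>" "hardy_bound q f C" and q: "2 \<le> q"
    and \<rho>: "\<And>n. 0 < \<rho> n" "\<And>n. \<rho> n \<le> 1" "\<rho> \<longlonglongrightarrow> 1" and e: "0 < \<epsilon>"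
  shows "eventually (\<lambda>n. hardy_bound q (\<lambda>z. f z - f (of_real (\<rho> n) * z)) \<epsilon>) sequentially"
proof -
  define m where "m = (SUP r\<in>{0<..<1}. hardy_mean q f r)"
  have bdd: "bdd_above (hardy_mean q f ` {0<..<1})"
    using f(2) by (auto simp: hardy_bound_def intro!: bdd_aboveI[of _ C])
  have m: "hardy_mean q f r \<le> m" if "0 < r" "r < 1" for r
    unfolding m_def by (rule cSUP_upper[OF _ bdd]) (use that in auto)
  \<comment> \<open>Chosen so that the defect \<open>2 powr q * \<epsilon>'\<close> in Clarkson's
    inequality is exactly \<open>\<epsilon>\<close>.\<close>
  define \<epsilon>' where "\<epsilon>' = \<epsilon> / 2 powr q"
  have e': "\<epsilon>' > 0" using e by (simp add: \<epsilon>'_def)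
  have "m - \<epsilon>' < (SUP r\<in>{0<..<1}. hardy_mean q f r)" using e' by (simp add: m_def)
  then obtain r0 where r0: "0 < r0" "r0 < 1" "m - \<epsilon>' < hardy_mean q f r0"
    by (subst (asm) less_cSUP_iff[OF _ bdd]) auto
  define F where "F n z = f (of_real (\<rho> n) * z)" for n z
  have F: "F n holomorphic_on \<D>" for n
    unfolding F_def using dilation_holomorphic[OF f(1)] \<rho>(1,2) less_imp_le by blast
  have FC: "hardy_mean q (F n) s \<le> m" if "0 < s" "s < 1" for n s
  proof -
    have "\<rho> n * s \<le> 1 * s" using \<rho>(2)[of n] that by (intro mult_right_mono) auto
    hence "\<rho> n * s < 1" using that by linarith
    thus ?thesis unfolding F_def hardy_mean_dilation using \<rho>(1)[of n] that by (intro m) auto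
  qed
  note cont = holomorphic_on_disc_continuous(1)
  have "(\<lambda>n. hardy_mean q (\<lambda>z. f z + F n z) r0) \<longlonglongrightarrow> hardy_mean q (\<lambda>z. f z + f z) r0"
  proof (rule hardy_mean_tendsto)
    have "uniform_limit (sphere 0 r0) F f sequentially"
      unfolding F_def
      by (rule uniform_limit_on_subset[OF dilation_uniform_limit[OF f(1), of \<rho> r0]])
        (use \<rho> r0 less_imp_le in auto)
    thus "uniform_limit (sphere 0 r0) (\<lambda>n z. f z + F n z) (\<lambda>z. f z + f z) sequentially"
      by (intro uniform_limit_intros)
  qed (use cont[OF f(1) r0(2)] cont[OF F r0(2)] q r0 in \<open>auto intro: continuous_intros\<close>)
  moreover have "hardy_mean q (\<lambda>z. f z + f z) r0 = 2 powr q * hardy_mean q f r0"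
    using hardy_mean_cmult[of q 2 f r0] by (simp only: mult_2) simp
  ultimately have lim: "(\<lambda>n. hardy_mean q (\<lambda>z. f z + F n z) r0) \<longlonglongrightarrow> 2 powr q * hardy_mean q f r0"
    by (simp only:)
  have "2 powr q * (m - \<epsilon>') < 2 powr q * hardy_mean q f r0"
    using r0(3) by (intro mult_strict_left_mono) auto
  from order_tendstoD(1)[OF lim this]
  have "eventually (\<lambda>n. hardy_mean q (\<lambda>z. f z + F n z) r0 > 2 powr q * (m - \<epsilon>')) sequentially" .
  thus ?thesis
  proof eventually_elim
    case (elim n)
    have big: "hardy_mean q (\<lambda>z. f z - F n z) s \<le> \<epsilon>" if s: "r0 \<le> s" "s < 1" for s
    proof -
      have "hardy_mean q (\<lambda>z. f z + F n z) r0 \<le> hardy_mean q (\<lambda>z. f z + F n z) s"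
        by (rule hardy_mean_radius_mono_disc) (use s r0 q f(1) F in \<open>auto intro: holomorphic_intros\<close>)
      moreover have "hardy_mean q (\<lambda>z. f z + F n z) s + hardy_mean q (\<lambda>z. f z - F n z) s
          \<le> 2 powr (q - 1) * (hardy_mean q f s + hardy_mean q (F n) s)"
        by (rule hardy_mean_Clarkson) (use s r0 q cont f(1) F in auto)
      moreover have "2 powr (q - 1) * (hardy_mean q f s + hardy_mean q (F n) s) \<le> 2 powr (q - 1) * (m + m)"
        by (intro mult_left_mono add_mono m FC) (use s r0 in auto)
      moreover have "2 powr (q - 1) * (m + m) = 2 powr q * m" by (simp add: powr_diff)
      moreover have "2 powr q * (m - \<epsilon>') = 2 powr q * m - \<epsilon>"
        by (simp add: \<epsilon>'_def right_diff_distrib)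
      ultimately show ?thesis using elim by linarith
    qed
    have "hardy_mean q (\<lambda>z. f z - F n z) s \<le> \<epsilon>" if s: "0 < s" "s < 1" for s
    proof (cases "r0 \<le> s")
      case False
      have "hardy_mean q (\<lambda>z. f z - F n z) s \<le> hardy_mean q (\<lambda>z. f z - F n z) r0"
        by (rule hardy_mean_radius_mono_disc) (use s r0 q f(1) F False in \<open>auto intro: holomorphic_intros\<close>)
      thus ?thesis using big[of r0] r0 by simp
    qed (use big s in auto)
    thus ?case by (simp add: hardy_bound_def F_def)
  qed
qed

section \<open>Factorization and density of polynomials\<close>

text \<open>The quotient off \<open>a\<close> and the local factor near \<open>a\<close> agree where
  both are defined, so they glue to one holomorphic function.\<close>

lemma divide_zero_factor:
  assumes f: "f holomorphic_on ball 0 R" and a: "a \<in> ball 0 R" "f a = 0"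
    and nz: "w \<in> ball 0 R" "f w \<noteq> 0"
  obtains n q where "0 < n" "q holomorphic_on ball 0 R"
    "\<And>z. z \<in> ball 0 R \<Longrightarrow> f z = (z - a) ^ n * q z" "q a \<noteq> 0"
proof -
  have "\<not> f constant_on ball 0 R" using a nz unfolding constant_on_def by metis
  then obtain g r n where g: "0 < n" "0 < r" "ball a r \<subseteq> ball 0 R" "g holomorphic_on ball a r"
      "\<And>w. w \<in> ball a r \<Longrightarrow> f w = (w - a) ^ n * g w" "\<And>w. w \<in> ball a r \<Longrightarrow> g w \<noteq> 0"
    using holomorphic_factor_zero_nonconstant[OF f open_ball connected_ball a] by metis
  define q where "q z = (if z = a then g a else f z / (z - a) ^ n)" for z
  have qg: "q z = g z" if "z \<in> ball a r" for z
    using g(5)[OF that] by (simp add: q_def)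
  have "q holomorphic_on ball a r" by (rule holomorphic_transform[OF g(4)]) (simp add: qg)
  moreover have "q holomorphic_on (ball 0 R - {a})"
  proof (rule holomorphic_transform)
    show "(\<lambda>z. f z / (z - a) ^ n) holomorphic_on (ball 0 R - {a})"
      by (intro holomorphic_intros holomorphic_on_subset[OF f]) auto
  qed (simp add: q_def)
  ultimately have "q holomorphic_on (ball a r \<union> (ball 0 R - {a}))"
    by (intro holomorphic_on_Un) auto
  moreover have "ball a r \<union> (ball 0 R - {a}) = ball 0 R" using g(2,3) a(1) by auto
  ultimately have "q holomorphic_on ball 0 R" by simp
  moreover have "f z = (z - a) ^ n * q z" for z using a(2) g(1) by (simp add: q_def)
  moreover have "q a \<noteq> 0" using g(2) g(6)[of a] by (simp add: q_def)
  ultimately show thesis using that g(1) by blast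
qed

text \<open>On the circle \<open>1 - cnj a * z\<close> equals \<open>z * cnj (z - a)\<close>. Hence
  exchanging \<open>z - a\<close> for \<open>1 - cnj a * z\<close> removes a zero without changing
  the boundary modulus.\<close>

lemma norm_one_minus_cnj_mult:
  fixes a z :: complex
  assumes "norm z = 1" shows "norm (1 - cnj a * z) = norm (z - a)"
proof -
  have "z * cnj z = 1" using complex_norm_square[of z] assms by simp
  hence "1 - cnj a * z = z * cnj (z - a)" by (simp add: algebra_simps)
  hence "norm (1 - cnj a * z) = norm z * norm (cnj (z - a))" by (simp only: norm_mult)
  thus ?thesis unfolding complex_mod_cnj using assms by simp
qed

lemma one_minus_cnj_mult_nonzero:
  fixes a z :: complex
  assumes "norm a < 1" "norm z \<le> 1" shows "1 - cnj a * z \<noteq> 0"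
proof
  assume "1 - cnj a * z = 0"
  hence "norm a * norm z = 1" by (metis complex_mod_cnj eq_iff_diff_eq_0 norm_mult norm_one)
  moreover have "norm a * norm z \<le> norm a" using assms(2) by (simp add: mult_left_le)
  ultimately show False using assms(1) by simp
qed

text \<open>Induction on the number of zeros in the open disc, which is finite because
  \<open>f\<close> is holomorphic on a larger disc. Zeros on the unit circle stay in
  \<open>G\<close>.\<close>

lemma Blaschke_factorization:
  assumes "f holomorphic_on ball 0 R" "1 < R" "\<exists>w\<in>ball 0 R. f w \<noteq> 0"
  shows "\<exists>B G. B holomorphic_on \<D> \<and> (\<forall>z\<in>\<D>. norm (B z) \<le> 1) \<and> G holomorphic_on ball 0 R \<and>
    (\<forall>z\<in>\<D>. G z \<noteq> 0 \<and> f z = B z * G z) \<and> (\<forall>z. norm z = 1 \<longrightarrow> norm (G z) = norm (f z))"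
proof -
  have fin: "finite {z\<in>\<D>. f z = 0}"
  proof (cases "f constant_on ball 0 R")
    case True
    then obtain c where c: "\<And>z. z \<in> ball 0 R \<Longrightarrow> f z = c" by (auto simp: constant_on_def)
    hence "c \<noteq> 0" using assms(3) by auto
    hence "{z\<in>\<D>. f z = 0} = {}" using c assms(2) by auto
    thus ?thesis by (simp only: finite.emptyI)
  next
    case False
    have "finite {z\<in>cball 0 1. f z = 0}"
      by (rule holomorphic_compact_finite_zeros[OF assms(1) _ _ _ _ False]) (use assms(2) in auto)
    thus ?thesis by (rule rev_finite_subset) auto
  qed
  from this assms(1,3) show ?thesis
  proof (induction "card {z\<in>\<D>. f z = 0}" arbitrary: f)
    case 0
    hence "{z\<in>\<D>. f z = 0} = {}" by simp
    thus ?case using 0 by (intro exI[of _ "\<lambda>_. 1"] exI[of _ f]) auto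
  next
    case (Suc n)
    have "{z\<in>\<D>. f z = 0} \<noteq> {}" using Suc.hyps(2) by (metis card.empty nat.distinct(1))
    then obtain a where a: "a \<in> \<D>" "f a = 0" by auto
    have aR: "a \<in> ball 0 R" using a assms(2) by auto
    obtain k q where q: "q holomorphic_on ball 0 R" "q a \<noteq> 0"
      "\<And>z. z \<in> ball 0 R \<Longrightarrow> f z = (z - a) ^ k * q z"
      using Suc.prems(3) divide_zero_factor[OF Suc.prems(2) aR a(2)] by metis
    \<comment> \<open>The exchange of \<open>(z - a) ^ k\<close> for
      \<open>(1 - cnj a * z) ^ k\<close> takes the whole multiplicity at once, so the number of
      distinct zeros drops by exactly one.\<close>
    define F where "F z = (1 - cnj a * z) ^ k * q z" for z
    have nz: "1 - cnj a * z \<noteq> 0" if "norm z \<le> 1" for z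
      using one_minus_cnj_mult_nonzero a(1) that by simp
    have Fhol: "F holomorphic_on ball 0 R" unfolding F_def by (intro holomorphic_intros q)
    have Fa: "F a \<noteq> 0" using q(2) nz[of a] a(1) by (simp add: F_def)
    have zeros: "{z\<in>\<D>. F z = 0} = {z\<in>\<D>. f z = 0} - {a}"
    proof (intro equalityI subsetI)
      fix z assume z: "z \<in> {z\<in>\<D>. F z = 0}"
      hence "q z = 0" using nz[of z] by (auto simp: F_def)
      thus "z \<in> {z\<in>\<D>. f z = 0} - {a}" using q(3)[of z] z Fa assms(2) by auto
    next
      fix z assume z: "z \<in> {z\<in>\<D>. f z = 0} - {a}"
      hence "q z = 0" using q(3)[of z] assms(2) by auto
      thus "z \<in> {z\<in>\<D>. F z = 0}" using z by (simp add: F_def)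
    qed
    have card: "n = card {z\<in>\<D>. F z = 0}" and finF: "finite {z\<in>\<D>. F z = 0}"
      unfolding zeros using Suc.hyps(2) Suc.prems(1) a by auto
    have exF: "\<exists>w\<in>ball 0 R. F w \<noteq> 0" using Fa aR by blast
    obtain B G where BG: "B holomorphic_on \<D>" "\<forall>z\<in>\<D>. norm (B z) \<le> 1" "G holomorphic_on ball 0 R"
      "\<forall>z\<in>\<D>. G z \<noteq> 0 \<and> F z = B z * G z" "\<forall>z. norm z = 1 \<longrightarrow> norm (G z) = norm (F z)"
      using Suc.hyps(1)[OF card finF Fhol exF] by auto
    define b where "b z = (z - a) / (1 - cnj a * z)" for z
    have b1: "norm (b z) \<le> 1" if "z \<in> \<D>" for z
      using Moebius_function_norm_lt_1[of a z 0] that a(1)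
      unfolding Moebius_function_simple b_def by simp
    show ?case
    proof (rule exI[of _ "\<lambda>z. b z ^ k * B z"], rule exI[of _ G], intro conjI ballI allI impI BG(3))
      show "(\<lambda>z. b z ^ k * B z) holomorphic_on \<D>"
        unfolding b_def by (intro holomorphic_intros BG(1)) (use nz in auto)
      show "norm (b z ^ k * B z) \<le> 1" if "z \<in> \<D>" for z
        using b1[OF that] BG(2) that by (simp add: norm_mult norm_power mult_le_one power_le_one)
      show "G z \<noteq> 0" if "z \<in> \<D>" for z using BG(4) that by blast
      show "f z = b z ^ k * B z * G z" if z: "z \<in> \<D>" for z
      proof -
        have "B z * G z = (1 - cnj a * z) ^ k * q z" using BG(4) z by (simp add: F_def)
        moreover have "1 - cnj a * z \<noteq> 0" using nz[of z] z by simp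
        ultimately have "b z ^ k * (B z * G z) = (z - a) ^ k * q z"
          by (simp add: b_def power_divide)
        thus ?thesis using q(3)[of z] z assms(2) by (simp add: mult.assoc)
      qed
      show "norm (G z) = norm (f z)" if "norm z = 1" for z
        using BG(5) that norm_one_minus_cnj_mult[OF that, of a] q(3)[of z] assms(2)
        by (simp add: F_def norm_mult norm_power)
    qed
  qed
qed

lemma hardy_bound_locally_bounded:
  assumes p: "1 \<le> p" and K: "compact K" "K \<subseteq> \<D>"
  shows "\<exists>M. \<forall>h \<in> {h. h holomorphic_on \<D> \<and> hardy_bound p h C}. \<forall>z\<in>K. norm (h z) \<le> M"
proof -
  obtain s where s: "s < 1" "K \<subseteq> cball 0 s"
  proof (cases "K = {}")
    case False
    have "continuous_on K (\<lambda>z. norm z)" by (intro continuous_intros)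
    then obtain w where w: "w \<in> K" "\<forall>z\<in>K. norm z \<le> norm w"
      using continuous_attains_sup[OF K(1) False] by auto
    hence "norm w < 1" "K \<subseteq> cball 0 (norm w)" using K(2) by auto
    thus thesis by (rule that)
  qed (use that[of 0] in simp)
  have "norm (h z) \<le> (C / (1 - s)) powr (1 / p)"
    if h: "h holomorphic_on \<D>" "hardy_bound p h C" and z: "z \<in> K" for h z
  proof -
    have "norm (h z) powr p \<le> C / (1 - s)"
      by (rule hardy_point_bound[OF h(1) hardy_boundD[OF h(2)]]) (use s z p in auto)
    hence "(norm (h z) powr p) powr (1 / p) \<le> (C / (1 - s)) powr (1 / p)"
      using p by (intro powr_mono2) auto
    thus ?thesis using p by (simp add: powr_powr)
  qed
  thus ?thesis by blast
qed

lemma radius_sequence: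
  obtains \<rho> :: "nat \<Rightarrow> real" where "\<And>n. 0 < \<rho> n" "\<And>n. \<rho> n < 1" "\<rho> \<longlonglongrightarrow> 1"
proof (rule that)
  show "0 < 1 - 1 / (real n + 2)" "1 - 1 / (real n + 2) < 1" for n by (auto simp: field_simps)
  have "(\<lambda>n. 1 / (real n + 2)) \<longlonglongrightarrow> 0"
    using LIMSEQ_ignore_initial_segment[OF lim_1_over_n[where 'a = real], of 2] by (simp add: add.commute)
  from tendsto_diff[OF tendsto_const[of 1] this]
  show "(\<lambda>n. 1 - 1 / (real n + 2)) \<longlonglongrightarrow> 1" by simp
qed

text \<open>The dilation is holomorphic past the closed disc, so on the disc it is a finite Blaschke
  product \<open>B\<close> times a zero-free \<open>G\<close>. With \<open>g\<close> a square root
  of \<open>G\<close> the factors are \<open>B * g\<close> and \<open>g\<close>, and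
  \<open>norm g powr (2 * p)\<close> is \<open>norm G powr p\<close>. On the unit circle
  \<open>G\<close> and the dilation have equal modulus, which gives the same bound
  \<open>C\<close>.\<close>

lemma hardy_factor_dilation:
  assumes f: "f holomorphic_on \<D>" "hardy_bound p f C" and p: "1 \<le> p"
    and nz: "\<exists>w\<in>\<D>. f w \<noteq> 0" and \<rho>: "0 < \<rho>" "\<rho> < 1"
  shows "\<exists>u g. (u holomorphic_on \<D> \<and> hardy_bound (2 * p) u C) \<and> (g holomorphic_on \<D> \<and> hardy_bound (2 * p) g C)
    \<and> (\<forall>z\<in>\<D>. f (of_real \<rho> * z) = u z * g z)"
proof -
  define F where "F z = f (of_real \<rho> * z)" for z
  define R where "R = 1 / \<rho>"
  have R: "1 < R" using \<rho> by (simp add: R_def)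
  have "(f \<circ> (\<lambda>z. of_real \<rho> * z)) holomorphic_on ball 0 R"
    by (rule holomorphic_on_compose_gen[OF _ f(1)])
      (use \<rho> in \<open>auto intro!: holomorphic_intros simp: norm_mult R_def field_simps\<close>)
  hence Fhol: "F holomorphic_on ball 0 R" by (simp add: o_def F_def[abs_def])
  obtain w where w: "w \<in> \<D>" "f w \<noteq> 0" using nz by auto
  have "\<exists>w\<in>ball 0 R. F w \<noteq> 0"
    by (rule bexI[of _ "w / of_real \<rho>"]) (use w \<rho> in \<open>auto simp: F_def R_def norm_divide divide_strict_right_mono\<close>)
  from Blaschke_factorization[OF Fhol R this]
  obtain B G where B: "B holomorphic_on \<D>" "\<forall>z\<in>\<D>. norm (B z) \<le> 1" and G: "G holomorphic_on ball 0 R"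
    "\<forall>z\<in>\<D>. G z \<noteq> 0 \<and> F z = B z * G z" "\<forall>z. norm z = 1 \<longrightarrow> norm (G z) = norm (F z)" by blast
  have Gd: "G holomorphic_on \<D>" by (rule holomorphic_on_subset[OF G(1)]) (use R in auto)
  have "simply_connected \<D>" by (simp add: convex_imp_simply_connected)
  then obtain g where g: "g holomorphic_on \<D>" "\<And>z. z \<in> \<D> \<Longrightarrow> G z = (g z)\<^sup>2"
    using simply_connected_eq_holomorphic_sqrt[of \<D>] Gd G(2) by auto
  have bG: "hardy_mean p G r \<le> C" if r: "0 < r" "r < 1" for r
  proof -
    have "hardy_mean p G r \<le> hardy_mean p G 1"
      by (rule hardy_mean_radius_mono[OF holomorphic_on_imp_continuous_on[OF holomorphic_on_subset[OF G(1)]] Gd])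
        (use r R p in auto)
    also have "\<dots> = hardy_mean p F 1" by (rule hardy_mean_cong) (use G(3) in auto)
    also have "\<dots> = hardy_mean p f \<rho>" unfolding F_def using hardy_mean_dilation[of p f \<rho> 1] by simp
    also have "\<dots> \<le> C" by (rule hardy_boundD[OF f(2) \<rho>])
    finally show ?thesis .
  qed
  have bg: "hardy_bound (2 * p) g C"
    unfolding hardy_bound_def
  proof (intro allI impI)
    fix r :: real assume r: "0 < r" "r < 1"
    have "hardy_mean (2 * p) g r = hardy_mean p G r"
      unfolding hardy_mean_def
    proof (rule integral_cong)
      fix \<theta>
      have "norm (G (rcis r \<theta>)) = norm (g (rcis r \<theta>)) powr 2"
        using g(2)[of "rcis r \<theta>"] r by (simp add: norm_rcis norm_power)
      thus "norm (g (rcis r \<theta>)) powr (2 * p) = norm (G (rcis r \<theta>)) powr p"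
        by (simp add: powr_powr del: powr_numeral)
    qed
    thus "hardy_mean (2 * p) g r \<le> C" using bG[OF r] by simp
  qed
  have "hardy_bound (2 * p) (\<lambda>z. B z * g z) (1 powr (2 * p) * C)"
    by (rule hardy_bound_mult_bounded[OF g(1) B(1)]) (use B bg p in auto)
  hence "hardy_bound (2 * p) (\<lambda>z. B z * g z) C" by simp
  moreover have "f (of_real \<rho> * z) = (B z * g z) * g z" if "z \<in> \<D>" for z
    using G(2) g(2)[OF that] that by (simp add: F_def power2_eq_square)
  moreover have "(\<lambda>z. B z * g z) holomorphic_on \<D>" by (intro holomorphic_intros B(1) g(1))
  ultimately show ?thesis
    using g(1) bg by (rule_tac exI[of _ "\<lambda>z. B z * g z"], rule_tac exI[of _ g]) simp
qed

text \<open>The factors of the dilations are uniformly bounded in H^(2p), hence form normal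
  families. Limits along a common subsequence factor \<open>f\<close> itself, and the bound
  \<open>C\<close> passes to them.\<close>

theorem hardy_factorization:
  assumes f: "f holomorphic_on \<D>" "hardy_bound p f C" and p: "1 \<le> p"
  obtains u g where "u holomorphic_on \<D>" "hardy_bound (2 * p) u C" "g holomorphic_on \<D>" "hardy_bound (2 * p) g C"
    "\<And>z. z \<in> \<D> \<Longrightarrow> f z = u z * g z"
proof (cases "\<exists>w\<in>\<D>. f w \<noteq> 0")
  case False
  have "0 \<le> C" by (rule hardy_bound_nonneg[OF f(2)])
  hence "hardy_bound (2 * p) (\<lambda>_. 0) C" by (simp add: hardy_bound_def hardy_mean_def)
  thus thesis using that[of "\<lambda>_. 0" "\<lambda>_. 0"] False by simp
next
  case True
  obtain \<rho> :: "nat \<Rightarrow> real" where \<rho>: "\<And>n. 0 < \<rho> n" "\<And>n. \<rho> n < 1" and \<rho>lim: "\<rho> \<longlonglongrightarrow> 1"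
    using radius_sequence by blast
  define H where "H = {h. h holomorphic_on \<D> \<and> hardy_bound (2 * p) h C}"
  have H: "h holomorphic_on \<D>" "hardy_bound (2 * p) h C" if "h \<in> H" for h
    using that by (auto simp: H_def)
  have "\<forall>n. \<exists>u g. u \<in> H \<and> g \<in> H \<and> (\<forall>z\<in>\<D>. f (of_real (\<rho> n) * z) = u z * g z)"
    using hardy_factor_dilation[OF f p True \<rho>] by (simp add: H_def)
  from choice[OF this] obtain U
    where "\<forall>n. \<exists>g. U n \<in> H \<and> g \<in> H \<and> (\<forall>z\<in>\<D>. f (of_real (\<rho> n) * z) = U n z * g z)" by (elim exE)
  from choice[OF this] obtain G
    where G: "\<forall>n. U n \<in> H \<and> G n \<in> H \<and> (\<forall>z\<in>\<D>. f (of_real (\<rho> n) * z) = U n z * G n z)" by (elim exE)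
  have UG: "U n \<in> H" "G n \<in> H" "z \<in> \<D> \<Longrightarrow> f (of_real (\<rho> n) * z) = U n z * G n z" for n z
    using spec[OF G, of n] by simp_all
  have bd: "\<exists>B. \<forall>h\<in>H. \<forall>z\<in>K. norm (h z) \<le> B" if "compact K" "K \<subseteq> \<D>" for K
    unfolding H_def by (rule hardy_bound_locally_bounded[OF _ that]) (use p in simp)
  obtain u r1 where u: "u holomorphic_on \<D>" "strict_mono r1" "\<And>z. z \<in> \<D> \<Longrightarrow> (\<lambda>n. U (r1 n) z) \<longlonglongrightarrow> u z"
    "\<And>K. compact K \<Longrightarrow> K \<subseteq> \<D> \<Longrightarrow> uniform_limit K (U \<circ> r1) u sequentially"
    by (rule Montel[of \<D> H U]) (use bd UG(1) H(1) in auto)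
  obtain g r2 where g: "g holomorphic_on \<D>" "strict_mono r2" "\<And>z. z \<in> \<D> \<Longrightarrow> (\<lambda>n. (G \<circ> r1) (r2 n) z) \<longlonglongrightarrow> g z"
    "\<And>K. compact K \<Longrightarrow> K \<subseteq> \<D> \<Longrightarrow> uniform_limit K ((G \<circ> r1) \<circ> r2) g sequentially"
    by (rule Montel[of \<D> H "G \<circ> r1"]) (use bd UG(2) H(1) in auto)
  have bound: "hardy_bound (2 * p) k C"
    if "\<And>n. K n \<in> H" "\<And>S. compact S \<Longrightarrow> S \<subseteq> \<D> \<Longrightarrow> uniform_limit S K k sequentially" for K k
    unfolding hardy_bound_def
  proof (intro allI impI)
    fix r :: real assume r: "0 < r" "r < 1"
    hence "sphere 0 r \<subseteq> \<D>" by auto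
    hence u: "uniform_limit (sphere 0 r) K k sequentially" by (intro that(2)) simp_all
    show "hardy_mean (2 * p) k r \<le> C"
      by (rule hardy_mean_limit_le[where F = K])
        (use H[OF that(1)] u r p in \<open>auto intro: hardy_boundD\<close>)
  qed
  have bu: "hardy_bound (2 * p) u C" by (rule bound[of "U \<circ> r1"]) (use UG(1) u(4) in auto)
  have bg: "hardy_bound (2 * p) g C" by (rule bound[of "(G \<circ> r1) \<circ> r2"]) (use UG(2) g(4) in auto)
  have "f z = u z * g z" if z: "z \<in> \<D>" for z
  proof (rule LIMSEQ_unique)
    have "(\<lambda>n. U (r1 (r2 n)) z) \<longlonglongrightarrow> u z"
      using LIMSEQ_subseq_LIMSEQ[OF u(3)[OF z] g(2)] by (simp add: o_def)
    moreover have "(\<lambda>n. G (r1 (r2 n)) z) \<longlonglongrightarrow> g z" using g(3)[OF z] by simp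
    ultimately show "(\<lambda>n. f (of_real (\<rho> (r1 (r2 n))) * z)) \<longlonglongrightarrow> u z * g z"
      unfolding UG(3)[OF z] by (rule tendsto_mult)
    have "strict_mono (r1 \<circ> r2)" using u(2) g(2) by (rule strict_mono_o)
    hence "(\<lambda>n. of_real (\<rho> (r1 (r2 n))) * z) \<longlonglongrightarrow> of_real 1 * z"
      using LIMSEQ_subseq_LIMSEQ[OF \<rho>lim] by (intro tendsto_intros) (auto simp: o_def)
    hence l: "(\<lambda>n. of_real (\<rho> (r1 (r2 n))) * z) \<longlonglongrightarrow> z" by simp
    have "isCont f z"
      using holomorphic_on_imp_continuous_on[OF f(1)] z by (simp add: continuous_on_eq_continuous_at)
    thus "(\<lambda>n. f (of_real (\<rho> (r1 (r2 n))) * z)) \<longlonglongrightarrow> f z"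
      using l by (rule isCont_tendsto_compose)
  qed
  with u(1) bu g(1) bg show thesis by (rule that)
qed

text \<open>The inequality \<open>x * y \<le> x\<^sup>2 / (2 * sqrt \<eta>) + sqrt \<eta> *
  y\<^sup>2 / 2\<close> replaces that of Cauchy and Schwarz. The weight balances a small first
  factor against a second one that is merely bounded.\<close>

lemma hardy_bound_mult:
  assumes f: "f holomorphic_on \<D>" "hardy_bound (2 * p) f \<eta>" and g: "g holomorphic_on \<D>" "hardy_bound (2 * p) g C"
    and \<eta>: "0 < \<eta>" and p: "0 < p"
  shows "hardy_bound p (\<lambda>z. f z * g z) (sqrt \<eta> * (1 + C) / 2)"
  unfolding hardy_bound_def
proof (intro allI impI)
  fix r :: real assume r: "0 < r" "r < 1"
  have I: "(\<lambda>\<theta>. norm (k (rcis r \<theta>)) powr s) integrable_on {0..2*pi}" if "k holomorphic_on \<D>" "0 < s" for k s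
    by (rule integrable_hardy_mean[OF holomorphic_on_disc_continuous(1)[OF that(1) r(2)]]) (use r that in auto)
  have "hardy_mean p (\<lambda>z. f z * g z) r \<le> integral {0..2*pi} (\<lambda>\<theta>. 1 / (2 * sqrt \<eta>) * norm (f (rcis r \<theta>)) powr (2 * p)
      + sqrt \<eta> / 2 * norm (g (rcis r \<theta>)) powr (2 * p))"
    unfolding hardy_mean_def
  proof (intro integral_le integrable_add integrable_on_mult_right)
    show "(\<lambda>\<theta>. norm (f (rcis r \<theta>) * g (rcis r \<theta>)) powr p) integrable_on {0..2 * pi}"
      by (rule I[of "\<lambda>z. f z * g z"]) (use f g p in \<open>auto intro: holomorphic_intros\<close>)
    fix \<theta>
    define x y where "x = norm (f (rcis r \<theta>)) powr p" and "y = norm (g (rcis r \<theta>)) powr p"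
    have xy: "norm (f (rcis r \<theta>)) powr (2 * p) = x\<^sup>2" "norm (g (rcis r \<theta>)) powr (2 * p) = y\<^sup>2"
      by (simp_all add: x_def y_def power2_eq_square flip: powr_add)
    have "0 \<le> (x / sqrt \<eta> - y)\<^sup>2" by simp
    hence "2 * (x * y) / sqrt \<eta> \<le> x\<^sup>2 / \<eta> + y\<^sup>2"
      using \<eta> by (simp add: power2_diff power_divide)
    hence "sqrt \<eta> / 2 * (2 * (x * y) / sqrt \<eta>) \<le> sqrt \<eta> / 2 * (x\<^sup>2 / \<eta> + y\<^sup>2)"
      using \<eta> by (intro mult_left_mono) auto
    hence "x * y \<le> sqrt \<eta> / \<eta> / 2 * x\<^sup>2 + sqrt \<eta> / 2 * y\<^sup>2"
      using \<eta> by (simp add: algebra_simps)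
    moreover have "sqrt \<eta> / \<eta> = 1 / sqrt \<eta>" using \<eta> by (simp add: real_div_sqrt field_simps)
    ultimately have "x * y \<le> 1 / (2 * sqrt \<eta>) * x\<^sup>2 + sqrt \<eta> / 2 * y\<^sup>2" by simp
    thus "norm (f (rcis r \<theta>) * g (rcis r \<theta>)) powr p \<le>
        1 / (2 * sqrt \<eta>) * norm (f (rcis r \<theta>)) powr (2 * p) + sqrt \<eta> / 2 * norm (g (rcis r \<theta>)) powr (2 * p)"
      unfolding xy by (simp add: norm_mult powr_mult x_def y_def)
  qed (use I f g p in auto)
  also have "\<dots> = 1 / (2 * sqrt \<eta>) * hardy_mean (2 * p) f r + sqrt \<eta> / 2 * hardy_mean (2 * p) g r"
    unfolding hardy_mean_def
    by (subst integral_add) (use I f g p in \<open>auto intro!: integrable_on_mult_right simp del: times_divide_eq_left\<close>)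
  also have "\<dots> \<le> 1 / (2 * sqrt \<eta>) * \<eta> + sqrt \<eta> / 2 * C"
    using \<eta> by (intro add_mono mult_left_mono hardy_boundD[OF f(2) r] hardy_boundD[OF g(2) r]) auto
  also have "1 / (2 * sqrt \<eta>) * \<eta> = sqrt \<eta> / 2" using \<eta> by (simp add: real_div_sqrt)
  finally show "hardy_mean p (\<lambda>z. f z * g z) r \<le> sqrt \<eta> * (1 + C) / 2" by (simp add: algebra_simps)
qed

text \<open>Clarkson's inequality needs an exponent at least \<open>2\<close>, so \<open>f\<close> is factored into two functions of \<open>H\<^sup>2\<^sup>p\<close>.\<close>
theorem dilation_converges:
  assumes f: "f holomorphic_on \<D>" "hardy_bound p f C" and p: "1 \<le> p" and e: "0 < \<epsilon>"
  shows "\<exists>\<rho>. 0 < \<rho> \<and> \<rho> < 1 \<and> hardy_bound p (\<lambda>z. f z - f (of_real \<rho> * z)) \<epsilon>"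
proof -
  obtain u g where ug: "u holomorphic_on \<D>" "hardy_bound (2 * p) u C" "g holomorphic_on \<D>" "hardy_bound (2 * p) g C"
    "\<And>z. z \<in> \<D> \<Longrightarrow> f z = u z * g z" using hardy_factorization[OF f p] by blast
  have C: "0 \<le> C" by (rule hardy_bound_nonneg[OF f(2)])
  obtain \<rho> :: "nat \<Rightarrow> real" where \<rho>: "\<And>n. 0 < \<rho> n" "\<And>n. \<rho> n < 1" and \<rho>lim: "\<rho> \<longlonglongrightarrow> 1"
    using radius_sequence by blast
  \<comment> \<open>Chosen so that the two products below, each bounded by
    \<open>s * (1 + C) / 2\<close>, add up to \<open>\<epsilon>\<close> after the factor
    \<open>2 powr p\<close>.\<close>
  define s where "s = \<epsilon> / (2 powr p * (1 + C))"
  have s: "0 < s" using e C by (simp add: s_def)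
  define \<eta> where "\<eta> = s\<^sup>2"
  have \<eta>: "0 < \<eta>" "sqrt \<eta> = s" using s by (auto simp: \<eta>_def)
  have "eventually (\<lambda>n. hardy_bound (2 * p) (\<lambda>z. u z - u (of_real (\<rho> n) * z)) \<eta> \<and>
      hardy_bound (2 * p) (\<lambda>z. g z - g (of_real (\<rho> n) * z)) \<eta>) sequentially"
    using p by (intro eventually_conj
      dilation_converges_of_two_le[OF ug(1,2) _ \<rho>(1) less_imp_le[OF \<rho>(2)] \<rho>lim \<eta>(1)]
      dilation_converges_of_two_le[OF ug(3,4) _ \<rho>(1) less_imp_le[OF \<rho>(2)] \<rho>lim \<eta>(1)]) simp_all
  from eventually_happens[OF this] obtain n
    where n: "hardy_bound (2 * p) (\<lambda>z. u z - u (of_real (\<rho> n) * z)) \<eta>"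
      "hardy_bound (2 * p) (\<lambda>z. g z - g (of_real (\<rho> n) * z)) \<eta>" by auto
  let ?u = "\<lambda>z. u (of_real (\<rho> n) * z)" and ?g = "\<lambda>z. g (of_real (\<rho> n) * z)"
  have uh: "?u holomorphic_on \<D>" and gh: "?g holomorphic_on \<D>"
    by (rule dilation_holomorphic[OF _ less_imp_le[OF \<rho>(1)] less_imp_le[OF \<rho>(2)]], fact ug)+
  have ub: "hardy_bound (2 * p) ?u C"
    unfolding hardy_bound_def hardy_mean_dilation
  proof (intro allI impI)
    fix r :: real assume r: "0 < r" "r < 1"
    have "\<rho> n * r < 1 * 1" using \<rho>[of n] r by (intro mult_strict_mono) auto
    thus "hardy_mean (2 * p) u (\<rho> n * r) \<le> C" using hardy_boundD[OF ug(2)] \<rho>[of n] r by simp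
  qed
  have p0: "0 < p" using p by simp
  \<comment> \<open>The difference of the two products is split as
    \<open>(u - ?u) * g + (g - ?g) * ?u\<close>, so that each term has one small factor.\<close>
  have 1: "hardy_bound p (\<lambda>z. (u z - ?u z) * g z) (sqrt \<eta> * (1 + C) / 2)"
    by (rule hardy_bound_mult[OF _ n(1) ug(3,4) \<eta>(1) p0]) (intro holomorphic_intros ug uh)
  have 2: "hardy_bound p (\<lambda>z. (g z - ?g z) * ?u z) (sqrt \<eta> * (1 + C) / 2)"
    by (rule hardy_bound_mult[OF _ n(2) uh ub \<eta>(1) p0]) (intro holomorphic_intros ug gh)
  have "hardy_bound p (\<lambda>z. (u z - ?u z) * g z + (g z - ?g z) * ?u z)
      (2 powr p * (sqrt \<eta> * (1 + C) / 2 + sqrt \<eta> * (1 + C) / 2))"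
    by (rule hardy_bound_add[OF _ _ 1 2 p0]) (intro holomorphic_intros ug uh gh)+
  moreover have "2 powr p * (sqrt \<eta> * (1 + C) / 2 + sqrt \<eta> * (1 + C) / 2) = \<epsilon>"
  proof -
    have "2 powr p * (1 + C) \<noteq> 0" using C by simp
    moreover have "2 powr p * (sqrt \<eta> * (1 + C) / 2 + sqrt \<eta> * (1 + C) / 2) = s * (2 powr p * (1 + C))"
      unfolding \<eta>(2) by (simp add: algebra_simps)
    ultimately show ?thesis unfolding s_def by (simp only: nonzero_divide_eq_eq) simp
  qed
  ultimately have b: "hardy_bound p (\<lambda>z. (u z - ?u z) * g z + (g z - ?g z) * ?u z) \<epsilon>" by simp
  have res: "hardy_bound p (\<lambda>z. f z - f (of_real (\<rho> n) * z)) \<epsilon>"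
  proof (rule hardy_bound_cong[OF _ b])
    fix z assume z: "z \<in> \<D>"
    have "norm (of_real (\<rho> n) * z) \<le> norm z" using \<rho>[of n] by (simp add: norm_mult mult_left_le_one_le)
    hence z': "of_real (\<rho> n) * z \<in> \<D>" using z by simp
    show "norm ((u z - ?u z) * g z + (g z - ?g z) * ?u z) = norm (f z - f (of_real (\<rho> n) * z))"
      unfolding ug(5)[OF z] ug(5)[OF z'] by (simp add: algebra_simps)
  qed
  show ?thesis by (rule exI[of _ "\<rho> n"]) (intro conjI \<rho> res)
qed

text \<open>A dilation of \<open>f\<close> has a Taylor series that converges beyond the closed
  disc, hence uniformly on it.\<close>

theorem polynomials_dense_hardy:
  assumes f: "f holomorphic_on \<D>" "hardy_bound p f C" and p: "1 \<le> p" and e: "0 < \<epsilon>"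
  shows "\<exists>n a. hardy_bound p (\<lambda>z. f z - (\<Sum>i<n. a i * z ^ i)) \<epsilon>"
proof -
  have p0: "0 < p" using p by simp
  define \<delta> where "\<delta> = \<epsilon> / 2 powr p / 2"
  have \<delta>: "0 < \<delta>" "2 powr p * (\<delta> + \<delta>) = \<epsilon>" using e by (auto simp: \<delta>_def)
  obtain \<rho> where \<rho>: "0 < \<rho>" "\<rho> < 1" and b1: "hardy_bound p (\<lambda>z. f z - f (of_real \<rho> * z)) \<delta>"
    using dilation_converges[OF f p \<delta>(1)] by blast
  define F where "F z = f (of_real \<rho> * z)" for z
  define a where "a i = (deriv ^^ i) f 0 / fact i * of_real \<rho> ^ i" for i
  have sums: "(\<lambda>i. a i * z ^ i) sums F z" if "norm z < 1 / \<rho>" for z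
  proof -
    have "(\<lambda>n. (deriv ^^ n) f 0 / fact n * (of_real \<rho> * z - 0) ^ n) sums f (of_real \<rho> * z)"
      by (rule holomorphic_power_series[OF f(1)]) (use that \<rho> in \<open>auto simp: norm_mult field_simps\<close>)
    thus ?thesis by (simp add: a_def F_def power_mult_distrib mult_ac)
  qed
  \<comment> \<open>A radius strictly between \<open>1\<close> and \<open>1 / \<rho>\<close>;
    convergence at this single point makes the radius of convergence exceed
    \<open>1\<close>.\<close>
  define R where "R = (1 + 1 / \<rho>) / 2"
  have R: "1 < R" "R < 1 / \<rho>" using \<rho> by (auto simp: R_def field_simps)
  have "ereal (norm (of_real R :: complex)) \<le> conv_radius a"
    by (rule conv_radius_geI) (use sums[of "of_real R"] R in \<open>auto simp: sums_iff\<close>)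
  moreover have "ereal 1 < ereal (norm (of_real R :: complex))" using R(1) by simp
  ultimately have "ereal 1 < conv_radius a" by (rule less_le_trans[rotated])
  hence "uniform_limit (cball 0 1) (\<lambda>n z. \<Sum>i<n. a i * (z - 0) ^ i) (\<lambda>z. suminf (\<lambda>i. a i * (z - 0) ^ i)) sequentially"
    by (rule powser_uniform_limit)
  moreover have "0 < (\<delta> / (2 * pi)) powr (1 / p)" using \<delta> by simp
  ultimately have "eventually (\<lambda>n. \<forall>z\<in>cball 0 1. dist (\<Sum>i<n. a i * (z - 0) ^ i) (suminf (\<lambda>i. a i * (z - 0) ^ i))
      < (\<delta> / (2 * pi)) powr (1 / p)) sequentially"
    by (rule uniform_limitD)
  then obtain n where n: "\<And>z. z \<in> cball 0 1 \<Longrightarrow> dist (\<Sum>i<n. a i * (z - 0) ^ i) (suminf (\<lambda>i. a i * (z - 0) ^ i))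
      < (\<delta> / (2 * pi)) powr (1 / p)"
    unfolding eventually_sequentially by blast
  let ?P = "\<lambda>z. \<Sum>i<n. a i * z ^ i"
  have Fh: "F holomorphic_on \<D>" unfolding F_def by (rule dilation_holomorphic[OF f(1)]) (use \<rho> in auto)
  have Ph: "?P holomorphic_on \<D>" by (intro holomorphic_intros)
  have nb: "norm (F z - ?P z) \<le> (\<delta> / (2 * pi)) powr (1 / p)" if z: "z \<in> \<D>" for z
  proof -
    have "1 < 1 / \<rho>" using \<rho> by simp
    hence "norm z < 1 / \<rho>" using z by simp
    thus ?thesis using n[of z] sums[of z] z
      by (simp add: sums_iff dist_norm norm_minus_commute)
  qed
  have "hardy_bound p (\<lambda>z. F z - ?P z) (2 * pi * ((\<delta> / (2 * pi)) powr (1 / p)) powr p)"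
    by (rule hardy_bound_uniform[OF holomorphic_on_diff[OF Fh Ph] nb p0])
  moreover have "2 * pi * ((\<delta> / (2 * pi)) powr (1 / p)) powr p = \<delta>"
    using \<delta>(1) p by (simp add: powr_powr)
  ultimately have b2: "hardy_bound p (\<lambda>z. F z - ?P z) \<delta>" by simp
  have "hardy_bound p (\<lambda>z. (f z - F z) + (F z - ?P z)) (2 powr p * (\<delta> + \<delta>))"
    by (rule hardy_bound_add[OF holomorphic_on_diff[OF f(1) Fh] holomorphic_on_diff[OF Fh Ph] _ b2 p0])
      (use b1 in \<open>simp add: F_def\<close>)
  hence "hardy_bound p (\<lambda>z. f z - ?P z) \<epsilon>" using \<delta>(2) by simp
  thus ?thesis by (intro exI)
qed

section \<open>Non-Blaschke zero sets\<close>

text \<open>Dividing by a Blaschke factor does not increase the norm, since the factor has modulus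
  close to \<open>1\<close> near the circle. On the circle of radius \<open>r\<close> the estimate
  loses only a factor \<open>c r\<close>, which tends to \<open>1\<close>, and means grow with the
  radius.\<close>

lemma hardy_divide_zero:
  assumes f: "f holomorphic_on \<D>" "hardy_bound p f C" and p: "1 \<le> p" and a: "a \<in> \<D>" "f a = 0"
  shows "\<exists>g. g holomorphic_on \<D> \<and> hardy_bound p g C \<and> (\<forall>z\<in>\<D>. f z * (1 - cnj a * z) = (z - a) * g z)"
proof (cases "\<forall>w\<in>\<D>. f w = 0")
  case True
  have "hardy_bound p (\<lambda>_. 0) C"
    using hardy_bound_nonneg[OF f(2)] by (simp add: hardy_bound_def hardy_mean_def)
  thus ?thesis using True by (intro exI[of _ "\<lambda>_. 0"]) simp
next
  case False
  have C: "0 \<le> C" by (rule hardy_bound_nonneg[OF f(2)])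
  obtain n q where q: "0 < n" "q holomorphic_on \<D>" "\<And>z. z \<in> \<D> \<Longrightarrow> f z = (z - a) ^ n * q z"
    using False divide_zero_factor[OF f(1) a] by metis
  define k where "k z = (z - a) ^ (n - 1) * q z" for z
  have k: "k holomorphic_on \<D>" unfolding k_def by (intro holomorphic_intros q)
  have fk: "f z = (z - a) * k z" if "z \<in> \<D>" for z
  proof -
    have "(z - a) ^ n = (z - a) * (z - a) ^ (n - 1)" using q(1) by (metis power_minus_mult mult.commute)
    thus ?thesis using q(3)[OF that] by (simp add: k_def)
  qed
  define g where "g z = (1 - cnj a * z) * k z" for z
  have g: "g holomorphic_on \<D>" unfolding g_def by (intro holomorphic_intros k)
  \<comment> \<open>For \<open>norm z = r\<close> one has \<open>norm (1 - cnj a * z) \<le> r * norm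
    (z - a) + (1 - r\<^sup>2)\<close> and \<open>r - norm a \<le> norm (z - a)\<close>.\<close>
  define c where "c r = 1 + (1 - r\<^sup>2) / (r - norm a)" for r
  have cr: "hardy_mean p g r \<le> c r powr p * C" if r: "norm a < r" "r < 1" for r
  proof -
    have r0: "0 < r" using r norm_ge_zero[of a] by linarith
    have r2: "r\<^sup>2 \<le> 1" using r r0 by (simp add: power_le_one)
    have c0: "0 \<le> c r" unfolding c_def using r r2 by (intro add_nonneg_nonneg divide_nonneg_nonneg) auto
    have "hardy_mean p g r \<le> hardy_mean p (\<lambda>z. of_real (c r) * f z) r"
    proof (rule hardy_mean_mono)
      fix z :: complex assume z: "norm z = r"
      have "z * cnj z = of_real (r\<^sup>2)" using complex_norm_square[of z] z by simp
      hence "1 - cnj a * z = z * cnj (z - a) + of_real (1 - r\<^sup>2)" by (simp add: algebra_simps)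
      hence "norm (1 - cnj a * z) \<le> norm (z * cnj (z - a)) + norm (of_real (1 - r\<^sup>2) :: complex)"
        by (simp only: norm_triangle_ineq)
      also have "norm (z * cnj (z - a)) = r * norm (z - a)"
        unfolding norm_mult complex_mod_cnj z ..
      also have "norm (of_real (1 - r\<^sup>2) :: complex) = 1 - r\<^sup>2" using r2 by (simp only: norm_of_real)
      finally have 1: "norm (1 - cnj a * z) \<le> r * norm (z - a) + (1 - r\<^sup>2)" .
      have 2: "r - norm a \<le> norm (z - a)" using norm_triangle_ineq2[of z a] z by simp
      have fz: "norm (f z) = norm (z - a) * norm (k z)"
        using fk[of z] z r by (simp add: norm_mult)
      have "(r - norm a) * norm (k z) \<le> norm (f z)" unfolding fz using 2 by (intro mult_right_mono) auto
      hence kz: "norm (k z) \<le> norm (f z) / (r - norm a)" using r by (simp add: field_simps)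
      have "norm (g z) \<le> (r * norm (z - a) + (1 - r\<^sup>2)) * norm (k z)"
        unfolding g_def norm_mult by (intro mult_right_mono 1) auto
      also have "\<dots> = r * norm (f z) + (1 - r\<^sup>2) * norm (k z)" by (simp add: fz algebra_simps)
      also have "\<dots> \<le> 1 * norm (f z) + (1 - r\<^sup>2) * (norm (f z) / (r - norm a))"
        using r r2 by (intro add_mono mult_right_mono mult_left_mono kz) auto
      also have "\<dots> = c r * norm (f z)" by (simp add: c_def algebra_simps)
      finally show "norm (g z) \<le> norm (of_real (c r) * f z)" using c0 by (simp add: norm_mult)
    qed (use r r0 p f g in \<open>auto intro!: holomorphic_on_disc_continuous(1) holomorphic_intros\<close>)
    also have "\<dots> = c r powr p * hardy_mean p f r" using c0 by (simp add: hardy_mean_cmult)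
    also have "\<dots> \<le> c r powr p * C" by (intro mult_left_mono hardy_boundD[OF f(2)] r r0) auto
    finally show ?thesis .
  qed
  have "hardy_mean p g s \<le> C" if s: "0 < s" "s < 1" for s
  proof -
    have "norm a \<noteq> 1" using a by simp
    hence "(c \<longlongrightarrow> 1 + (1 - 1\<^sup>2) / (1 - norm a)) (at_left 1)"
      unfolding c_def by (intro tendsto_intros) auto
    hence "((\<lambda>r. c r powr p * C) \<longlongrightarrow> 1 powr p * C) (at_left 1)"
      by (intro tendsto_intros) auto
    moreover have "eventually (\<lambda>r. hardy_mean p g s \<le> c r powr p * C) (at_left 1)"
      unfolding eventually_at_left_field
    proof (intro exI[of _ "max s (norm a)"] conjI allI impI)
      show "max s (norm a) < 1" using s a by simp
      fix r assume r: "max s (norm a) < r" "r < 1"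
      have "hardy_mean p g s \<le> hardy_mean p g r"
        by (rule hardy_mean_radius_mono_disc[OF g]) (use r s p in auto)
      thus "hardy_mean p g s \<le> c r powr p * C" using cr[of r] r by simp
    qed
    ultimately have "hardy_mean p g s \<le> 1 powr p * C"
      by (rule tendsto_lowerbound) simp
    thus ?thesis by simp
  qed
  hence "hardy_bound p g C" by (simp add: hardy_bound_def)
  moreover have "f z * (1 - cnj a * z) = (z - a) * g z" if "z \<in> \<D>" for z
    using fk[OF that] by (simp add: g_def)
  ultimately show ?thesis using g by (intro exI[of _ g]) simp
qed

text \<open>The identity is free of quotients, so it can be evaluated at the next zero: there the
  product of differences is nonzero, and \<open>g\<close> inherits the zero.\<close>

lemma hardy_divide_zeros:
  assumes f: "f holomorphic_on \<D>" "hardy_bound p f C" and p: "1 \<le> p"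
    and A: "finite A" "A \<subseteq> \<D>" "\<And>a. a \<in> A \<Longrightarrow> f a = 0"
  shows "\<exists>g. g holomorphic_on \<D> \<and> hardy_bound p g C \<and>
    (\<forall>z\<in>\<D>. f z * (\<Prod>a\<in>A. 1 - cnj a * z) = (\<Prod>a\<in>A. z - a) * g z)"
  using A
proof (induction A rule: finite_induct)
  case empty
  show ?case using f by (intro exI[of _ f]) simp
next
  case (insert a A)
  obtain g where g: "g holomorphic_on \<D>" "hardy_bound p g C"
    "\<forall>z\<in>\<D>. f z * (\<Prod>a\<in>A. 1 - cnj a * z) = (\<Prod>a\<in>A. z - a) * g z"
    using insert.IH insert.prems by auto
  have aD: "a \<in> \<D>" and fa: "f a = 0" using insert.prems by auto
  have "(\<Prod>b\<in>A. a - b) * g a = 0" using g(3) aD fa by (metis mult_zero_left)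
  moreover have "(\<Prod>b\<in>A. a - b) \<noteq> 0" using insert.hyps by auto
  ultimately have "g a = 0" by simp
  from hardy_divide_zero[OF g(1,2) p aD this] obtain k
    where k: "k holomorphic_on \<D>" "hardy_bound p k C" "\<forall>z\<in>\<D>. g z * (1 - cnj a * z) = (z - a) * k z" by auto
  have "f z * (\<Prod>a\<in>insert a A. 1 - cnj a * z) = (\<Prod>a\<in>insert a A. z - a) * k z" if z: "z \<in> \<D>" for z
  proof -
    have "f z * (\<Prod>a\<in>insert a A. 1 - cnj a * z) = (f z * (\<Prod>a\<in>A. 1 - cnj a * z)) * (1 - cnj a * z)"
      using insert.hyps by (simp add: mult_ac)
    also have "\<dots> = (\<Prod>a\<in>A. z - a) * (g z * (1 - cnj a * z))"
      using bspec[OF g(3) z] by (simp add: mult_ac)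
    also have "\<dots> = (\<Prod>a\<in>insert a A. z - a) * k z"
      using bspec[OF k(3) z] insert.hyps by (simp add: mult_ac)
    finally show ?thesis .
  qed
  thus ?case using k(1,2) by (intro exI[of _ k]) simp
qed

text \<open>The difference of \<open>(norm (1 - cnj a * z))\<^sup>2\<close> and
  \<open>(norm (z - a))\<^sup>2\<close> is
  \<open>(1 - (norm a)\<^sup>2) * (1 - (norm z)\<^sup>2)\<close>, and
  \<open>1 - t \<le> exp (- t)\<close>. In the constant \<open>8\<close>, a factor \<open>4\<close>
  bounds the first square and a factor \<open>2\<close> comes from taking the root.\<close>

lemma Blaschke_factor_le_exp:
  fixes a z :: complex
  assumes a: "norm a < 1" and z: "norm z < 1"
  shows "norm (z - a) \<le> norm (1 - cnj a * z) * exp (- ((1 - (norm z)\<^sup>2) / 8 * (1 - norm a)))"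
proof (rule power2_le_imp_le)
  let ?t = "(1 - (norm z)\<^sup>2) * (1 - norm a) / 4"
  let ?y = "norm (1 - cnj a * z)"
  have z2: "(norm z)\<^sup>2 \<le> 1" using z by (simp add: power_le_one)
  have a2: "(norm a)\<^sup>2 \<le> norm a" using a by (simp add: power2_eq_square mult_left_le)
  have id: "(norm (z - a))\<^sup>2 = ?y\<^sup>2 - (1 - (norm a)\<^sup>2) * (1 - (norm z)\<^sup>2)"
    unfolding cmod_power2 by (simp add: power2_eq_square algebra_simps)
  have "?y \<le> 1 + norm (cnj a * z)" using norm_triangle_ineq4[of 1 "cnj a * z"] by simp
  moreover have "norm (cnj a * z) \<le> 1" using a z by (simp add: norm_mult mult_le_one)
  ultimately have "?y \<le> 2" by linarith
  hence y2: "?y\<^sup>2 \<le> 4" using power_mono[of ?y 2 2] by simp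
  have "?y\<^sup>2 * ?t \<le> 4 * ?t" using y2 z2 a by (intro mult_right_mono) auto
  also have "\<dots> = (1 - norm a) * (1 - (norm z)\<^sup>2)" by simp
  also have "\<dots> \<le> (1 - (norm a)\<^sup>2) * (1 - (norm z)\<^sup>2)" using a2 z2 by (intro mult_right_mono) auto
  finally have "(norm (z - a))\<^sup>2 \<le> ?y\<^sup>2 * (1 - ?t)" unfolding id by (simp add: algebra_simps)
  also have "\<dots> \<le> ?y\<^sup>2 * exp (- ?t)" using exp_ge_add_one_self[of "- ?t"] by (intro mult_left_mono) auto
  also have "\<dots> = (?y * exp (- ((1 - (norm z)\<^sup>2) / 8 * (1 - norm a))))\<^sup>2"
    by (simp add: power_mult_distrib power2_eq_square flip: exp_add)
  finally show "(norm (z - a))\<^sup>2 \<le> (?y * exp (- ((1 - (norm z)\<^sup>2) / 8 * (1 - norm a))))\<^sup>2" .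
qed simp

lemma exp_minus_le:
  fixes x :: real
  assumes "0 \<le> x" shows "exp (- x) \<le> 1 / (1 + x)"
proof -
  have "1 / exp x \<le> 1 / (1 + x)"
    by (rule frac_le) (use assms exp_ge_add_one_self[of x] in auto)
  thus ?thesis by (simp add: exp_minus inverse_eq_divide)
qed

text \<open>After division by the first \<open>N\<close> Blaschke factors the quotient still obeys
  the same bound \<open>K\<close> at \<open>z\<close>, while the product of the factors decays
  exponentially in the partial sum of \<open>1 - norm (a n)\<close>. A divergent sum leaves only the
  value \<open>0\<close>.\<close>

theorem hardy_zero_of_non_Blaschke:
  assumes f: "f holomorphic_on \<D>" "hardy_bound p f C" and p: "1 \<le> p"
    and a: "inj_on a {1..}" "\<And>n. a n \<in> \<D>" "\<And>n. f (a n) = 0"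
    and div: "filterlim (\<lambda>N. \<Sum>n=1..N. 1 - norm (a n)) at_top sequentially"
    and z: "z \<in> \<D>"
  shows "f z = 0"
proof (rule ccontr)
  assume nz: "f z \<noteq> 0"
  have z1: "norm z < 1" using z by simp
  define \<kappa> where "\<kappa> = (1 - (norm z)\<^sup>2) / 8"
  have \<kappa>: "\<kappa> > 0" using z1 by (simp add: \<kappa>_def power_less_one_iff)
  define K where "K = (C / (1 - norm z)) powr (1 / p)"
  have K: "0 \<le> K" by (simp add: K_def)
  have main: "norm (f z) \<le> K * exp (- (\<kappa> * (\<Sum>n=1..N. 1 - norm (a n))))" for N
  proof -
    let ?A = "a ` {1..N}"
    have inj: "inj_on a {1..N}" by (rule inj_on_subset[OF a(1)]) auto
    obtain g where g: "g holomorphic_on \<D>" "hardy_bound p g C"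
      "\<forall>z\<in>\<D>. f z * (\<Prod>a\<in>?A. 1 - cnj a * z) = (\<Prod>a\<in>?A. z - a) * g z"
      using hardy_divide_zeros[OF f p, of ?A] a(2,3) by blast
    have "norm (g z) powr p \<le> C / (1 - norm z)"
      by (rule hardy_point_bound[OF g(1) hardy_boundD[OF g(2)] _ z1 p]) auto
    hence "(norm (g z) powr p) powr (1 / p) \<le> K"
      unfolding K_def using p by (intro powr_mono2) auto
    hence gK: "norm (g z) \<le> K" using p by (simp add: powr_powr)
    let ?P = "\<Prod>a\<in>?A. norm (1 - cnj a * z)"
    have P: "?P > 0"
    proof (intro prod_pos)
      fix b assume "b \<in> ?A"
      hence "norm b < 1" using a(2) by auto
      thus "0 < norm (1 - cnj b * z)" using one_minus_cnj_mult_nonzero[of b z] z1 by simp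
    qed
    have "norm (f z) * ?P = (\<Prod>a\<in>?A. norm (z - a)) * norm (g z)"
      using arg_cong[OF bspec[OF g(3) z], of norm] by (simp only: norm_mult prod_norm[symmetric])
    also have "\<dots> \<le> (\<Prod>b\<in>?A. norm (1 - cnj b * z) * exp (- (\<kappa> * (1 - norm b)))) * K"
    proof (intro mult_mono gK prod_mono conjI)
      fix b assume "b \<in> ?A"
      hence "norm b < 1" using a(2) by auto
      thus "norm (z - b) \<le> norm (1 - cnj b * z) * exp (- (\<kappa> * (1 - norm b)))"
        unfolding \<kappa>_def by (rule Blaschke_factor_le_exp[OF _ z1])
    qed (auto intro: prod_nonneg)
    also have "(\<Prod>b\<in>?A. norm (1 - cnj b * z) * exp (- (\<kappa> * (1 - norm b)))) = ?P * (\<Prod>b\<in>?A. exp (- (\<kappa> * (1 - norm b))))"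
      by (rule prod.distrib)
    also have "(\<Prod>b\<in>?A. exp (- (\<kappa> * (1 - norm b)))) = exp (\<Sum>b\<in>?A. - (\<kappa> * (1 - norm b)))"
      by (rule exp_sum[symmetric]) simp
    also have "(\<Sum>b\<in>?A. - (\<kappa> * (1 - norm b))) = (\<Sum>n=1..N. - (\<kappa> * (1 - norm (a n))))"
      by (rule sum.reindex_cong[OF inj]) auto
    also have "\<dots> = - (\<kappa> * (\<Sum>n=1..N. 1 - norm (a n)))"
      unfolding sum_negf sum_distrib_left ..
    finally have "?P * norm (f z) \<le> ?P * (K * exp (- (\<kappa> * (\<Sum>n=1..N. 1 - norm (a n)))))" by (simp only: mult_ac)
    thus ?thesis using P by (rule mult_left_le_imp_le)
  qed
  \<comment> \<open>Once the partial sum reaches \<open>S\<close>, the bound is at most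
    \<open>K / (1 + K / norm (f z))\<close>, which is less than \<open>norm (f z)\<close>.\<close>
  define S where "S = K / (\<kappa> * norm (f z))"
  have S: "0 \<le> S" using K \<kappa> by (simp add: S_def)
  obtain N where N: "S \<le> (\<Sum>n=1..N. 1 - norm (a n))"
    using div unfolding filterlim_at_top eventually_sequentially by blast
  have "norm (f z) \<le> K * exp (- (\<kappa> * (\<Sum>n=1..N. 1 - norm (a n))))" by (rule main)
  also have "\<dots> \<le> K * exp (- (\<kappa> * S))" using K N \<kappa> by (intro mult_left_mono) auto
  also have "exp (- (\<kappa> * S)) \<le> 1 / (1 + \<kappa> * S)"
    using \<kappa> S by (intro exp_minus_le) simp
  hence "K * exp (- (\<kappa> * S)) \<le> K * (1 / (1 + \<kappa> * S))" using K by (rule mult_left_mono)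
  also have "\<kappa> * S = K / norm (f z)" using \<kappa> by (simp add: S_def)
  also have "K * (1 / (1 + K / norm (f z))) = K * norm (f z) / (norm (f z) + K)"
    using nz K by (simp add: field_simps)
  also have "\<dots> < norm (f z)"
  proof -
    have "0 < norm (f z) + K" using nz K by (simp add: add_pos_nonneg)
    thus ?thesis using nz by (simp add: pos_divide_less_eq algebra_simps)
  qed
  finally show False by simp
qed

section \<open>Exponentials of a univalent function and their resolvents\<close>

text \<open>The derivative of \<open>exp\<close> has modulus at most \<open>1\<close> on the closed
  left half-plane, which is convex.\<close>

lemma norm_exp_minus_one_le:
  fixes x :: complex
  assumes "Re x \<le> 0" shows "norm (exp x - 1) \<le> norm x"
proof -
  have "norm (exp x - exp 0) \<le> 1 * norm (x - 0)"
  proof (rule field_differentiable_bound)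
    show "convex {x. Re x \<le> 0}" by (rule convex_halfspace_Re_le)
    show "(exp has_field_derivative exp z) (at z within {x. Re x \<le> 0})" for z :: complex
      by (rule DERIV_subset[OF DERIV_exp]) simp
  qed (use assms in auto)
  thus ?thesis by simp
qed

text \<open>\<open>conn\<close> allows poles to be moved, \<open>int_cl\<close> serves the kernel
  convergence, and \<open>unbdd\<close> puts the image of infinity under the later inversion, the
  origin, into the compact set \<open>K\<close>.\<close>

locale univalent_right_half_plane =
  fixes p :: real and F :: "complex \<Rightarrow> complex"
  assumes p: "1 \<le> p" and F: "F holomorphic_on \<D>" and inj: "inj_on F \<D>"
    and Re_F: "z \<in> \<D> \<Longrightarrow> 0 < Re (F z)"
    and int_cl: "interior (closure (F ` \<D>)) = F ` \<D>"
    and conn: "connected (- closure (F ` \<D>))"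
    and unbdd: "\<not> bounded (F ` \<D>)"
begin

definition E :: "(complex \<Rightarrow> complex) set" where
  "E = fun_span {e. \<exists>l\<ge>0. e = (\<lambda>z. exp (- (of_real l * F z)))}"

text \<open>Products of H^p functions may leave H^p, so boundedness of \<open>f\<close> is part of
  membership. No common bound for the approximants is asked.\<close>

definition M :: "(complex \<Rightarrow> complex) set" where
  "M = {f. f holomorphic_on \<D> \<and> (\<exists>B. \<forall>z\<in>\<D>. norm (f z) \<le> B) \<and>
    (\<forall>\<epsilon>>0. \<exists>g\<in>E. hardy_bound p (\<lambda>z. f z - g z) \<epsilon>)}"

lemma p0: "0 < p" using p by simp

lemma E_exp: "0 \<le> l \<Longrightarrow> (\<lambda>z. exp (- (of_real l * F z))) \<in> E"
  unfolding E_def by (rule fun_span.base) blast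

lemma E_add: "f \<in> E \<Longrightarrow> g \<in> E \<Longrightarrow> (\<lambda>z. f z + g z) \<in> E"
  unfolding E_def by (rule fun_span.add)

lemma E_scale: "f \<in> E \<Longrightarrow> (\<lambda>z. c * f z) \<in> E"
  unfolding E_def by (rule fun_span.scale)

lemma E_zero: "(\<lambda>z. 0) \<in> E"
  unfolding E_def by (rule fun_span.zero)

lemma E_induct [consumes 1, case_names zero exp add scale]:
  assumes "f \<in> E" "P (\<lambda>z. 0)" "\<And>l. 0 \<le> l \<Longrightarrow> P (\<lambda>z. exp (- (of_real l * F z)))"
    "\<And>f g. f \<in> E \<Longrightarrow> g \<in> E \<Longrightarrow> P f \<Longrightarrow> P g \<Longrightarrow> P (\<lambda>z. f z + g z)"
    "\<And>f c. f \<in> E \<Longrightarrow> P f \<Longrightarrow> P (\<lambda>z. c * f z)"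
  shows "P f"
  using assms(1) unfolding E_def
proof (induction rule: fun_span.induct)
  case (base e)
  then obtain l where "0 \<le> l" "e = (\<lambda>z. exp (- (of_real l * F z)))" by auto
  thus ?case using assms(3) by simp
qed (use assms(2,4,5) in \<open>simp_all add: E_def\<close>)

lemma norm_exp_le: "z \<in> \<D> \<Longrightarrow> 0 \<le> l \<Longrightarrow> norm (exp (- (of_real l * F z))) \<le> 1"
  using Re_F[of z] by simp

lemma E_holomorphic: "f \<in> E \<Longrightarrow> f holomorphic_on \<D>"
  by (induction rule: E_induct) (auto intro!: holomorphic_intros F)

lemma E_bounded: "f \<in> E \<Longrightarrow> \<exists>B. \<forall>z\<in>\<D>. norm (f z) \<le> B"
proof (induction rule: E_induct)
  case (exp l)
  thus ?case using norm_exp_le by (intro exI[of _ 1]) simp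
next
  case (add f g)
  then obtain A B where "\<forall>z\<in>\<D>. norm (f z) \<le> A" "\<forall>z\<in>\<D>. norm (g z) \<le> B" by auto
  thus ?case by (intro exI[of _ "A + B"]) (auto intro: norm_triangle_mono)
next
  case (scale f c)
  then obtain A where "\<forall>z\<in>\<D>. norm (f z) \<le> A" by auto
  thus ?case by (intro exI[of _ "norm c * A"]) (auto simp: norm_mult intro: mult_left_mono)
qed auto

lemma E_mult: "f \<in> E \<Longrightarrow> g \<in> E \<Longrightarrow> (\<lambda>z. f z * g z) \<in> E"
proof (induction rule: E_induct)
  case zero
  show ?case using E_zero by simp
next
  case (add f1 f2)
  have "(\<lambda>z. f1 z * g z + f2 z * g z) \<in> E" using add by (intro E_add) auto
  thus ?case by (simp add: distrib_right)
next
  case (scale f c)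
  have "(\<lambda>z. c * (f z * g z)) \<in> E" using scale by (intro E_scale) auto
  thus ?case by (simp add: mult.assoc)
next
  case (exp l)
  show ?case using exp(2)
  proof (induction rule: E_induct)
    case zero
    show ?case using E_zero by simp
  next
    case (add f1 f2)
    have "(\<lambda>z. exp (- (of_real l * F z)) * f1 z + exp (- (of_real l * F z)) * f2 z) \<in> E"
      using add by (intro E_add) auto
    thus ?case by (simp add: distrib_left)
  next
    case (scale f c)
    have "(\<lambda>z. c * (exp (- (of_real l * F z)) * f z)) \<in> E" using scale by (intro E_scale) auto
    thus ?case by (simp add: mult.left_commute)
  next
    case (exp k)
    have "(\<lambda>z. exp (- (of_real (l + k) * F z))) \<in> E" using exp \<open>0 \<le> l\<close> by (intro E_exp) simp
    thus ?case by (simp add: distrib_right flip: exp_add)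
  qed
qed

lemma M_holomorphic: "f \<in> M \<Longrightarrow> f holomorphic_on \<D>"
  by (simp add: M_def)

lemma M_bounded:
  assumes "f \<in> M" obtains B where "0 \<le> B" "\<And>z. z \<in> \<D> \<Longrightarrow> norm (f z) \<le> B"
proof -
  obtain B where B: "\<forall>z\<in>\<D>. norm (f z) \<le> B" using assms by (auto simp: M_def)
  have "norm (f 0) \<le> B" using B by simp
  hence "0 \<le> B" using norm_ge_zero[of "f 0"] by linarith
  thus thesis using B that by blast
qed

lemma M_approx:
  assumes "f \<in> M" "0 < \<epsilon>"
  obtains g where "g \<in> E" "hardy_bound p (\<lambda>z. f z - g z) \<epsilon>"
  using assms unfolding M_def by blast

text \<open>The limit is taken in H^p, where boundedness is not inherited, so the bound
  \<open>B\<close> for the limit is a hypothesis.\<close>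

lemma M_limit:
  assumes f: "f holomorphic_on \<D>" "\<And>z. z \<in> \<D> \<Longrightarrow> norm (f z) \<le> B"
    and ap: "\<And>\<epsilon>. 0 < \<epsilon> \<Longrightarrow> \<exists>g\<in>M. hardy_bound p (\<lambda>z. f z - g z) \<epsilon>"
  shows "f \<in> M"
proof -
  have "\<exists>g\<in>E. hardy_bound p (\<lambda>z. f z - g z) \<epsilon>" if e: "0 < \<epsilon>" for \<epsilon>
  proof -
    define \<delta> where "\<delta> = \<epsilon> / 2 powr p / 2"
    have \<delta>: "0 < \<delta>" "2 powr p * (\<delta> + \<delta>) = \<epsilon>" using e by (auto simp: \<delta>_def)
    obtain g where g: "g \<in> M" "hardy_bound p (\<lambda>z. f z - g z) \<delta>" using ap[OF \<delta>(1)] by auto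
    obtain k where k: "k \<in> E" "hardy_bound p (\<lambda>z. g z - k z) \<delta>" by (rule M_approx[OF g(1) \<delta>(1)])
    have "hardy_bound p (\<lambda>z. (f z - g z) + (g z - k z)) (2 powr p * (\<delta> + \<delta>))"
      by (rule hardy_bound_add[OF holomorphic_on_diff[OF f(1) M_holomorphic[OF g(1)]]
          holomorphic_on_diff[OF M_holomorphic[OF g(1)] E_holomorphic[OF k(1)]] g(2) k(2) p0])
    hence "hardy_bound p (\<lambda>z. f z - k z) \<epsilon>" using \<delta>(2) by simp
    thus ?thesis using k(1) by (rule rev_bexI[rotated])
  qed
  moreover have "\<exists>B. \<forall>z\<in>\<D>. norm (f z) \<le> B" using f(2) by (intro exI[of _ B]) simp
  ultimately show ?thesis using f(1) by (simp add: M_def)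
qed

lemma E_subset_M: "f \<in> E \<Longrightarrow> f \<in> M"
proof -
  assume f: "f \<in> E"
  have z: "hardy_bound p (\<lambda>z. f z - f z) \<epsilon>" if "0 < \<epsilon>" for \<epsilon>
    using that by (simp add: hardy_bound_def hardy_mean_def)
  have "\<exists>g\<in>E. hardy_bound p (\<lambda>z. f z - g z) \<epsilon>" if "0 < \<epsilon>" for \<epsilon>
    by (rule bexI[of "\<lambda>g. hardy_bound p (\<lambda>z. f z - g z) \<epsilon>" f E, OF z[OF that] f])
  thus "f \<in> M" using E_holomorphic[OF f] E_bounded[OF f] by (simp add: M_def)
qed

lemma M_uniform_limit:
  assumes f: "f holomorphic_on \<D>"
    and ap: "\<And>\<epsilon>. 0 < \<epsilon> \<Longrightarrow> \<exists>g\<in>M. \<forall>z\<in>\<D>. norm (f z - g z) \<le> \<epsilon>"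
  shows "f \<in> M"
proof -
  obtain g where g: "g \<in> M" "\<forall>z\<in>\<D>. norm (f z - g z) \<le> 1" using ap[of 1] by auto
  obtain B where B: "0 \<le> B" "\<And>z. z \<in> \<D> \<Longrightarrow> norm (g z) \<le> B" by (rule M_bounded[OF g(1)]) blast
  show ?thesis
  proof (rule M_limit[OF f])
    fix z assume z: "z \<in> \<D>"
    have "norm (f z) \<le> norm (f z - g z) + norm (g z)" by (metis diff_add_cancel norm_triangle_ineq)
    thus "norm (f z) \<le> 1 + B" using B(2)[OF z] bspec[OF g(2) z] by linarith
  next
    fix \<epsilon> :: real assume e: "0 < \<epsilon>"
    have "0 < (\<epsilon> / (2 * pi)) powr (1 / p)" using e by simp
    from ap[OF this] obtain g where g: "g \<in> M" "\<And>z. z \<in> \<D> \<Longrightarrow> norm (f z - g z) \<le> (\<epsilon> / (2 * pi)) powr (1 / p)"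
      by auto
    have "hardy_bound p (\<lambda>z. f z - g z) (2 * pi * ((\<epsilon> / (2 * pi)) powr (1 / p)) powr p)"
      by (rule hardy_bound_uniform[OF holomorphic_on_diff[OF f M_holomorphic[OF g(1)]] g(2) p0])
    moreover have "2 * pi * ((\<epsilon> / (2 * pi)) powr (1 / p)) powr p = \<epsilon>" using e p by (simp add: powr_powr)
    ultimately have "hardy_bound p (\<lambda>z. f z - g z) \<epsilon>" by simp
    thus "\<exists>g\<in>M. hardy_bound p (\<lambda>z. f z - g z) \<epsilon>" using g(1) by (rule bexI)
  qed
qed

text \<open>Membership depends only on the values in the disc, although the elements are functions
  on the whole plane.\<close>

lemma M_cong:
  assumes "f \<in> M" "\<And>z. z \<in> \<D> \<Longrightarrow> f z = g z" shows "g \<in> M"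
proof (rule M_uniform_limit)
  show "g holomorphic_on \<D>" by (rule holomorphic_transform[OF M_holomorphic[OF assms(1)] assms(2)])
  show "\<exists>k\<in>M. \<forall>z\<in>\<D>. norm (g z - k z) \<le> \<epsilon>" if "0 < \<epsilon>" for \<epsilon>
    using assms that by (intro bexI[of _ f]) auto
qed

lemma M_add:
  assumes f: "f \<in> M" and g: "g \<in> M" shows "(\<lambda>z. f z + g z) \<in> M"
proof -
  obtain A where A: "\<And>z. z \<in> \<D> \<Longrightarrow> norm (f z) \<le> A" using M_bounded[OF f] by metis
  obtain B where B: "\<And>z. z \<in> \<D> \<Longrightarrow> norm (g z) \<le> B" using M_bounded[OF g] by metis
  show ?thesis
  proof (rule M_limit)
    show "(\<lambda>z. f z + g z) holomorphic_on \<D>" by (intro holomorphic_intros M_holomorphic f g)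
    show "norm (f z + g z) \<le> A + B" if "z \<in> \<D>" for z by (rule norm_triangle_mono[OF A[OF that] B[OF that]])
    fix \<epsilon> :: real assume e: "0 < \<epsilon>"
    define \<delta> where "\<delta> = \<epsilon> / 2 powr p / 2"
    have \<delta>: "0 < \<delta>" "2 powr p * (\<delta> + \<delta>) = \<epsilon>" using e by (auto simp: \<delta>_def)
    obtain f' where f': "f' \<in> E" "hardy_bound p (\<lambda>z. f z - f' z) \<delta>" by (rule M_approx[OF f \<delta>(1)])
    obtain g' where g': "g' \<in> E" "hardy_bound p (\<lambda>z. g z - g' z) \<delta>" by (rule M_approx[OF g \<delta>(1)])
    have "hardy_bound p (\<lambda>z. (f z - f' z) + (g z - g' z)) (2 powr p * (\<delta> + \<delta>))"
      by (rule hardy_bound_add[OF holomorphic_on_diff[OF M_holomorphic[OF f] E_holomorphic[OF f'(1)]]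
          holomorphic_on_diff[OF M_holomorphic[OF g] E_holomorphic[OF g'(1)]] f'(2) g'(2) p0])
    hence "hardy_bound p (\<lambda>z. (f z + g z) - (f' z + g' z)) \<epsilon>" using \<delta>(2) by (simp add: algebra_simps)
    thus "\<exists>k\<in>M. hardy_bound p (\<lambda>z. (f z + g z) - k z) \<epsilon>"
      by (rule bexI[OF _ E_subset_M[OF E_add[OF f'(1) g'(1)]]])
  qed
qed

text \<open>Replacing both factors at once would call for uniform bounds on the approximants. The
  second factor is replaced first, against the fixed bounded \<open>f\<close>; the product of
  \<open>f\<close> with an element of the span is then approximated by replacing
  \<open>f\<close>.\<close>

lemma M_mult:
  assumes f: "f \<in> M" and g: "g \<in> M" shows "(\<lambda>z. f z * g z) \<in> M"
proof -
  have hol: "(\<lambda>z. f z * g z) holomorphic_on \<D>" if "f \<in> M" "g \<in> M" for f g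
    by (intro holomorphic_intros M_holomorphic that)
  obtain A where A: "0 \<le> A" "\<And>z. z \<in> \<D> \<Longrightarrow> norm (f z) \<le> A" by (rule M_bounded[OF f]) blast
  obtain B where B: "0 \<le> B" "\<And>z. z \<in> \<D> \<Longrightarrow> norm (g z) \<le> B" by (rule M_bounded[OF g]) blast
  have step: "\<exists>k\<in>E. hardy_bound p (\<lambda>z. u z * v z - u z * k z) \<epsilon>"
    if u: "u \<in> M" and v: "v \<in> M" and e: "0 < \<epsilon>" for u v \<epsilon>
  proof -
    obtain U where U: "0 \<le> U" "\<And>z. z \<in> \<D> \<Longrightarrow> norm (u z) \<le> U" by (rule M_bounded[OF u]) blast
    define \<delta> where "\<delta> = \<epsilon> / (U + 1) powr p"
    have \<delta>: "0 < \<delta>" using e U by (simp add: \<delta>_def)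
    obtain k where k: "k \<in> E" "hardy_bound p (\<lambda>z. v z - k z) \<delta>" by (rule M_approx[OF v \<delta>])
    have "norm (u z) \<le> U + 1" if "z \<in> \<D>" for z using U(2)[OF that] by simp
    from hardy_bound_mult_bounded[OF holomorphic_on_diff[OF M_holomorphic[OF v] E_holomorphic[OF k(1)]]
        M_holomorphic[OF u] this k(2) p0]
    have "hardy_bound p (\<lambda>z. u z * (v z - k z)) ((U + 1) powr p * \<delta>)" .
    moreover have "(U + 1) powr p * \<delta> = \<epsilon>" using U by (simp add: \<delta>_def)
    ultimately have "hardy_bound p (\<lambda>z. u z * v z - u z * k z) \<epsilon>" by (simp add: algebra_simps)
    thus ?thesis using k(1) by (rule bexI)
  qed
  have ME: "(\<lambda>z. u z * v z) \<in> M" if u: "u \<in> M" and v: "v \<in> E" for u v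
  proof -
    obtain U where U: "0 \<le> U" "\<And>z. z \<in> \<D> \<Longrightarrow> norm (u z) \<le> U" by (rule M_bounded[OF u]) blast
    obtain V where V: "0 \<le> V" "\<And>z. z \<in> \<D> \<Longrightarrow> norm (v z) \<le> V" by (rule M_bounded[OF E_subset_M[OF v]]) blast
    show ?thesis
    proof (rule M_limit[OF hol[OF u E_subset_M[OF v]]])
      show "norm (u z * v z) \<le> U * V" if "z \<in> \<D>" for z
        unfolding norm_mult using U(1) by (intro mult_mono U(2) V(2) that) auto
      fix \<epsilon> :: real assume e: "0 < \<epsilon>"
      obtain k where k: "k \<in> E" "hardy_bound p (\<lambda>z. v z * u z - v z * k z) \<epsilon>"
        using step[OF E_subset_M[OF v] u e] by auto
      hence "hardy_bound p (\<lambda>z. u z * v z - v z * k z) \<epsilon>" by (simp add: mult.commute)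
      thus "\<exists>k\<in>M. hardy_bound p (\<lambda>z. u z * v z - k z) \<epsilon>"
        by (rule bexI[OF _ E_subset_M[OF E_mult[OF v k(1)]]])
    qed
  qed
  show ?thesis
  proof (rule M_limit[OF hol[OF f g]])
    show "norm (f z * g z) \<le> A * B" if "z \<in> \<D>" for z
      unfolding norm_mult using A(1) by (intro mult_mono A(2) B(2) that) auto
    fix \<epsilon> :: real assume e: "0 < \<epsilon>"
    obtain k where k: "k \<in> E" "hardy_bound p (\<lambda>z. f z * g z - f z * k z) \<epsilon>"
      using step[OF f g e] by auto
    show "\<exists>k\<in>M. hardy_bound p (\<lambda>z. f z * g z - k z) \<epsilon>"
      by (rule bexI[of "\<lambda>h. hardy_bound p (\<lambda>z. f z * g z - h z) \<epsilon>" "\<lambda>z. f z * k z" M, OF k(2) ME[OF f k(1)]])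
  qed
qed

lemma M_const: "(\<lambda>z. c) \<in> M"
  using E_subset_M[OF E_scale[OF E_exp[of 0]], of c] by simp

lemma M_scale: "f \<in> M \<Longrightarrow> (\<lambda>z. c * f z) \<in> M"
  by (rule M_mult[OF M_const])

lemma M_power: "f \<in> M \<Longrightarrow> (\<lambda>z. f z ^ n) \<in> M"
proof (induction n)
  case (Suc n)
  have "(\<lambda>z. f z * f z ^ n) \<in> M" using Suc by (intro M_mult)
  thus ?case by simp
qed (simp add: M_const)

lemma M_sum: "finite I \<Longrightarrow> (\<And>i. i \<in> I \<Longrightarrow> f i \<in> M) \<Longrightarrow> (\<lambda>z. \<Sum>i\<in>I. f i z) \<in> M"
proof (induction I rule: finite_induct)
  case (insert i I)
  have "(\<lambda>z. f i z + (\<Sum>i\<in>I. f i z)) \<in> M" using insert by (intro M_add) auto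
  thus ?case using insert.hyps by simp
qed (simp add: M_const)

text \<open>The geometric series converges uniformly because the ratio is bounded by
  \<open>\<theta> < 1\<close>, and its partial sums are polynomials in \<open>f\<close>.\<close>

lemma M_geometric:
  assumes f: "f \<in> M" and \<theta>: "\<theta> < 1" "\<And>z. z \<in> \<D> \<Longrightarrow> norm (f z) \<le> \<theta>"
  shows "(\<lambda>z. 1 / (1 - f z)) \<in> M"
proof (rule M_uniform_limit)
  have \<theta>0: "0 \<le> \<theta>" using order_trans[OF norm_ge_zero \<theta>(2)[of 0]] by simp
  have ne: "f z \<noteq> 1" if "z \<in> \<D>" for z using \<theta>(2)[OF that] \<theta>(1) by auto
  show "(\<lambda>z. 1 / (1 - f z)) holomorphic_on \<D>"
    by (intro holomorphic_intros M_holomorphic f) (use ne in force)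
  fix \<epsilon> :: real assume e: "0 < \<epsilon>"
  have "(\<lambda>n. \<theta> ^ n / (1 - \<theta>)) \<longlonglongrightarrow> 0 / (1 - \<theta>)"
    using \<theta>(1) \<theta>0 by (intro tendsto_intros LIMSEQ_power_zero) auto
  hence "eventually (\<lambda>n. \<theta> ^ n / (1 - \<theta>) < \<epsilon>) sequentially" using e by (intro order_tendstoD(2)) auto
  then obtain n where n: "\<theta> ^ n / (1 - \<theta>) < \<epsilon>" by (auto simp: eventually_sequentially)
  show "\<exists>g\<in>M. \<forall>z\<in>\<D>. norm (1 / (1 - f z) - g z) \<le> \<epsilon>"
  proof (rule bexI)
    show "(\<lambda>z. \<Sum>i<n. f z ^ i) \<in> M" by (rule M_sum) (auto intro: M_power f)
    show "\<forall>z\<in>\<D>. norm (1 / (1 - f z) - (\<Sum>i<n. f z ^ i)) \<le> \<epsilon>"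
    proof
      fix z assume z: "z \<in> \<D>"
      have "1 / (1 - f z) - (\<Sum>i<n. f z ^ i) = f z ^ n / (1 - f z)"
        using ne[OF z] by (simp add: sum_gp_strict diff_divide_distrib)
      hence "norm (1 / (1 - f z) - (\<Sum>i<n. f z ^ i)) = norm (f z) ^ n / norm (1 - f z)"
        by (simp add: norm_divide norm_power)
      also have "\<dots> \<le> \<theta> ^ n / (1 - \<theta>)"
      proof (intro frac_le power_mono \<theta>(2) z)
        show "1 - \<theta> \<le> norm (1 - f z)" using norm_triangle_ineq2[of 1 "f z"] \<theta>(2)[OF z] by simp
      qed (use \<theta> \<theta>0 in auto)
      also have "\<dots> \<le> \<epsilon>" using n by simp
      finally show "norm (1 / (1 - f z) - (\<Sum>i<n. f z ^ i)) \<le> \<epsilon>" .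
    qed
  qed
qed

text \<open>The resolvent is the \<open>H\<^sup>p\<close>-limit of the Riemann sums \<open>\<delta> / (1 - exp (\<delta> (w - F)))\<close> of its
  Laplace representation.\<close>
lemma resolvent_left_half_plane:
  assumes w: "Re w < 0" shows "(\<lambda>z. 1 / (F z - w)) \<in> M"
proof -
  define c where "c = - Re w"
  have c: "0 < c" using w by (simp add: c_def)
  define q where "q z = w - F z" for z
  have q: "q holomorphic_on \<D>" unfolding q_def by (intro holomorphic_intros F)
  have Re_q: "Re (q z) \<le> - c" if "z \<in> \<D>" for z using Re_F[OF that] by (simp add: q_def c_def)
  have qnz: "q z \<noteq> 0" if "z \<in> \<D>" for z using Re_q[OF that] c by auto
  \<comment> \<open>The quotient of the resolvent by its Riemann sum. It is the mean of
    \<open>exp (s * q z)\<close> over \<open>s\<close> between \<open>0\<close> and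
    \<open>\<delta>\<close>, hence a contraction because \<open>Re (q z)\<close> is negative, and at
    \<open>z = 0\<close> it tends to \<open>1\<close> as \<open>\<delta>\<close> tends to
    \<open>0\<close>.\<close>
  define \<phi> where "\<phi> \<delta> z = (exp (of_real \<delta> * q z) - 1) / (of_real \<delta> * q z)" for \<delta> :: real and z
  have S: "(\<lambda>z. of_real \<delta> * (1 / (1 - exp (of_real \<delta> * q z)))) \<in> M" if \<delta>: "0 < \<delta>" for \<delta> :: real
  proof (rule M_scale[OF M_geometric])
    have "(\<lambda>z. exp (of_real \<delta> * w) * exp (- (of_real \<delta> * F z))) \<in> M"
      using \<delta> by (intro M_scale E_subset_M E_exp) simp
    thus "(\<lambda>z. exp (of_real \<delta> * q z)) \<in> M"
      by (simp add: q_def right_diff_distrib exp_diff exp_minus divide_inverse)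
    show "exp (- (\<delta> * c)) < 1" using \<delta> c by simp
    show "norm (exp (of_real \<delta> * q z)) \<le> exp (- (\<delta> * c))" if "z \<in> \<D>" for z
      using mult_left_mono[OF Re_q[OF that], of \<delta>] \<delta> by simp
  qed
  show ?thesis
  proof (rule M_limit)
    show "(\<lambda>z. 1 / (F z - w)) holomorphic_on \<D>"
      by (intro holomorphic_intros F) (use qnz in \<open>auto simp: q_def\<close>)
    show "norm (1 / (F z - w)) \<le> 1 / c" if z: "z \<in> \<D>" for z
    proof -
      have "c \<le> norm (F z - w)" using Re_q[OF z] abs_Re_le_cmod[of "F z - w"] by (simp add: q_def)
      thus ?thesis using c by (simp add: norm_divide frac_le)
    qed
    fix \<epsilon> :: real assume e: "0 < \<epsilon>"
    \<comment> \<open>Bounds the Riemann sums for all \<open>\<delta> \<le> 1\<close>: since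
      \<open>1 - exp (- (\<delta> * c))\<close> is at least
      \<open>\<delta> * c / (1 + \<delta> * c)\<close>, their modulus is at most
      \<open>(1 + \<delta> * c) / c\<close>.\<close>
    define B where "B = (1 + c) / c"
    have B: "0 < B" using c by (simp add: B_def)
    define \<epsilon>' where "\<epsilon>' = \<epsilon> / B powr p"
    have e': "0 < \<epsilon>'" using e B by (simp add: \<epsilon>'_def)
    obtain \<eta> where \<eta>: "0 < \<eta>" "\<And>q. q holomorphic_on \<D> \<Longrightarrow> \<forall>z\<in>\<D>. norm (q z) \<le> 1 \<Longrightarrow> 1 - Re (q 0) < \<eta> \<Longrightarrow>
        hardy_bound p (\<lambda>z. q z - 1) \<epsilon>'"
      using hardy_bound_contraction_near_one[OF p0 e'] by auto
    obtain \<delta> where \<delta>: "0 < \<delta>" "\<delta> \<le> 1" "1 - Re (\<phi> \<delta> 0) < \<eta>"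
    proof -
      have "filterlim (\<lambda>\<delta>. complex_of_real \<delta> * q 0) (at 0) (at_right 0)"
        unfolding filterlim_at
      proof
        show "eventually (\<lambda>\<delta>. complex_of_real \<delta> * q 0 \<in> UNIV \<and> complex_of_real \<delta> * q 0 \<noteq> 0) (at_right 0)"
          using qnz[of 0] by (auto simp: eventually_at_right_field intro: exI[of _ 1])
        have "((\<lambda>\<delta>. complex_of_real \<delta> * q 0) \<longlongrightarrow> complex_of_real 0 * q 0) (at_right 0)"
          by (intro tendsto_intros)
        thus "((\<lambda>\<delta>. complex_of_real \<delta> * q 0) \<longlongrightarrow> 0) (at_right 0)" by simp
      qed
      from filterlim_compose[OF lim_exp_minus_1 this]
      have "((\<lambda>\<delta>. \<phi> \<delta> 0) \<longlongrightarrow> 1) (at_right 0)" by (simp add: \<phi>_def)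
      from tendsto_diff[OF tendsto_const[of 1] tendsto_Re[OF this]]
      have "((\<lambda>\<delta>. 1 - Re (\<phi> \<delta> 0)) \<longlongrightarrow> 0) (at_right 0)" by simp
      from order_tendstoD(2)[OF this \<eta>(1)]
      obtain b where b: "0 < b" "\<And>\<delta>. 0 < \<delta> \<Longrightarrow> \<delta> < b \<Longrightarrow> 1 - Re (\<phi> \<delta> 0) < \<eta>"
        unfolding eventually_at_right_field by auto
      show thesis by (rule that[of "min 1 (b / 2)"]) (use b in auto)
    qed
    have \<phi>hol: "\<phi> \<delta> holomorphic_on \<D>"
      unfolding \<phi>_def using \<delta>(1) qnz by (intro holomorphic_intros q) auto
    have \<phi>1: "norm (\<phi> \<delta> z) \<le> 1" if z: "z \<in> \<D>" for z
    proof -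
      have "\<delta> * Re (q z) \<le> 0" using Re_q[OF z] c \<delta>(1) by (intro mult_nonneg_nonpos) auto
      hence "norm (exp (of_real \<delta> * q z) - 1) \<le> norm (of_real \<delta> * q z)" by (intro norm_exp_minus_one_le) simp
      thus ?thesis unfolding \<phi>_def norm_divide by (rule divide_le_eq_1[THEN iffD2, OF disjI1, rotated, OF conjI, rotated])
        (use \<delta>(1) qnz[OF z] in simp)
    qed
    let ?S = "\<lambda>z. of_real \<delta> * (1 / (1 - exp (of_real \<delta> * q z)))"
    have Sb: "norm (?S z) \<le> B" if z: "z \<in> \<D>" for z
    proof -
      have "norm (exp (of_real \<delta> * q z)) \<le> exp (- (\<delta> * c))"
        using mult_left_mono[OF Re_q[OF z], of \<delta>] \<delta> by simp
      also have "\<dots> \<le> 1 / (1 + \<delta> * c)"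
        using \<delta>(1) c by (intro exp_minus_le) simp
      finally have "1 - 1 / (1 + \<delta> * c) \<le> norm (1 - exp (of_real \<delta> * q z))"
        using norm_triangle_ineq2[of 1 "exp (of_real \<delta> * q z)"] by simp
      moreover have "1 - 1 / (1 + \<delta> * c) = \<delta> * c / (1 + \<delta> * c)"
      proof -
        have "1 + \<delta> * c \<noteq> 0" using mult_pos_pos[OF \<delta>(1) c] by linarith
        thus ?thesis by (simp add: divide_simps)
      qed
      ultimately have "\<delta> * c / (1 + \<delta> * c) \<le> norm (1 - exp (of_real \<delta> * q z))" by simp
      moreover have "0 < \<delta> * c / (1 + \<delta> * c)" using \<delta>(1) c by (simp add: add_pos_pos)
      ultimately have "\<delta> / norm (1 - exp (of_real \<delta> * q z)) \<le> \<delta> / (\<delta> * c / (1 + \<delta> * c))"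
        using \<delta>(1) by (intro frac_le) auto
      hence "norm (?S z) \<le> \<delta> / (\<delta> * c / (1 + \<delta> * c))"
        using \<delta>(1) by (simp only: norm_mult norm_divide norm_of_real abs_of_pos norm_one times_divide_eq_right mult_1_right)
      also have "\<dots> = (1 + \<delta> * c) / c" using \<delta>(1) c by (simp add: field_simps)
      also have "\<dots> \<le> B" unfolding B_def using \<delta> c by (intro divide_right_mono) auto
      finally show ?thesis .
    qed
    have "hardy_bound p (\<lambda>z. \<phi> \<delta> z - 1) \<epsilon>'" by (rule \<eta>(2)[OF \<phi>hol]) (use \<phi>1 \<delta>(3) in auto)
    from hardy_bound_mult_bounded[OF holomorphic_on_diff[OF \<phi>hol holomorphic_on_const] M_holomorphic[OF S[OF \<delta>(1)]] Sb this p0]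
    have b: "hardy_bound p (\<lambda>z. ?S z * (\<phi> \<delta> z - 1)) \<epsilon>" using B by (simp add: \<epsilon>'_def)
    show "\<exists>g\<in>M. hardy_bound p (\<lambda>z. 1 / (F z - w) - g z) \<epsilon>"
    proof (rule bexI[OF hardy_bound_cong[OF _ b] S[OF \<delta>(1)]])
      fix z assume z: "z \<in> \<D>"
      have "norm (exp (of_real \<delta> * q z)) < 1" using \<delta>(1) Re_q[OF z] c by (simp add: mult_pos_neg)
      hence ne: "exp (of_real \<delta> * q z) \<noteq> 1" by (metis less_irrefl norm_one)
      have q': "F z - w = - q z" by (simp add: q_def)
      have "?S z * (\<phi> \<delta> z - 1) = 1 / (F z - w) - ?S z"
        unfolding q' \<phi>_def using ne qnz[OF z] \<delta>(1) by (simp add: divide_simps)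
      thus "norm (?S z * (\<phi> \<delta> z - 1)) = norm (1 / (F z - w) - ?S z)" by simp
    qed
  qed
qed

section \<open>Moving the pole of the resolvent\<close>

text \<open>The Neumann series: \<open>1 / (F z - w')\<close> is \<open>1 / (F z - w)\<close> times
  \<open>1 / (1 - (w' - w) / (F z - w))\<close>, and the distance \<open>d / 2\<close> makes the
  ratio at most \<open>1 / 2\<close>.\<close>

lemma resolvent_step:
  assumes w: "(\<lambda>z. 1 / (F z - w)) \<in> M" and d: "0 < d" "\<And>z. z \<in> \<D> \<Longrightarrow> d \<le> norm (F z - w)"
    and w': "norm (w' - w) \<le> d / 2"
  shows "(\<lambda>z. 1 / (F z - w')) \<in> M"
proof -
  have f: "(\<lambda>z. (w' - w) * (1 / (F z - w))) \<in> M" by (rule M_scale[OF w])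
  have "norm ((w' - w) * (1 / (F z - w))) \<le> 1 / 2" if "z \<in> \<D>" for z
  proof -
    have "norm ((w' - w) * (1 / (F z - w))) = norm (w' - w) / norm (F z - w)" by (simp add: norm_mult norm_divide)
    also have "\<dots> \<le> (d / 2) / d" by (intro frac_le w' d that) (use d in auto)
    finally show ?thesis using d by simp
  qed
  hence "(\<lambda>z. 1 / (1 - (w' - w) * (1 / (F z - w)))) \<in> M" by (intro M_geometric[OF f, of "1/2"]) auto
  hence g: "(\<lambda>z. (1 / (F z - w)) * (1 / (1 - (w' - w) * (1 / (F z - w))))) \<in> M" by (rule M_mult[OF w])
  show ?thesis
  proof (rule M_cong[OF g])
    fix z assume z: "z \<in> \<D>"
    have "F z - w \<noteq> 0" using d(2)[OF z] d(1) by auto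
    moreover have "F z - w' \<noteq> 0"
    proof
      assume "F z - w' = 0"
      hence "norm (F z - w) \<le> d / 2" using w' by simp
      thus False using d(2)[OF z] d(1) by simp
    qed
    ultimately show "(1 / (F z - w)) * (1 / (1 - (w' - w) * (1 / (F z - w)))) = 1 / (F z - w')"
      by (simp add: divide_simps)
  qed
qed

lemma minus_one_notin: "- 1 \<notin> closure (F ` \<D>)"
proof
  have "closure (F ` \<D>) \<subseteq> {z. 0 \<le> Re z}"
    by (rule closure_minimal) (use Re_F in \<open>auto simp: closed_halfspace_Re_ge less_imp_le\<close>)
  moreover assume "- 1 \<in> closure (F ` \<D>)"
  ultimately show False by auto
qed

text \<open>A pole can be moved by half the radius of a disc around it that lies in the exterior, so
  the set \<open>W\<close> of good poles is open and relatively closed in the connected exterior. It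
  contains \<open>-1\<close> by the half-plane case.\<close>

lemma resolvent:
  assumes "w \<notin> closure (F ` \<D>)" shows "(\<lambda>z. 1 / (F z - w)) \<in> M"
proof -
  let ?O = "- closure (F ` \<D>)"
  define W where "W = {w \<in> ?O. (\<lambda>z. 1 / (F z - w)) \<in> M}"
  have far: "d \<le> norm (F z - w)" if "ball w d \<subseteq> ?O" "z \<in> \<D>" for w d z
  proof (rule ccontr)
    assume "\<not> d \<le> norm (F z - w)"
    hence "F z \<in> ball w d" by (simp add: dist_norm norm_minus_commute)
    hence "F z \<notin> closure (F ` \<D>)" using that(1) by auto
    moreover have "F z \<in> closure (F ` \<D>)" by (intro subsetD[OF closure_subset] imageI that(2))
    ultimately show False by simp
  qed
  have step: "w' \<in> W" if "w \<in> W" "ball w d \<subseteq> ?O" "0 < d" "norm (w' - w) \<le> d / 2" for w w' d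
  proof -
    have "w' \<in> ball w d" using that(3,4) by (simp add: dist_norm norm_minus_commute)
    hence "w' \<in> ?O" using that(2) by (rule subsetD[rotated])
    moreover have "(\<lambda>z. 1 / (F z - w)) \<in> M" using that(1) by (simp add: W_def)
    from resolvent_step[OF this that(3) far[OF that(2)] that(4)] have "(\<lambda>z. 1 / (F z - w')) \<in> M" .
    ultimately show ?thesis unfolding W_def by (intro CollectI conjI)
  qed
  have oO: "open ?O" by (simp add: open_Compl)
  have "open W"
    unfolding open_contains_ball
  proof
    fix w assume w: "w \<in> W"
    hence "w \<in> ?O" by (simp add: W_def)
    then obtain d where d: "0 < d" "ball w d \<subseteq> ?O" using oO openE by blast
    have "ball w (d / 2) \<subseteq> W"
      using step[OF w d(2,1)] by (auto simp: dist_norm norm_minus_commute less_imp_le)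
    thus "\<exists>e>0. ball w e \<subseteq> W" using d(1) by (intro exI[of _ "d / 2"]) auto
  qed
  moreover have "open (?O - W)"
    unfolding open_contains_ball
  proof
    fix w assume w: "w \<in> ?O - W"
    then obtain d where d: "0 < d" "ball w d \<subseteq> ?O" using oO openE by blast
    \<comment> \<open>A pole \<open>w'\<close> within \<open>d / 3\<close> of \<open>w\<close> has a
      free disc of radius \<open>2 * d / 3\<close>, and half of this radius reaches
      \<open>w\<close>. So a bad pole has no good ones nearby.\<close>
    have "w' \<notin> W" if w': "w' \<in> ball w (d / 3)" for w'
    proof
      assume "w' \<in> W"
      moreover have "ball w' (2 * d / 3) \<subseteq> ball w d"
      proof
        fix x assume "x \<in> ball w' (2 * d / 3)"
        thus "x \<in> ball w d" using w' dist_triangle[of w x w'] by simp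
      qed
      hence "ball w' (2 * d / 3) \<subseteq> ?O" using d(2) by blast
      moreover have "norm (w - w') \<le> 2 * d / 3 / 2" using w' by (simp add: dist_norm)
      ultimately have "w \<in> W" using step[of w' "2 * d / 3" w] d(1) by simp
      thus False using w by simp
    qed
    moreover have "ball w (d / 3) \<subseteq> ball w d" using d(1) by auto
    ultimately have "ball w (d / 3) \<subseteq> ?O - W" using d(2) by blast
    thus "\<exists>e>0. ball w e \<subseteq> ?O - W" using d(1) by (intro exI[of _ "d / 3"]) auto
  qed
  ultimately have "W \<inter> ?O = {} \<or> (?O - W) \<inter> ?O = {}"
    by (intro connectedD[OF conn]) (auto simp: W_def)
  moreover have "- 1 \<in> W \<inter> ?O"
    using resolvent_left_half_plane[of "-1"] minus_one_notin by (simp add: W_def)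
  ultimately have "?O \<subseteq> W" by blast
  thus ?thesis using assms by (auto simp: W_def)
qed

end

section \<open>Riemann maps shrinking to the closure\<close>

text \<open>Continuity is asked at \<open>x\<close> alone: the inversions to which this is applied
  have a pole elsewhere, possibly in the closure.\<close>

lemma closure_image_isCont:
  fixes f :: "complex \<Rightarrow> complex"
  assumes "x \<in> closure S" "isCont f x" shows "f x \<in> closure (f ` S)"
proof -
  obtain s where s: "\<And>n. s n \<in> S" "s \<longlonglongrightarrow> x" using assms(1) unfolding closure_sequential by auto
  have "(\<lambda>n. f (s n)) \<longlonglongrightarrow> f x" using assms(2) s(2) by (rule isCont_tendsto_compose)
  thus ?thesis unfolding closure_sequential using s(1) by (intro exI[of _ "\<lambda>n. f (s n)"]) auto
qed

text \<open>Enlarge the part of the complement far from \<open>K\<close> to a closed connected subset of \<open>- K\<close>; the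
  component of its complement that contains \<open>K\<close> has no holes.\<close>
lemma simply_connected_neighbourhood:
  fixes K :: "complex set"
  assumes K: "compact K" "connected K" "connected (- K)" "K \<noteq> {}" and \<epsilon>: "0 < \<epsilon>"
  obtains V where "open V" "simply_connected V" "bounded V" "K \<subseteq> V" "V \<subseteq> {x. infdist x K < \<epsilon>}"
proof -
  obtain R where R: "0 < R" "K \<subseteq> ball 0 R"
    using bounded_subset_ballD[OF compact_imp_bounded[OF K(1)], of 0] by auto
  have clK: "closed K" by (rule compact_imp_closed[OF K(1)])
  have opc: "open (- K)" using clK by (simp add: open_Compl)
  define Q where "Q = - ball (0::complex) R"
  have Q: "connected Q" "closed Q" "Q \<subseteq> - K"
    unfolding Q_def using R(2) by (auto intro: connected_complement_bounded_convex simp: closed_Compl)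
  define y where "y = complex_of_real R"
  have y: "y \<in> Q" using R(1) by (simp add: Q_def y_def)
  define L where "L = cball 0 R \<inter> {x. \<epsilon> \<le> infdist x K}"
  have "compact L"
    unfolding L_def by (intro compact_Int_closed closed_Collect_le continuous_intros) auto
  have LK: "L \<subseteq> - K" using \<epsilon> by (auto simp: L_def)
  have "\<forall>x\<in>L. \<exists>r>0. cball x r \<subseteq> - K" using opc LK open_contains_cball by blast
  from bchoice[OF this] obtain r where r: "\<And>x. x \<in> L \<Longrightarrow> 0 < r x \<and> cball x (r x) \<subseteq> - K" by auto
  have cov: "L \<subseteq> (\<Union>x\<in>L. ball x (r x))"
  proof
    fix x assume "x \<in> L"
    thus "x \<in> (\<Union>x\<in>L. ball x (r x))" using r by (intro UN_I[of x]) auto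
  qed
  obtain C where C: "C \<subseteq> L" "finite C" "L \<subseteq> (\<Union>x\<in>C. ball x (r x))"
    by (rule compactE_image[OF \<open>compact L\<close> _ cov]) auto
  have pc: "path_connected (- K)" using connected_open_path_connected[OF opc K(3)] .
  have "\<forall>x\<in>L. \<exists>g. path g \<and> path_image g \<subseteq> - K \<and> pathstart g = x \<and> pathfinish g = y"
    using pc LK y Q(3) unfolding path_connected_def by blast
  from bchoice[OF this] obtain g where g: "\<And>x. x \<in> L \<Longrightarrow> path (g x) \<and> path_image (g x) \<subseteq> - K \<and> pathstart (g x) = x \<and> pathfinish (g x) = y"
    by auto
  \<comment> \<open>Covers a neighbourhood of \<open>x\<close> and is tied to \<open>Q\<close> by a
    path that avoids \<open>K\<close>. All these sets share the point \<open>y\<close>, so finitely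
    many of them together with \<open>Q\<close> form a connected closed set off
    \<open>K\<close>.\<close>
  define P where "P x = cball x (r x) \<union> path_image (g x) \<union> Q" for x
  have P: "connected (P x)" "closed (P x)" "P x \<subseteq> - K" "y \<in> P x" if x: "x \<in> L" for x
  proof -
    have "x \<in> path_image (g x)" "y \<in> path_image (g x)" using g[OF x] by (metis pathstart_in_path_image, metis pathfinish_in_path_image)
    moreover have "x \<in> cball x (r x)" using r[OF x] by simp
    ultimately have ne: "cball x (r x) \<inter> path_image (g x) \<noteq> {}"
      "(cball x (r x) \<union> path_image (g x)) \<inter> Q \<noteq> {}" using y by blast+
    have "connected (path_image (g x))" using g[OF x] by (simp add: connected_path_image)
    thus "connected (P x)" unfolding P_def
      by (intro connected_Un[OF _ Q(1) ne(2)] connected_Un[OF _ _ ne(1)] connected_cball)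
    show "closed (P x)" unfolding P_def using Q(2) g[OF x] by (intro closed_Un) (auto simp: closed_path_image)
    show "P x \<subseteq> - K" using r[OF x] g[OF x] Q(3) by (auto simp: P_def)
    show "y \<in> P x" using y by (simp add: P_def)
  qed
  define T where "T = \<Union> (insert Q (P ` C))"
  have "connected T"
    unfolding T_def
  proof (rule connected_Union)
    show "connected S" if "S \<in> insert Q (P ` C)" for S using that Q(1) P(1) C(1) by auto
    have "y \<in> \<Inter> (insert Q (P ` C))" using y P(4) C(1) by auto
    thus "\<Inter> (insert Q (P ` C)) \<noteq> {}" by blast
  qed
  have "closed T" unfolding T_def using C(1,2) Q(2) P(2) by (intro closed_Union) auto
  have TK: "K \<subseteq> - T" unfolding T_def using Q(3) P(3) C(1) by fastforce
  have far: "x \<in> T" if "\<epsilon> \<le> infdist x K" for x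
  proof (cases "x \<in> ball 0 R")
    case True
    hence "x \<in> L" using that by (simp add: L_def)
    then obtain c where c: "c \<in> C" "x \<in> ball c (r c)" using C(3) by blast
    hence "x \<in> P c" by (simp add: P_def)
    thus ?thesis using c(1) by (auto simp: T_def)
  qed (simp add: T_def Q_def)
  have "- T \<noteq> {}" using TK K(4) by blast
  then obtain V where V: "V \<in> components (- T)" "K \<subseteq> V"
    using exists_component_superset[OF TK _ K(2)] by blast
  have VT: "V \<subseteq> - T" using V(1) by (rule in_components_subset)
  have "open V" by (rule open_components[OF _ V(1)]) (simp add: open_Compl \<open>closed T\<close>)
  moreover have "connected V" by (rule in_components_connected[OF V(1)])
  \<comment> \<open>A component of the complement of a connected set has connected complement; for a
    bounded connected open plane set this amounts to simple connectivity.\<close>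
  moreover have "connected (- V)" by (rule component_complement_connected[OF \<open>connected T\<close> V(1)])
  moreover have "bounded V"
  proof (rule bounded_subset[of "ball 0 R"])
    show "V \<subseteq> ball 0 R" using VT by (auto simp: T_def Q_def)
  qed simp
  moreover have "V \<subseteq> {x. infdist x K < \<epsilon>}" using VT far by force
  ultimately show thesis using that V(2) simply_connected_iff_simple by blast
qed

text \<open>The Riemann map is followed by the disc automorphism that sends the image of
  \<open>w0\<close> to \<open>0\<close>.\<close>

lemma Riemann_map_normalized:
  assumes V: "open V" "simply_connected V" "bounded V" "w0 \<in> V"
  obtains \<psi> k where "\<psi> holomorphic_on V" "k holomorphic_on \<D>"
    "\<And>v. v \<in> V \<Longrightarrow> \<psi> v \<in> \<D>" "\<And>v. v \<in> V \<Longrightarrow> k (\<psi> v) = v"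
    "\<And>\<zeta>. \<zeta> \<in> \<D> \<Longrightarrow> k \<zeta> \<in> V" "\<And>\<zeta>. \<zeta> \<in> \<D> \<Longrightarrow> \<psi> (k \<zeta>) = \<zeta>" "\<psi> w0 = 0"
proof -
  have "V \<noteq> {}" "V \<noteq> UNIV" using V(3,4) by auto
  then obtain f g where fg: "f holomorphic_on V" "g holomorphic_on \<D>"
    "\<And>z. z \<in> V \<Longrightarrow> f z \<in> \<D> \<and> g (f z) = z" "\<And>z. z \<in> \<D> \<Longrightarrow> g z \<in> V \<and> f (g z) = z"
    using simply_connected_eq_biholomorphic_to_disc[OF V(1)] V(2) by blast
  define a where "a = f w0"
  have a: "norm a < 1" using fg(3)[OF V(4)] by (simp add: a_def)
  let ?m = "Moebius_function 0 a" and ?n = "Moebius_function 0 (- a)"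
  have m: "?m z \<in> \<D>" "?n z \<in> \<D>" if "z \<in> \<D>" for z
    using Moebius_function_norm_lt_1 a that by simp_all
  have mn: "?m (?n z) = z" "?n (?m z) = z" if "z \<in> \<D>" for z
    using Moebius_function_compose a that by simp_all
  show thesis
  proof (rule that[of "\<lambda>v. ?m (f v)" "\<lambda>\<zeta>. g (?n \<zeta>)"])
    have "(?m \<circ> f) holomorphic_on V"
      by (rule holomorphic_on_compose_gen[OF fg(1) Moebius_function_holomorphic[OF a]]) (use fg(3) in auto)
    thus "(\<lambda>v. ?m (f v)) holomorphic_on V" by (simp add: o_def)
    have "(g \<circ> ?n) holomorphic_on \<D>"
      by (rule holomorphic_on_compose_gen[OF Moebius_function_holomorphic fg(2)]) (use a m in auto)
    thus "(\<lambda>\<zeta>. g (?n \<zeta>)) holomorphic_on \<D>" by (simp add: o_def)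
    show "?m (f v) \<in> \<D>" "g (?n (?m (f v))) = v" if "v \<in> V" for v
      using m mn fg(3)[OF that] by simp_all
    show "g (?n \<zeta>) \<in> V" "?m (f (g (?n \<zeta>))) = \<zeta>" if "\<zeta> \<in> \<D>" for \<zeta>
      using m[OF that] mn[OF that] fg(4) by simp_all
    show "?m (f w0) = 0" by (simp add: a_def Moebius_function_eq_zero)
  qed
qed

text \<open>Exhibits \<open>\<zeta>0\<close> as an average of simple poles in \<open>k \<zeta>0\<close>.\<close>
lemma Cauchy_inverse_formula:
  fixes k :: "complex \<Rightarrow> complex" and \<zeta>0 :: complex
  assumes k: "k holomorphic_on \<D>" "inj_on k \<D>" and r: "0 < r" "r < 1" and \<zeta>0: "norm \<zeta>0 < r"
  shows "((\<lambda>t. (rcis r t)\<^sup>2 * deriv k (rcis r t) / (k (rcis r t) - k \<zeta>0)) has_integral 2 * pi * \<zeta>0) {0..2*pi}"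
proof -
  have z0: "\<zeta>0 \<in> \<D>" using \<zeta>0 r by simp
  \<comment> \<open>The difference quotient of \<open>k\<close> at \<open>\<zeta>0\<close>, with the
    removable singularity filled in by the derivative; it has no zeros because \<open>k\<close> is
    injective. Hence \<open>H\<close> below is holomorphic and takes the value
    \<open>\<zeta>0\<close> at \<open>\<zeta>0\<close>.\<close>
  define Q where "Q \<zeta> = (if \<zeta> = \<zeta>0 then deriv k \<zeta>0 else (k \<zeta> - k \<zeta>0) / (\<zeta> - \<zeta>0))" for \<zeta> :: complex
  have Q: "Q holomorphic_on \<D>" unfolding Q_def by (rule pole_lemma_open[OF k(1)]) simp
  have Qnz: "Q \<zeta> \<noteq> 0" if "\<zeta> \<in> \<D>" for \<zeta>
    using holomorphic_injective_imp_regular[OF k(1) _ k(2) z0] inj_onD[OF k(2) _ that z0]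
    by (auto simp: Q_def)
  define H where "H \<zeta> = \<zeta> * deriv k \<zeta> / Q \<zeta>" for \<zeta>
  have H: "H holomorphic_on \<D>"
    unfolding H_def by (intro holomorphic_intros holomorphic_deriv k Q) (use Qnz in auto)
  have "((\<lambda>\<theta>. H (rcis r \<theta>) * (rcis r \<theta> / (rcis r \<theta> - \<zeta>0))) has_integral 2 * pi * H \<zeta>0) {0..2 * pi}"
    by (rule Cauchy_circle_integral[OF holomorphic_on_disc_continuous(2)[OF H r(2)] holomorphic_on_subset[OF H] \<zeta>0])
      (use r in auto)
  moreover have "H \<zeta>0 = \<zeta>0" using Qnz[OF z0] by (simp add: H_def Q_def)
  moreover have "H (rcis r \<theta>) * (rcis r \<theta> / (rcis r \<theta> - \<zeta>0)) =
      (rcis r \<theta>)\<^sup>2 * deriv k (rcis r \<theta>) / (k (rcis r \<theta>) - k \<zeta>0)" for \<theta>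
  proof -
    have n: "norm (rcis r \<theta>) = r" using r by (simp add: norm_rcis)
    hence ne: "rcis r \<theta> \<noteq> \<zeta>0" using \<zeta>0 by auto
    have "k (rcis r \<theta>) \<noteq> k \<zeta>0" using inj_onD[OF k(2) _ _ z0, of "rcis r \<theta>"] n r ne by auto
    thus ?thesis using ne by (simp add: H_def Q_def power2_eq_square)
  qed
  ultimately show ?thesis by simp
qed

lemma Riemann_sum_error:
  fixes f :: "real \<Rightarrow> complex"
  assumes f: "continuous_on {0..b} f" and h: "0 \<le> h" "real n * h = b"
    and e: "\<And>s t. s \<in> {0..b} \<Longrightarrow> t \<in> {0..b} \<Longrightarrow> \<bar>s - t\<bar> \<le> h \<Longrightarrow> norm (f s - f t) \<le> e"
  shows "norm (integral {0..b} f - (\<Sum>i<n. of_real h * f (real i * h))) \<le> b * e"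
proof -
  have "norm (integral {0..real m * h} f - (\<Sum>i<m. of_real h * f (real i * h))) \<le> real m * h * e" if "m \<le> n" for m
    using that
  proof (induction m)
    case (Suc m)
    let ?a = "real m * h" and ?c = "real (Suc m) * h"
    have ac: "0 \<le> ?a" "?a \<le> ?c" using h by (auto simp: mult_right_mono)
    have cb: "?c \<le> b" unfolding h(2)[symmetric] using Suc.prems h(1) by (intro mult_right_mono) auto
    have cf: "continuous_on {?a..?c} f" by (rule continuous_on_subset[OF f]) (use ac cb in auto)
    have cf0: "continuous_on {0..?c} f" by (rule continuous_on_subset[OF f]) (use cb in auto)
    have eq: "integral {0..?c} f = integral {0..?a} f + integral {?a..?c} f"
      by (rule Henstock_Kurzweil_Integration.integral_combine[OF ac integrable_continuous_interval[OF cf0], symmetric])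
    have "integral {?a..?c} (\<lambda>t. f t - f ?a) = integral {?a..?c} f - integral {?a..?c} (\<lambda>t. f ?a)"
      by (intro integral_diff integrable_continuous_interval cf continuous_on_const)
    also have "integral {?a..?c} (\<lambda>t. f ?a) = of_real h * f ?a"
      using h(1) by (simp add: algebra_simps scaleR_conv_of_real)
    finally have d: "integral {?a..?c} (\<lambda>t. f t - f ?a) = integral {?a..?c} f - of_real h * f ?a" .
    have "norm (integral {?a..?c} (\<lambda>t. f t - f ?a)) \<le> e * (?c - ?a)"
    proof (rule integral_bound[OF ac(2)])
      show "continuous_on {?a..?c} (\<lambda>t. f t - f ?a)" by (intro continuous_intros cf)
      fix t assume t: "t \<in> {?a..?c}"
      hence "t \<in> {0..b}" "?a \<in> {0..b}" using ac cb unfolding atLeastAtMost_iff by linarith+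
      moreover have "\<bar>t - ?a\<bar> \<le> h" using t by (simp add: algebra_simps)
      ultimately show "norm (f t - f ?a) \<le> e" by (rule e)
    qed
    hence 1: "norm (integral {?a..?c} f - of_real h * f ?a) \<le> h * e" unfolding d by (simp add: algebra_simps)
    have sp: "integral {0..?c} f - (\<Sum>i<Suc m. of_real h * f (real i * h)) =
      (integral {0..?a} f - (\<Sum>i<m. of_real h * f (real i * h))) + (integral {?a..?c} f - of_real h * f ?a)"
      unfolding eq by simp
    have "norm (integral {0..?c} f - (\<Sum>i<Suc m. of_real h * f (real i * h))) \<le> real m * h * e + h * e"
      unfolding sp by (intro norm_triangle_mono[OF Suc.IH[OF Suc_leD[OF Suc.prems]] 1])
    thus ?case by (simp add: algebra_simps)
  qed simp
  from this[of n] show ?thesis by (simp add: h(2))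
qed

context univalent_right_half_plane
begin

text \<open>The values of \<open>G\<close> stay in a compact set, on which the integrand is
  uniformly continuous jointly with \<open>t\<close>. So the Riemann sums, which lie in
  \<open>M\<close>, approximate the integral uniformly over the non-compact disc.\<close>

lemma M_integral:
  fixes J :: "real \<Rightarrow> complex \<Rightarrow> complex" and K :: "complex set"
  assumes J: "continuous_on ({0..b} \<times> K) (\<lambda>x. J (fst x) (snd x))" and K: "compact K" and b: "0 < b"
    and G: "\<And>z. z \<in> \<D> \<Longrightarrow> G z \<in> K" and JM: "\<And>t. t \<in> {0..b} \<Longrightarrow> (\<lambda>z. J t (G z)) \<in> M"
    and f: "f holomorphic_on \<D>" "\<And>z. z \<in> \<D> \<Longrightarrow> f z = integral {0..b} (\<lambda>t. J t (G z))"
  shows "f \<in> M"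
proof (rule M_uniform_limit[OF f(1)])
  fix \<epsilon> :: real assume e: "0 < \<epsilon>"
  have "uniformly_continuous_on ({0..b} \<times> K) (\<lambda>x. J (fst x) (snd x))"
    by (rule compact_uniformly_continuous[OF J]) (intro compact_Times K compact_Icc)
  moreover have "0 < \<epsilon> / b" using e b by simp
  ultimately obtain d where d: "0 < d" "\<And>x y. x \<in> {0..b} \<times> K \<Longrightarrow> y \<in> {0..b} \<times> K \<Longrightarrow> dist y x < d \<Longrightarrow>
      dist (J (fst y) (snd y)) (J (fst x) (snd x)) < \<epsilon> / b"
    unfolding uniformly_continuous_on_def by metis
  obtain n where n: "b / d < real n" using reals_Archimedean2 by blast
  have "0 < b / d" using b d by simp
  hence n0: "0 < real n" using n by linarith
  define h where "h = b / real n"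
  have h: "0 \<le> h" "real n * h = b" "h < d" using b d n n0 by (auto simp: h_def field_simps)
  show "\<exists>g\<in>M. \<forall>z\<in>\<D>. norm (f z - g z) \<le> \<epsilon>"
  proof (rule bexI)
    have "(\<lambda>z. of_real h * J (real i * h) (G z)) \<in> M" if "i < n" for i
    proof -
      have "real i * h \<le> b" unfolding h(2)[symmetric] using that h(1) by (intro mult_right_mono) auto
      thus ?thesis using h(1) by (intro M_scale JM) auto
    qed
    thus "(\<lambda>z. \<Sum>i<n. of_real h * J (real i * h) (G z)) \<in> M" by (intro M_sum) auto
    show "\<forall>z\<in>\<D>. norm (f z - (\<Sum>i<n. of_real h * J (real i * h) (G z))) \<le> \<epsilon>"
    proof
      fix z assume z: "z \<in> \<D>"
      have "continuous_on {0..b} (\<lambda>t. J (fst (t, G z)) (snd (t, G z)))"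
        by (rule continuous_on_compose2[OF J]) (use G[OF z] in \<open>auto intro!: continuous_intros\<close>)
      hence c: "continuous_on {0..b} (\<lambda>t. J t (G z))" by simp
      have "norm (integral {0..b} (\<lambda>t. J t (G z)) - (\<Sum>i<n. of_real h * J (real i * h) (G z))) \<le> b * (\<epsilon> / b)"
      proof (rule Riemann_sum_error[OF c h(1,2)])
        fix s t assume st: "s \<in> {0..b}" "t \<in> {0..b}" "\<bar>s - t\<bar> \<le> h"
        have "dist (s, G z) (t, G z) < d" using st(3) h(3) by (simp add: dist_Pair_Pair dist_real_def)
        thus "norm (J s (G z) - J t (G z)) \<le> \<epsilon> / b"
          using d(2)[of "(t, G z)" "(s, G z)"] st G[OF z] by (simp add: dist_norm)
      qed
      thus "norm (f z - (\<Sum>i<n. of_real h * J (real i * h) (G z))) \<le> \<epsilon>" using f(2)[OF z] b by simp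
    qed
  qed
qed

section \<open>Inversion of the domain to a bounded set\<close>

text \<open>The pole \<open>-1\<close> of the inversion has positive distance from the image of
  \<open>F\<close>, so the unbounded image becomes bounded: the right half-plane goes to the disc of
  radius \<open>1 / 2\<close> about \<open>1 / 2\<close>.\<close>

definition G :: "complex \<Rightarrow> complex" where "G z = 1 / (F z + 1)"

definition K :: "complex set" where "K = closure (G ` \<D>)"

lemma F_plus_one: "z \<in> \<D> \<Longrightarrow> F z + 1 \<noteq> 0"
  using Re_F[of z] by (auto simp: complex_eq_iff)

lemma G_holomorphic: "G holomorphic_on \<D>"
  unfolding G_def by (intro holomorphic_intros F) (use F_plus_one in auto)

lemma F_eq_G: "z \<in> \<D> \<Longrightarrow> F z = 1 / G z - 1"
  using F_plus_one by (simp add: G_def)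

lemma G_inj: "inj_on G \<D>"
proof (rule inj_onI)
  fix x y assume "x \<in> \<D>" "y \<in> \<D>" "G x = G y"
  moreover from this have "F x = F y" using F_eq_G by simp
  ultimately show "x = y" using inj_onD[OF inj] by blast
qed

lemma G_in_K: "z \<in> \<D> \<Longrightarrow> G z \<in> K"
  unfolding K_def by (intro subsetD[OF closure_subset] imageI)

lemma norm_G_le:
  assumes "z \<in> \<D>" shows "norm (G z) \<le> 1"
proof -
  have "1 \<le> norm (F z + 1)" using Re_F[OF assms] abs_Re_le_cmod[of "F z + 1"] by simp
  hence "1 / norm (F z + 1) \<le> 1 / 1" by (intro frac_le) auto
  thus ?thesis by (simp add: G_def norm_divide)
qed

lemma compact_K: "compact K"
  unfolding K_def compact_closure
  by (rule boundedI[of _ 1]) (use norm_G_le in auto)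

lemma connected_K: "connected K"
  unfolding K_def
  by (intro connected_imp_connected_closure connected_continuous_image holomorphic_on_imp_continuous_on G_holomorphic) simp

text \<open>The origin stands for infinity: it is a limit of values of \<open>G\<close> because
  \<open>F\<close> is unbounded.\<close>

lemma zero_in_K: "0 \<in> K"
  unfolding K_def closure_approachable
proof (intro allI impI)
  fix e :: real assume e: "0 < e"
  obtain z where z: "z \<in> \<D>" "1 / e + 1 < norm (F z)"
    using unbdd unfolding bounded_iff by (metis (no_types, lifting) imageE not_le)
  have "norm (F z) \<le> norm (F z + 1) + 1" using norm_triangle_ineq4[of "F z + 1" 1] by simp
  hence "1 / e < norm (F z + 1)" using z(2) by linarith
  hence "norm (G z) < e" using e F_plus_one[OF z(1)] by (simp add: G_def norm_divide field_simps)
  thus "\<exists>y\<in>G ` \<D>. dist y 0 < e" using z(1) by (intro bexI[of _ "G z"]) auto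
qed

lemma closure_F_iff:
  assumes "w \<noteq> - 1" shows "1 / (w + 1) \<in> K \<longleftrightarrow> w \<in> closure (F ` \<D>)"
proof
  have w: "w + 1 \<noteq> 0" using assms by (simp add: add_eq_0_iff2)
  assume "1 / (w + 1) \<in> K"
  hence "(\<lambda>v. 1 / v - 1) (1 / (w + 1)) \<in> closure ((\<lambda>v. 1 / v - 1) ` (G ` \<D>))"
    unfolding K_def by (rule closure_image_isCont) (use w in \<open>auto intro!: continuous_intros\<close>)
  moreover have "(\<lambda>v. 1 / v - 1) ` (G ` \<D>) = F ` \<D>" using F_eq_G by (force simp: image_iff)
  ultimately show "w \<in> closure (F ` \<D>)" by simp
next
  have w: "w + 1 \<noteq> 0" using assms by (simp add: add_eq_0_iff2)
  assume "w \<in> closure (F ` \<D>)"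
  hence "(\<lambda>v. 1 / (v + 1)) w \<in> closure ((\<lambda>v. 1 / (v + 1)) ` (F ` \<D>))"
    by (rule closure_image_isCont) (use w in \<open>auto intro!: continuous_intros\<close>)
  moreover have "(\<lambda>v. 1 / (v + 1)) ` (F ` \<D>) = G ` \<D>" by (simp add: image_image G_def)
  ultimately show "1 / (w + 1) \<in> K" by (simp add: K_def)
qed

lemma notin_K_iff: "v \<notin> K \<longleftrightarrow> v \<noteq> 0 \<and> 1 / v - 1 \<notin> closure (F ` \<D>)"
proof (cases "v = 0")
  case False
  thus ?thesis using closure_F_iff[of "1 / v - 1"] by simp
qed (simp add: zero_in_K)

text \<open>The inversion maps the complement of the closure of the image of \<open>F\<close>,
  without the pole \<open>-1\<close>, onto the complement of \<open>K\<close>; nothing has to be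
  added for infinity because \<open>0\<close> lies in \<open>K\<close>. Deleting a point from a
  connected open plane set keeps it connected.\<close>

lemma connected_Compl_K: "connected (- K)"
proof -
  let ?O = "- closure (F ` \<D>)"
  have "connected (?O - {- 1})"
    by (rule connected_open_delete[OF _ conn]) (auto simp: open_Compl)
  hence "connected ((\<lambda>w. 1 / (w + 1)) ` (?O - {- 1}))"
    by (rule connected_continuous_image[rotated]) (auto intro!: continuous_intros simp: add_eq_0_iff2)
  moreover have "(\<lambda>w. 1 / (w + 1)) ` (?O - {- 1}) = - K"
  proof (intro equalityI subsetI)
    fix v assume "v \<in> (\<lambda>w. 1 / (w + 1)) ` (?O - {- 1})"
    thus "v \<in> - K" using closure_F_iff by auto
  next
    fix v assume "v \<in> - K"
    hence v: "v \<noteq> 0" "1 / v - 1 \<in> ?O" using notin_K_iff by auto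
    hence "1 / v - 1 \<in> ?O - {- 1}" by simp
    moreover have "v = 1 / ((1 / v - 1) + 1)" using v(1) by simp
    ultimately show "v \<in> (\<lambda>w. 1 / (w + 1)) ` (?O - {- 1})" by (rule image_eqI[rotated])
  qed
  ultimately show ?thesis by simp
qed

text \<open>This is where \<open>int_cl\<close> enters. Off the origin the inversion carries
  interior points of \<open>K\<close> back to interior points of the closure of the image of
  \<open>F\<close>. The origin is not interior, since \<open>K\<close> lies in the closed disc of
  radius \<open>1 / 2\<close> about \<open>1 / 2\<close>.\<close>

lemma interior_K: "interior K \<subseteq> G ` \<D>"
proof
  fix v assume v: "v \<in> interior K"
  have K_half: "K \<subseteq> cball (1 / 2) (1 / 2)"
    unfolding K_def
  proof (rule closure_minimal)
    show "G ` \<D> \<subseteq> cball (1 / 2) (1 / 2)"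
    proof
      fix x assume "x \<in> G ` \<D>"
      then obtain z where z: "z \<in> \<D>" "x = G z" by auto
      have "x - 1 / 2 = 1 / 2 * ((1 - F z) / (F z + 1))" using F_plus_one[OF z(1)] by (simp add: z(2) G_def field_simps)
      moreover have "norm (1 - F z) \<le> norm (F z + 1)"
      proof (rule power2_le_imp_le)
        show "(norm (1 - F z))\<^sup>2 \<le> (norm (F z + 1))\<^sup>2"
          using Re_F[OF z(1)] unfolding cmod_power2 by (simp add: power2_eq_square algebra_simps)
      qed simp
      ultimately have "norm (x - 1 / 2) \<le> 1 / 2" using F_plus_one[OF z(1)]
        by (simp only: norm_divide norm_mult) (simp add: divide_le_eq)
      thus "x \<in> cball (1 / 2) (1 / 2)" by (simp add: dist_norm norm_minus_commute)
    qed
  qed simp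
  hence "interior K \<subseteq> ball (1 / 2) (1 / 2)" using interior_mono[OF K_half] by simp
  hence v0: "v \<noteq> 0" using v by (auto simp: dist_norm norm_divide)
  let ?w = "1 / v - 1"
  have w: "?w \<noteq> - 1" using v0 by simp
  let ?N = "(\<lambda>w. 1 / (w + 1)) -` interior K \<inter> - {- 1}"
  have oN: "open ?N"
    by (subst Int_commute) (intro continuous_open_preimage continuous_intros; auto simp: add_eq_0_iff2 open_Compl)
  have "?N \<subseteq> closure (F ` \<D>)" using closure_F_iff interior_subset by blast
  moreover have "?w \<in> ?N" using v v0 by simp
  ultimately have "?w \<in> interior (closure (F ` \<D>))" using interiorI[OF oN] by blast
  then obtain z where "z \<in> \<D>" "?w = F z" unfolding int_cl by auto
  thus "v \<in> G ` \<D>" using v0 by (intro image_eqI[of _ _ z]) (simp_all add: G_def flip: \<open>?w = F z\<close>)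
qed

text \<open>With \<open>w = 1 / v - 1\<close> one has
  \<open>1 / (v - G z) = 1 / v * (1 + 1 / v * (1 / (F z - w)))\<close>. Here \<open>v\<close> is
  nonzero because \<open>0\<close> lies in \<open>K\<close>.\<close>

lemma resolvent_G:
  assumes "v \<notin> K" shows "(\<lambda>z. 1 / (v - G z)) \<in> M"
proof -
  let ?w = "1 / v - 1"
  have v: "v \<noteq> 0" "?w \<notin> closure (F ` \<D>)" using assms notin_K_iff by auto
  have m: "(\<lambda>z. 1 / v * (1 + 1 / v * (1 / (F z - ?w)))) \<in> M"
    by (intro M_scale M_add M_const resolvent v(2))
  show ?thesis
  proof (rule M_cong[OF m])
    fix z assume z: "z \<in> \<D>"
    have "F z \<in> closure (F ` \<D>)" by (intro subsetD[OF closure_subset] imageI z)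
    hence ne: "F z \<noteq> ?w" using v(2) by metis
    hence 1: "F z * v + v - 1 \<noteq> 0" using v(1) by (auto simp: field_simps)
    have 2: "F z - ?w = (F z * v + v - 1) / v" using v(1) by (simp add: field_simps)
    have 3: "v - G z = (F z * v + v - 1) / (F z + 1)" using F_plus_one[OF z] by (simp add: G_def field_simps)
    show "1 / v * (1 + 1 / v * (1 / (F z - ?w))) = 1 / (v - G z)"
    proof -
      define d where "d = F z * v + v - 1"
      have d: "d \<noteq> 0" "d + 1 = v * (F z + 1)" using 1 by (simp_all add: d_def algebra_simps)
      have "1 + 1 / v * (1 / (d / v)) = (d + 1) / d" using d(1) v(1) by (simp add: add_divide_distrib)
      thus ?thesis unfolding 2 3 d_def[symmetric] d(2) using v(1) by simp
    qed
  qed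
qed

text \<open>\<open>Cauchy_inverse_formula\<close> at the point \<open>\<psi> (G z)\<close> writes
  this point as an integral of resolvents of \<open>G\<close> with poles on the curve
  \<open>k (rcis r t)\<close>. As \<open>\<psi>\<close> maps the compact set \<open>K\<close> into a
  smaller disc, a radius \<open>r\<close> beyond that disc keeps the poles off
  \<open>K\<close>.\<close>

lemma conformal_map_in_M:
  assumes V: "K \<subseteq> V" and \<psi>: "\<psi> holomorphic_on V" and k: "k holomorphic_on \<D>"
    and inv: "\<And>v. v \<in> V \<Longrightarrow> \<psi> v \<in> \<D>" "\<And>v. v \<in> V \<Longrightarrow> k (\<psi> v) = v" "\<And>\<zeta>. \<zeta> \<in> \<D> \<Longrightarrow> \<psi> (k \<zeta>) = \<zeta>"
  shows "(\<lambda>z. \<psi> (G z)) \<in> M"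
proof -
  have "compact ((\<lambda>v. norm (\<psi> v)) ` K)"
    by (intro compact_continuous_image continuous_intros compact_K
        holomorphic_on_imp_continuous_on holomorphic_on_subset[OF \<psi> V])
  moreover have "(\<lambda>v. norm (\<psi> v)) ` K \<noteq> {}" using zero_in_K by blast
  ultimately obtain s where "s \<in> (\<lambda>v. norm (\<psi> v)) ` K" "\<forall>t\<in>(\<lambda>v. norm (\<psi> v)) ` K. t \<le> s"
    using compact_attains_sup by blast
  then obtain v0 where s: "v0 \<in> K" "\<And>v. v \<in> K \<Longrightarrow> norm (\<psi> v) \<le> norm (\<psi> v0)" by auto
  have s1: "norm (\<psi> v0) < 1" using inv(1)[of v0] s(1) V by auto
  define r where "r = (1 + norm (\<psi> v0)) / 2"
  have r: "0 < r" "r < 1" "norm (\<psi> v0) < r" using s1 unfolding r_def by (simp_all add: add_pos_nonneg)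
  have rD: "rcis r t \<in> \<D>" for t using r by (simp add: norm_rcis)
  have injk: "inj_on k \<D>" by (rule inj_on_inverseI[of _ \<psi>]) (rule inv(3))
  have kK: "k (rcis r t) \<notin> K" for t
  proof
    assume "k (rcis r t) \<in> K"
    from s(2)[OF this] have "r \<le> norm (\<psi> v0)" using inv(3)[OF rD, of t] r(1) by (simp add: norm_rcis)
    thus False using r(3) by simp
  qed
  define c where "c t = of_real (1 / (2 * pi)) * ((rcis r t)\<^sup>2 * deriv k (rcis r t))" for t
  define J where "J t v = c t * (1 / (k (rcis r t) - v))" for t v
  have ck: "continuous_on S (\<lambda>t. k (rcis r t))" "continuous_on S (\<lambda>t. deriv k (rcis r t))" for S
    using r by (intro continuous_on_rcis_compose holomorphic_on_disc_continuous holomorphic_deriv k open_ball; simp)+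
  show ?thesis
  proof (rule M_integral[where J = J and b = "2 * pi" and K = K and G = G])
    show "continuous_on ({0..2 * pi} \<times> K) (\<lambda>x. J (fst x) (snd x))"
      unfolding J_def c_def
      by (intro continuous_intros continuous_on_compose2[OF ck(1)[of UNIV] continuous_on_fst]
          continuous_on_compose2[OF ck(2)[of UNIV] continuous_on_fst]
          continuous_on_compose2[OF continuous_on_rcis[of UNIV] continuous_on_fst])
        (use kK in auto)
    show "(\<lambda>z. J t (G z)) \<in> M" if "t \<in> {0..2*pi}" for t
      unfolding J_def by (intro M_scale resolvent_G kK)
    have "(\<psi> \<circ> G) holomorphic_on \<D>"
      by (rule holomorphic_on_compose_gen[OF G_holomorphic \<psi>]) (use G_in_K V in auto)
    thus "(\<lambda>z. \<psi> (G z)) holomorphic_on \<D>" by (simp add: o_def)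
    fix z assume z: "z \<in> \<D>"
    have GV: "G z \<in> V" using G_in_K[OF z] V by auto
    have "norm (\<psi> (G z)) < r" using s(2)[OF G_in_K[OF z]] r(3) by linarith
    from Cauchy_inverse_formula[OF k injk r(1,2) this]
    have "((\<lambda>t. of_real (1 / (2 * pi)) * ((rcis r t)\<^sup>2 * deriv k (rcis r t) / (k (rcis r t) - G z)))
        has_integral of_real (1 / (2 * pi)) * (2 * pi * \<psi> (G z))) {0..2*pi}"
      unfolding inv(2)[OF GV] by (rule has_integral_mult_right)
    hence "((\<lambda>t. J t (G z)) has_integral \<psi> (G z)) {0..2*pi}" by (simp add: J_def c_def)
    thus "\<psi> (G z) = integral {0..2*pi} (\<lambda>t. J t (G z))" by (simp add: integral_unique)
  qed (use compact_K G_in_K in auto)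
qed

text \<open>Caratheodory kernel convergence: Riemann maps of simply connected domains shrinking to \<open>K\<close>
  approximate the inverse of \<open>G\<close>.\<close>
lemma conformal_maps_near_identity:
  assumes \<eta>: "0 < \<eta>"
  obtains g where "g \<in> M" "g 0 = 0" "\<And>z. z \<in> \<D> \<Longrightarrow> g z \<in> \<D>" "1 - \<eta> < norm (deriv g 0)"
proof -
  have zero: "(0::complex) \<in> \<D>" by simp
  have G0K: "G 0 \<in> K" by (rule G_in_K[OF zero])
  have Kne: "K \<noteq> {}" using zero_in_K by blast
  define A where "A V \<psi> k n \<longleftrightarrow> open V \<and> K \<subseteq> V \<and> V \<subseteq> {x. infdist x K < 1 / real (Suc n)} \<and>
    \<psi> holomorphic_on V \<and> k holomorphic_on \<D> \<and> (\<forall>v\<in>V. \<psi> v \<in> \<D> \<and> k (\<psi> v) = v) \<and>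
    (\<forall>\<zeta>\<in>\<D>. k \<zeta> \<in> V \<and> \<psi> (k \<zeta>) = \<zeta>) \<and> \<psi> (G 0) = 0" for V :: "complex set" and \<psi> k :: "complex \<Rightarrow> complex" and n
  have "\<forall>n. \<exists>x. A (fst x) (fst (snd x)) (snd (snd x)) n"
  proof
    fix n
    obtain V where V: "open V" "simply_connected V" "bounded V" "K \<subseteq> V" "V \<subseteq> {x. infdist x K < 1 / real (Suc n)}"
      by (rule simply_connected_neighbourhood[OF compact_K connected_K connected_Compl_K Kne, of "1 / real (Suc n)"]) simp
    have "G 0 \<in> V" using V(4) G0K by blast
    then obtain \<psi> k where "\<psi> holomorphic_on V" "k holomorphic_on \<D>"
      "\<And>v. v \<in> V \<Longrightarrow> \<psi> v \<in> \<D>" "\<And>v. v \<in> V \<Longrightarrow> k (\<psi> v) = v"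
      "\<And>\<zeta>. \<zeta> \<in> \<D> \<Longrightarrow> k \<zeta> \<in> V" "\<And>\<zeta>. \<zeta> \<in> \<D> \<Longrightarrow> \<psi> (k \<zeta>) = \<zeta>" "\<psi> (G 0) = 0"
      using Riemann_map_normalized[OF V(1-3)] by metis
    hence "A V \<psi> k n" using V by (simp add: A_def)
    thus "\<exists>x. A (fst x) (fst (snd x)) (snd (snd x)) n" by (intro exI[of _ "(V, \<psi>, k)"]) simp
  qed
  from choice[OF this] obtain X where X: "\<forall>n. A (fst (X n)) (fst (snd (X n))) (snd (snd (X n))) n" by auto
  define V \<psi> k where "V n = fst (X n)" and "\<psi> n = fst (snd (X n))" and "k n = snd (snd (X n))" for n
  have "A (V n) (\<psi> n) (k n) n" for n using X by (simp add: V_def \<psi>_def k_def)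
  hence V: "open (V n)" "K \<subseteq> V n" "V n \<subseteq> {x. infdist x K < 1 / real (Suc n)}"
    and \<psi>: "\<psi> n holomorphic_on V n" and k: "k n holomorphic_on \<D>"
    and \<psi>V: "\<And>v. v \<in> V n \<Longrightarrow> \<psi> n v \<in> \<D>" "\<And>v. v \<in> V n \<Longrightarrow> k n (\<psi> n v) = v"
    and kD: "\<And>\<zeta>. \<zeta> \<in> \<D> \<Longrightarrow> k n \<zeta> \<in> V n" "\<And>\<zeta>. \<zeta> \<in> \<D> \<Longrightarrow> \<psi> n (k n \<zeta>) = \<zeta>" and \<psi>0: "\<psi> n (G 0) = 0" for n
    unfolding A_def by blast+
  define g where "g n z = \<psi> n (G z)" for n z
  have gM: "g n \<in> M" for n
    unfolding g_def by (rule conformal_map_in_M[OF V(2) \<psi> k \<psi>V kD(2)])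
  have g0: "g n 0 = 0" for n by (simp add: g_def \<psi>0)
  have GV: "G z \<in> V n" if "z \<in> \<D>" for z n using G_in_K[OF that] V(2) by blast
  have gD: "g n z \<in> \<D>" if "z \<in> \<D>" for z n using \<psi>V(1)[OF GV[OF that]] by (simp add: g_def)
  have k0: "k n 0 = G 0" for n using \<psi>V(2)[OF GV[OF zero], of n] \<psi>0 by simp
  \<comment> \<open>The chain rule for \<open>G = k n \<circ> g n\<close>. With Schwarz's lemma for
    \<open>g n\<close> it bounds the derivative of \<open>k n\<close> at \<open>0\<close> in modulus
    from below by that of \<open>G\<close>.\<close>
  have kg: "deriv G 0 = deriv (k n) 0 * deriv (g n) 0" for n
  proof -
    have "G z = (k n \<circ> g n) z" if "z \<in> \<D>" for z using \<psi>V(2)[OF GV[OF that]] by (simp add: g_def)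
    hence "deriv G 0 = deriv (k n \<circ> g n) 0"
      by (intro deriv_cong_ev eventually_nhds_in_open[of \<D>, THEN eventually_mono]) auto
    also have "\<dots> = deriv (k n) (g n 0) * deriv (g n) 0"
    proof (rule deriv_chain)
      show "g n field_differentiable at 0"
        using M_holomorphic[OF gM] holomorphic_on_imp_differentiable_at[of "g n" \<D>] by simp
      show "k n field_differentiable at (g n 0)"
        using k holomorphic_on_imp_differentiable_at[of "k n" \<D>] g0 by simp
    qed
    finally show ?thesis by (simp add: g0)
  qed
  have dG: "deriv G 0 \<noteq> 0" by (rule holomorphic_injective_imp_regular[OF G_holomorphic _ G_inj zero]) simp
  have dg: "norm (deriv (g n) 0) \<le> 1" for n
    by (rule Schwarz_Lemma(2)[OF M_holomorphic[OF gM] g0, of n 0]) (use gD in auto)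
  obtain B where B: "\<And>x. x \<in> K \<Longrightarrow> norm x \<le> B" using compact_imp_bounded[OF compact_K] by (auto simp: bounded_iff)
  have kb: "norm (k n \<zeta>) \<le> B + 1" if "\<zeta> \<in> \<D>" for n \<zeta>
  proof -
    have "infdist (k n \<zeta>) K < 1 / real (Suc n)" using kD(1)[OF that] V(3) by blast
    also have "\<dots> \<le> 1" by simp
    finally have "infdist (k n \<zeta>) K < 1" .
    moreover obtain x where x: "x \<in> K" "infdist (k n \<zeta>) K = dist (k n \<zeta>) x"
      using infdist_attains_inf[OF compact_imp_closed[OF compact_K] Kne] by auto
    ultimately have "dist (k n \<zeta>) x < 1" by simp
    moreover have "norm (k n \<zeta>) \<le> norm x + dist (k n \<zeta>) x"
      using norm_triangle_sub[of "k n \<zeta>" x] by (simp add: dist_norm)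
    ultimately show ?thesis using B[OF x(1)] by linarith
  qed
  let ?H = "{h. h holomorphic_on \<D> \<and> (\<forall>z\<in>\<D>. norm (h z) \<le> B + 1)}"
  obtain l \<rho> where l: "l holomorphic_on \<D>" "strict_mono \<rho>"
    "\<And>x. x \<in> \<D> \<Longrightarrow> (\<lambda>n. k (\<rho> n) x) \<longlonglongrightarrow> l x"
    "\<And>S. compact S \<Longrightarrow> S \<subseteq> \<D> \<Longrightarrow> uniform_limit S (k \<circ> \<rho>) l sequentially"
  proof (rule Montel[of \<D> ?H k])
    fix S :: "complex set" assume "compact S" "S \<subseteq> \<D>"
    thus "\<exists>B. \<forall>h\<in>?H. \<forall>z\<in>S. norm (h z) \<le> B" by (intro exI[of _ "B + 1"]) auto
  next
    show "range k \<subseteq> ?H" using k kb by auto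
  qed auto
  have lK: "l \<zeta> \<in> K" if \<zeta>: "\<zeta> \<in> \<D>" for \<zeta>
  proof -
    have "(\<lambda>n. infdist (k (\<rho> n) \<zeta>) K) \<longlonglongrightarrow> infdist (l \<zeta>) K"
      by (intro tendsto_infdist l(3) \<zeta>)
    moreover have "(\<lambda>n. infdist (k (\<rho> n) \<zeta>) K) \<longlonglongrightarrow> 0"
    proof (rule tendsto_sandwich[OF _ _ tendsto_const])
      show "(\<lambda>n. 1 / real (Suc (\<rho> n))) \<longlonglongrightarrow> 0"
        using LIMSEQ_subseq_LIMSEQ[OF LIMSEQ_Suc[OF lim_1_over_n[where 'a = real]] l(2)] by (simp add: o_def)
      show "eventually (\<lambda>n. infdist (k (\<rho> n) \<zeta>) K \<le> 1 / real (Suc (\<rho> n))) sequentially"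
      proof (rule always_eventually, rule allI)
        fix n
        have "k (\<rho> n) \<zeta> \<in> {x. infdist x K < 1 / real (Suc (\<rho> n))}" using kD(1)[OF \<zeta>] V(3) by blast
        thus "infdist (k (\<rho> n) \<zeta>) K \<le> 1 / real (Suc (\<rho> n))" by simp
      qed
    qed (simp add: infdist_nonneg)
    ultimately have "infdist (l \<zeta>) K = 0" by (rule LIMSEQ_unique)
    thus ?thesis using in_closed_iff_infdist_zero[OF compact_imp_closed[OF compact_K] Kne] by blast
  qed
  have dlim: "(\<lambda>n. deriv (k (\<rho> n)) 0) \<longlonglongrightarrow> deriv l 0"
  proof (rule deriv_complex_uniform_limit)
    have "uniform_limit (cball 0 (1/2)) (\<lambda>n. k (\<rho> n)) l sequentially"
      using l(4)[of "cball 0 (1/2)"] by (simp add: o_def cball_subset_ball_iff)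
    thus "uniform_limit (ball 0 (1/2)) (\<lambda>n. k (\<rho> n)) l sequentially"
      by (rule uniform_limit_on_subset) auto
    show "eventually (\<lambda>n. k (\<rho> n) holomorphic_on ball 0 (1/2)) sequentially"
      by (intro always_eventually allI holomorphic_on_subset[OF k]) auto
  qed auto
  have dk: "norm (deriv G 0) \<le> norm (deriv (k n) 0)" for n
    unfolding kg[of n] norm_mult using dg[of n] by (simp add: mult_left_le)
  have dl: "norm (deriv G 0) \<le> norm (deriv l 0)"
    by (rule LIMSEQ_le_const[OF tendsto_norm[OF dlim]]) (use dk in auto)
  have lopen: "open (l ` \<D>)"
  proof (rule open_mapping_thm[OF l(1)])
    show "\<not> l constant_on \<D>"
    proof
      assume "l constant_on \<D>"
      then obtain c where "\<And>z. z \<in> \<D> \<Longrightarrow> l z = c" by (auto simp: constant_on_def)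
      hence "deriv l 0 = deriv (\<lambda>_. c) 0"
        by (intro deriv_cong_ev eventually_nhds_in_open[of \<D>, THEN eventually_mono]) auto
      thus False using dl dG by simp
    qed
  qed auto
  \<comment> \<open>The limit takes values in \<open>K\<close>, and its range is open because it is
    not constant, its derivative at \<open>0\<close> being nonzero.\<close>
  have "l ` \<D> \<subseteq> interior K" by (rule interior_maximal[OF _ lopen]) (use lK in auto)
  hence lG: "l ` \<D> \<subseteq> G ` \<D>" using interior_K by blast
  obtain G' where G': "G' holomorphic_on (G ` \<D>)" "\<And>z. z \<in> \<D> \<Longrightarrow> deriv G z * deriv G' (G z) = 1"
    "\<And>z. z \<in> \<D> \<Longrightarrow> G' (G z) = z" by (rule holomorphic_has_inverse[OF G_holomorphic open_ball G_inj]) blast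
  have l0: "l 0 = G 0" using LIMSEQ_unique[OF l(3)[OF zero]] by (simp add: k0)
  \<comment> \<open>Schwarz's lemma for \<open>G' \<circ> l\<close>, where \<open>G'\<close> is the
    inverse of \<open>G\<close>, gives the opposite inequality. So the derivatives of
    \<open>k (\<rho> n)\<close> at \<open>0\<close> tend in modulus to that of \<open>G\<close>, and
    those of \<open>g (\<rho> n)\<close> to \<open>1\<close>.\<close>
  have "norm (deriv (G' \<circ> l) 0) \<le> 1"
  proof (rule Schwarz_Lemma(2)[of _ 0])
    show "(G' \<circ> l) holomorphic_on \<D>" by (rule holomorphic_on_compose_gen[OF l(1) G'(1) lG])
    show "(G' \<circ> l) 0 = 0" using G'(3)[OF zero] l0 by simp
    fix z :: complex assume "norm z < 1"
    hence "l z \<in> G ` \<D>" using lG by auto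
    thus "norm ((G' \<circ> l) z) < 1" using G'(3) by auto
  qed simp
  moreover have "deriv (G' \<circ> l) 0 = deriv G' (l 0) * deriv l 0"
  proof (rule deriv_chain)
    show "l field_differentiable at 0"
      using l(1) holomorphic_on_imp_differentiable_at[of l \<D>] by simp
    have "open (G ` \<D>)" by (rule open_mapping_thm3[OF G_holomorphic open_ball G_inj])
    thus "G' field_differentiable at (l 0)"
      using holomorphic_on_imp_differentiable_at[OF G'(1)] l0 by simp
  qed
  moreover have "deriv G' (l 0) = 1 / deriv G 0" using G'(2)[OF zero] dG l0 by (simp add: field_simps)
  ultimately have "norm (deriv l 0) \<le> norm (deriv G 0)" using dG by (simp add: norm_divide divide_le_eq)
  hence eq: "norm (deriv l 0) = norm (deriv G 0)" using dl by simp
  have gq: "norm (deriv (g n) 0) = norm (deriv G 0) / norm (deriv (k n) 0)" for n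
  proof -
    have "deriv (k n) 0 \<noteq> 0" using dk[of n] dG by auto
    thus ?thesis unfolding kg[of n] by (simp add: norm_mult)
  qed
  have "(\<lambda>n. norm (deriv G 0) / norm (deriv (k (\<rho> n)) 0)) \<longlonglongrightarrow> norm (deriv G 0) / norm (deriv l 0)"
    by (intro tendsto_intros dlim) (use eq dG in simp)
  hence "(\<lambda>n. norm (deriv (g (\<rho> n)) 0)) \<longlonglongrightarrow> 1" using eq dG by (simp add: gq)
  hence "eventually (\<lambda>n. 1 - \<eta> < norm (deriv (g (\<rho> n)) 0)) sequentially" using \<eta> by (intro order_tendstoD(1)) auto
  from eventually_happens[OF this] obtain n where "1 - \<eta> < norm (deriv (g (\<rho> n)) 0)" by auto
  thus thesis using that[of "g (\<rho> n)"] gM g0 gD by blast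
qed

lemma identity_in_M: "(\<lambda>z. z) \<in> M"
proof (rule M_limit[where B = 1])
  fix \<epsilon> :: real assume e: "0 < \<epsilon>"
  obtain \<eta> where \<eta>: "0 < \<eta>" "\<And>q. q holomorphic_on \<D> \<Longrightarrow> \<forall>z\<in>\<D>. norm (q z) \<le> 1 \<Longrightarrow> 1 - Re (q 0) < \<eta> \<Longrightarrow>
      hardy_bound p (\<lambda>z. q z - 1) \<epsilon>"
    using hardy_bound_contraction_near_one[OF p0 e] by auto
  \<comment> \<open>The minimum with \<open>1\<close> also guarantees that \<open>q 0\<close> is
    nonzero.\<close>
  have "0 < min \<eta> 1" using \<eta>(1) by simp
  then obtain g where g: "g \<in> M" "g 0 = 0" "\<And>z. z \<in> \<D> \<Longrightarrow> g z \<in> \<D>" "1 - min \<eta> 1 < norm (deriv g 0)"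
    using conformal_maps_near_identity[of "min \<eta> 1"] by metis
  obtain q where q: "q holomorphic_on \<D>" "\<And>z. norm z < 1 \<Longrightarrow> g z = z * q z" "deriv g 0 = q 0"
    by (rule Schwarz3[OF M_holomorphic[OF g(1)] g(2)]) blast
  have g1: "norm (g z) < 1" if "norm z < 1" for z using g(3)[of z] that by simp
  have q1: "norm (q z) \<le> 1" if z: "z \<in> \<D>" for z
  proof (cases "z = 0")
    case True
    thus ?thesis using Schwarz_Lemma(2)[OF M_holomorphic[OF g(1)] g(2) g1, of 0] q(3) by simp
  next
    case False
    have "norm (g z) \<le> norm z" by (rule Schwarz_Lemma(1)[OF M_holomorphic[OF g(1)] g(2) g1]) (use z in auto)
    thus ?thesis using q(2)[of z] z False by (simp add: norm_mult)
  qed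
  have q0: "q 0 \<noteq> 0" "1 - \<eta> < norm (q 0)" using g(4) q(3) by auto
  \<comment> \<open>The rotation that makes \<open>\<alpha> * q 0\<close> positive, as the
    contraction criterion looks at the real part.\<close>
  define \<alpha> where "\<alpha> = cnj (q 0) / of_real (norm (q 0))"
  have \<alpha>: "norm \<alpha> = 1" using q0 by (simp add: \<alpha>_def norm_divide)
  have "\<alpha> * q 0 = (q 0 * cnj (q 0)) / of_real (norm (q 0))" by (simp add: \<alpha>_def)
  also have "\<dots> = of_real (norm (q 0))" using q0 by (simp flip: complex_norm_square add: power2_eq_square)
  finally have "Re (\<alpha> * q 0) = norm (q 0)" by simp
  hence b: "hardy_bound p (\<lambda>z. \<alpha> * q z - 1) \<epsilon>"
    using q0(2) q1 \<alpha> by (intro \<eta>(2) holomorphic_intros q) (auto simp: norm_mult)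
  have "hardy_bound p (\<lambda>z. z * (\<alpha> * q z - 1)) (1 powr p * \<epsilon>)"
    by (rule hardy_bound_mult_bounded[OF _ _ _ b p0]) (auto intro!: holomorphic_intros q)
  hence b': "hardy_bound p (\<lambda>z. z * (\<alpha> * q z - 1)) \<epsilon>" by simp
  have "hardy_bound p (\<lambda>z. z - \<alpha> * g z) \<epsilon>"
  proof (rule hardy_bound_cong[OF _ b'])
    fix z :: complex assume "z \<in> \<D>"
    hence "z * (\<alpha> * q z - 1) = - (z - \<alpha> * g z)" using q(2)[of z] by (simp add: algebra_simps)
    thus "norm (z * (\<alpha> * q z - 1)) = norm (z - \<alpha> * g z)" by (simp only: norm_minus_cancel)
  qed
  thus "\<exists>k\<in>M. hardy_bound p (\<lambda>z. z - k z) \<epsilon>"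
    by (rule bexI[of "\<lambda>h. hardy_bound p (\<lambda>z. z - h z) \<epsilon>" "\<lambda>z. \<alpha> * g z" M, OF _ M_scale[OF g(1)]])
qed (auto intro: holomorphic_intros)

theorem exponentials_total:
  assumes f: "f holomorphic_on \<D>" "hardy_bound p f C" and e: "0 < \<epsilon>"
  shows "\<exists>g\<in>E. hardy_bound p (\<lambda>z. f z - g z) \<epsilon>"
proof -
  define \<delta> where "\<delta> = \<epsilon> / 2 powr p / 2"
  have \<delta>: "0 < \<delta>" "2 powr p * (\<delta> + \<delta>) = \<epsilon>" using e by (auto simp: \<delta>_def)
  obtain n a where n: "hardy_bound p (\<lambda>z. f z - (\<Sum>i<n. a i * z ^ i)) \<delta>"
    using polynomials_dense_hardy[OF f p \<delta>(1)] by blast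
  have PM: "(\<lambda>z. \<Sum>i<n. a i * z ^ i) \<in> M"
    by (intro M_sum M_scale M_power identity_in_M finite_lessThan)
  obtain g where g: "g \<in> E" "hardy_bound p (\<lambda>z. (\<Sum>i<n. a i * z ^ i) - g z) \<delta>"
    by (rule M_approx[OF PM \<delta>(1)])
  have "hardy_bound p (\<lambda>z. (f z - (\<Sum>i<n. a i * z ^ i)) + ((\<Sum>i<n. a i * z ^ i) - g z)) (2 powr p * (\<delta> + \<delta>))"
    by (rule hardy_bound_add[OF holomorphic_on_diff[OF f(1) M_holomorphic[OF PM]]
        holomorphic_on_diff[OF M_holomorphic[OF PM] E_holomorphic[OF g(1)]] n g(2) p0])
  hence "hardy_bound p (\<lambda>z. f z - g z) \<epsilon>" using \<delta>(2) by simp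
  thus ?thesis by (rule bexI[of "\<lambda>g. hardy_bound p (\<lambda>z. f z - g z) \<epsilon>" g E, OF _ g(1)])
qed

end

section \<open>Operator algebras generated by one operator\<close>

context banach_function_space
begin

lemma restrict_bounded_operator:
  assumes "\<And>f. f \<in> X \<Longrightarrow> S f \<in> X"
    and "\<And>f g. f \<in> X \<Longrightarrow> g \<in> X \<Longrightarrow> S (\<lambda>z. f z + g z) = (\<lambda>z. S f z + S g z)"
    and "\<And>c f. f \<in> X \<Longrightarrow> S (\<lambda>z. c * f z) = (\<lambda>z. c * S f z)"
    and "\<And>f. f \<in> X \<Longrightarrow> N (S f) \<le> M * N f"
  shows "(\<lambda>f\<in>X. S f) \<in> bounded_operators X N"
  unfolding bounded_operators_def
proof (intro CollectI conjI ballI allI)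
  show "restrict S X \<in> X \<rightarrow>\<^sub>E X" using assms(1) by (simp add: restrict_PiE_iff)
  show "\<exists>M. \<forall>f\<in>X. N (restrict S X f) \<le> M * N f" using assms(4) by (intro exI[of _ M]) simp
  fix f assume f: "f \<in> X"
  show "restrict S X (\<lambda>z. c * f z) = (\<lambda>z. c * restrict S X f z)" for c
    using assms(3)[OF f] scale_mem[OF f] f by simp
  fix g assume g: "g \<in> X"
  show "restrict S X (\<lambda>z. f z + g z) = (\<lambda>z. restrict S X f z + restrict S X g z)"
    using assms(2)[OF f g] add_mem[OF f g] f g by simp
qed

lemma bounded_operators_bound:
  assumes "A \<in> bounded_operators X N"
  obtains M where "0 \<le> M" "\<And>f. f \<in> X \<Longrightarrow> N (A f) \<le> M * N f"
proof -
  have "\<exists>M. \<forall>f\<in>X. N (A f) \<le> M * N f" using assms by (simp add: bounded_operators_def)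
  then obtain M where M: "\<forall>f\<in>X. N (A f) \<le> M * N f" ..
  have "N (A f) \<le> \<bar>M\<bar> * N f" if "f \<in> X" for f
    using bspec[OF M that] mult_right_mono[OF abs_ge_self[of M] N_nonneg[of f]] by linarith
  thus thesis by (intro that[of "\<bar>M\<bar>"]) auto
qed

lemma bounded_operators_add:
  assumes A: "A \<in> bounded_operators X N" and B: "B \<in> bounded_operators X N"
  shows "(\<lambda>f\<in>X. \<lambda>z. A f z + B f z) \<in> bounded_operators X N"
proof -
  obtain K where K: "0 \<le> K" "\<And>f. f \<in> X \<Longrightarrow> N (A f) \<le> K * N f" by (rule bounded_operators_bound[OF A]) blast
  obtain L where L: "0 \<le> L" "\<And>f. f \<in> X \<Longrightarrow> N (B f) \<le> L * N f" by (rule bounded_operators_bound[OF B]) blast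
  show ?thesis
  proof (rule restrict_bounded_operator[where M = "K + L"])
    fix f assume f: "f \<in> X"
    show "(\<lambda>z. A f z + B f z) \<in> X" by (intro add_mem bounded_operatorsD(1)[OF A f] bounded_operatorsD(1)[OF B f])
    show "(\<lambda>z. A (\<lambda>z. c * f z) z + B (\<lambda>z. c * f z) z) = (\<lambda>z. c * (A f z + B f z))" for c
      by (simp add: bounded_operatorsD(3)[OF A f] bounded_operatorsD(3)[OF B f] distrib_left)
    show "N (\<lambda>z. A f z + B f z) \<le> (K + L) * N f"
      using N_triangle[OF bounded_operatorsD(1)[OF A f] bounded_operatorsD(1)[OF B f]] K(2)[OF f] L(2)[OF f]
      by (simp add: distrib_right)
    fix g assume g: "g \<in> X"
    show "(\<lambda>z. A (\<lambda>z. f z + g z) z + B (\<lambda>z. f z + g z) z) = (\<lambda>z. A f z + B f z + (A g z + B g z))"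
      by (simp add: bounded_operatorsD(2)[OF A f g] bounded_operatorsD(2)[OF B f g] add_ac)
  qed
qed

lemma bounded_operators_scale:
  assumes A: "A \<in> bounded_operators X N"
  shows "(\<lambda>f\<in>X. \<lambda>z. c * A f z) \<in> bounded_operators X N"
proof -
  obtain K where K: "0 \<le> K" "\<And>f. f \<in> X \<Longrightarrow> N (A f) \<le> K * N f" by (rule bounded_operators_bound[OF A]) blast
  show ?thesis
  proof (rule restrict_bounded_operator[where M = "norm c * K"])
    fix f assume f: "f \<in> X"
    show "(\<lambda>z. c * A f z) \<in> X" by (intro scale_mem bounded_operatorsD(1)[OF A f])
    show "(\<lambda>z. c * A (\<lambda>z. d * f z) z) = (\<lambda>z. d * (c * A f z))" for d
      by (simp add: bounded_operatorsD(3)[OF A f] mult_ac)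
    show "N (\<lambda>z. c * A f z) \<le> norm c * K * N f"
      using mult_left_mono[OF K(2)[OF f], of "norm c"] N_scale[OF bounded_operatorsD(1)[OF A f], of c]
      by (simp add: mult_ac)
    fix g assume g: "g \<in> X"
    show "(\<lambda>z. c * A (\<lambda>z. f z + g z) z) = (\<lambda>z. c * A f z + c * A g z)"
      by (simp add: bounded_operatorsD(2)[OF A f g] distrib_left)
  qed
qed

lemma bounded_operators_compose:
  assumes A: "A \<in> bounded_operators X N" and B: "B \<in> bounded_operators X N"
  shows "compose X A B \<in> bounded_operators X N"
proof -
  obtain K where K: "0 \<le> K" "\<And>f. f \<in> X \<Longrightarrow> N (A f) \<le> K * N f" by (rule bounded_operators_bound[OF A]) blast
  obtain L where L: "0 \<le> L" "\<And>f. f \<in> X \<Longrightarrow> N (B f) \<le> L * N f" by (rule bounded_operators_bound[OF B]) blast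
  show ?thesis
    unfolding compose_def
  proof (rule restrict_bounded_operator[where M = "K * L"])
    fix f assume f: "f \<in> X"
    note Bf = bounded_operatorsD(1)[OF B f]
    show "A (B f) \<in> X" by (rule bounded_operatorsD(1)[OF A Bf])
    show "A (B (\<lambda>z. c * f z)) = (\<lambda>z. c * A (B f) z)" for c
      by (simp only: bounded_operatorsD(3)[OF B f] bounded_operatorsD(3)[OF A Bf])
    show "N (A (B f)) \<le> K * L * N f"
      using K(2)[OF Bf] mult_left_mono[OF L(2)[OF f] K(1)] by (simp add: mult.assoc)
    fix g assume g: "g \<in> X"
    show "A (B (\<lambda>z. f z + g z)) = (\<lambda>z. A (B f) z + A (B g) z)"
      by (simp only: bounded_operatorsD(2)[OF B f g] bounded_operatorsD(2)[OF A Bf bounded_operatorsD(1)[OF B g]])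
  qed
qed

lemma bounded_operators_id: "(\<lambda>f\<in>X. f) \<in> bounded_operators X N"
  by (rule restrict_bounded_operator[where M = 1]) auto

lemma bounded_operators_eqI:
  assumes "A \<in> bounded_operators X N" "B \<in> bounded_operators X N" "\<And>f. f \<in> X \<Longrightarrow> A f = B f"
  shows "A = B"
  by (rule PiE_ext[of A X "\<lambda>_. X" B]) (use assms in \<open>auto simp: bounded_operators_def\<close>)

lemma sum_mem:
  assumes "finite I" "\<And>i. i \<in> I \<Longrightarrow> u i \<in> X" shows "(\<lambda>z. \<Sum>i\<in>I. u i z) \<in> X"
  using assms
proof (induction I rule: finite_induct)
  case (insert i I)
  have "(\<lambda>z. u i z + (\<Sum>i\<in>I. u i z)) \<in> X" using insert by (intro add_mem) auto
  thus ?case using insert.hyps by simp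
qed (simp add: zero_mem)

lemma bounded_operators_sum:
  assumes T: "T \<in> bounded_operators X N" and "finite I" "\<And>i. i \<in> I \<Longrightarrow> u i \<in> X"
  shows "T (\<lambda>z. \<Sum>i\<in>I. u i z) = (\<lambda>z. \<Sum>i\<in>I. T (u i) z)"
  using assms(2,3)
proof (induction I rule: finite_induct)
  case (insert i I)
  have "T (\<lambda>z. u i z + (\<Sum>i\<in>I. u i z)) = (\<lambda>z. T (u i) z + T (\<lambda>z. \<Sum>i\<in>I. u i z) z)"
    using insert.prems insert.hyps by (intro bounded_operatorsD(2)[OF T] sum_mem) auto
  also have "T (\<lambda>z. \<Sum>i\<in>I. u i z) = (\<lambda>z. \<Sum>i\<in>I. T (u i) z)" using insert by auto
  finally show ?case using insert.hyps by simp
qed (simp add: bounded_operatorsD(5)[OF T])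

lemma funpow_mem:
  assumes "T \<in> bounded_operators X N" "f \<in> X" shows "(T ^^ i) f \<in> X"
  by (induction i) (use assms bounded_operatorsD(1)[OF assms(1)] in auto)

text \<open>Any upper bound may replace the degree, so polynomials of different degrees can be
  compared over one range of summation.\<close>

lemma poly_operator_apply:
  assumes "f \<in> X" "degree q \<le> n"
  shows "poly_operator X q T f = (\<lambda>z. \<Sum>i\<le>n. coeff q i * (T ^^ i) f z)"
proof
  fix z
  have "(\<Sum>i\<le>degree q. coeff q i * (T ^^ i) f z) = (\<Sum>i\<le>n. coeff q i * (T ^^ i) f z)"
    by (rule sum.mono_neutral_left) (use assms(2) in \<open>auto simp: coeff_eq_0\<close>)
  thus "poly_operator X q T f z = (\<Sum>i\<le>n. coeff q i * (T ^^ i) f z)"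
    using assms(1) by (simp add: poly_operator_def)
qed

lemma poly_operator_add:
  "poly_operator X (q + r) T = (\<lambda>f\<in>X. \<lambda>z. poly_operator X q T f z + poly_operator X r T f z)"
proof
  fix f
  show "poly_operator X (q + r) T f = (\<lambda>f\<in>X. \<lambda>z. poly_operator X q T f z + poly_operator X r T f z) f"
  proof (cases "f \<in> X")
    case True
    let ?n = "max (degree q) (degree r)"
    show ?thesis
      using True poly_operator_apply[OF True, of q ?n T] poly_operator_apply[OF True, of r ?n T]
        poly_operator_apply[OF True degree_add_le_max, of q r T]
      by (simp add: distrib_right sum.distrib)
  qed (simp add: poly_operator_def)
qed

lemma poly_operator_smult:
  "poly_operator X (smult c q) T = (\<lambda>f\<in>X. \<lambda>z. c * poly_operator X q T f z)"
proof
  fix f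
  show "poly_operator X (smult c q) T f = (\<lambda>f\<in>X. \<lambda>z. c * poly_operator X q T f z) f"
  proof (cases "f \<in> X")
    case True
    show ?thesis
      using True poly_operator_apply[OF True, of q "degree q" T]
        poly_operator_apply[OF True degree_smult_le, of c q T]
      by (simp add: sum_distrib_left mult.assoc)
  qed (simp add: poly_operator_def)
qed

text \<open>Horner's rule, which opens statements about \<open>poly_operator\<close> to induction on
  the polynomial.\<close>

lemma poly_operator_pCons:
  assumes T: "T \<in> bounded_operators X N" and f: "f \<in> X"
  shows "poly_operator X (pCons a q) T f = (\<lambda>z. a * f z + T (poly_operator X q T f) z)"
proof -
  let ?n = "degree q"
  have "poly_operator X (pCons a q) T f = (\<lambda>z. \<Sum>i\<le>Suc ?n. coeff (pCons a q) i * (T ^^ i) f z)"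
    by (rule poly_operator_apply[OF f degree_pCons_le])
  also have "\<dots> = (\<lambda>z. a * f z + (\<Sum>i\<le>?n. coeff q i * T ((T ^^ i) f) z))"
    by (simp only: sum.atMost_Suc_shift) simp
  also have "(\<lambda>z. \<Sum>i\<le>?n. coeff q i * T ((T ^^ i) f) z) = T (\<lambda>z. \<Sum>i\<le>?n. coeff q i * (T ^^ i) f z)"
    by (subst bounded_operators_sum[OF T])
      (simp_all add: scale_mem funpow_mem[OF T f] bounded_operatorsD(3)[OF T funpow_mem[OF T f]])
  hence "(\<lambda>z. a * f z + (\<Sum>i\<le>?n. coeff q i * T ((T ^^ i) f) z)) =
      (\<lambda>z. a * f z + T (poly_operator X q T f) z)"
    unfolding poly_operator_apply[OF f order_refl] by (simp add: fun_eq_iff)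
  finally show ?thesis .
qed

lemma poly_operator_bounded:
  assumes T: "T \<in> bounded_operators X N"
  shows "poly_operator X q T \<in> bounded_operators X N"
proof (induction q rule: pCons_induct)
  case 0
  have "(\<lambda>f\<in>X. \<lambda>z. 0 * (\<lambda>f\<in>X. f) f z) \<in> bounded_operators X N"
    by (rule bounded_operators_scale[OF bounded_operators_id])
  moreover have "poly_operator X 0 T = (\<lambda>f\<in>X. \<lambda>z. 0 * (\<lambda>f\<in>X. f) f z)" by (simp add: poly_operator_def)
  ultimately show ?case by (simp only:)
next
  case (pCons a q)
  have "(\<lambda>f\<in>X. \<lambda>z. (\<lambda>f\<in>X. \<lambda>z. a * (\<lambda>f\<in>X. f) f z) f z + compose X T (poly_operator X q T) f z) \<in> bounded_operators X N"
    by (intro bounded_operators_add bounded_operators_scale bounded_operators_id bounded_operators_compose T pCons.IH)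
  moreover have "poly_operator X (pCons a q) T =
      (\<lambda>f\<in>X. \<lambda>z. (\<lambda>f\<in>X. \<lambda>z. a * (\<lambda>f\<in>X. f) f z) f z + compose X T (poly_operator X q T) f z)" (is "?L = ?R")
  proof
    fix f show "?L f = ?R f"
      by (cases "f \<in> X") (simp_all add: poly_operator_pCons[OF T] compose_eq, simp add: poly_operator_def)
  qed
  ultimately show ?case by (simp only:)
qed

lemma operator_algebra_generated:
  assumes T: "T \<in> bounded_operators X N"
  shows "operator_algebra X N (generated_algebra X T)"
  unfolding operator_algebra_def
proof (intro conjI ballI allI)
  let ?A = "generated_algebra X T"
  show "?A \<noteq> {}" by (simp add: generated_algebra_def)
  show bo: "?A \<subseteq> bounded_operators X N"
    unfolding generated_algebra_def using poly_operator_bounded[OF T] by (intro image_subsetI)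
  show add: "(\<lambda>f\<in>X. \<lambda>z. A f z + B f z) \<in> ?A" if A: "A \<in> ?A" and B: "B \<in> ?A" for A B
  proof -
    obtain q where "A = poly_operator X q T" by (rule rangeE[OF A[unfolded generated_algebra_def]])
    moreover obtain r where "B = poly_operator X r T" by (rule rangeE[OF B[unfolded generated_algebra_def]])
    ultimately show ?thesis using poly_operator_add[of q r T] by (simp only: generated_algebra_def) (metis rangeI)
  qed
  show scale: "(\<lambda>f\<in>X. \<lambda>z. c * A f z) \<in> ?A" if A: "A \<in> ?A" for c A
  proof -
    obtain q where "A = poly_operator X q T" by (rule rangeE[OF A[unfolded generated_algebra_def]])
    thus ?thesis using poly_operator_smult[of c q T] by (simp only: generated_algebra_def) (metis rangeI)
  qed
  \<comment> \<open>Left composition with \<open>T\<close> prepends a zero coefficient. By Horner's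
    rule closure under products then follows by induction on the left factor, without expanding a
    product of polynomials.\<close>
  have T_comp: "compose X T A \<in> ?A" if A: "A \<in> ?A" for A
  proof -
    obtain q where q: "A = poly_operator X q T" by (rule rangeE[OF A[unfolded generated_algebra_def]])
    have "compose X T A = poly_operator X (pCons 0 q) T"
      using bo A poly_operator_pCons[OF T] q
      by (intro bounded_operators_eqI bounded_operators_compose T poly_operator_bounded)
        (auto simp: compose_eq)
    thus ?thesis by (simp add: generated_algebra_def)
  qed
  show "compose X A B \<in> ?A" if A: "A \<in> ?A" and B: "B \<in> ?A" for A B
  proof -
    obtain q where q: "A = poly_operator X q T" by (rule rangeE[OF A[unfolded generated_algebra_def]])
    have BX: "B f \<in> X" if "f \<in> X" for f using bounded_operatorsD(1) B bo that by blast
    have "compose X (poly_operator X q T) B \<in> ?A"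
    proof (induction q rule: pCons_induct)
      case 0
      have "compose X (poly_operator X 0 T) B = (\<lambda>f\<in>X. \<lambda>z. 0 * B f z)"
        by (rule ext) (simp add: compose_def poly_operator_def BX)
      thus ?case using scale[OF B, of 0] by (simp only:)
    next
      case (pCons a q)
      let ?R = "\<lambda>f\<in>X. \<lambda>z. (\<lambda>f\<in>X. \<lambda>z. a * B f z) f z + compose X T (compose X (poly_operator X q T) B) f z"
      have "?R \<in> ?A" by (intro add scale B T_comp pCons.IH)
      moreover have "compose X (poly_operator X (pCons a q) T) B = ?R"
        by (rule ext) (simp add: compose_def poly_operator_pCons[OF T BX])
      ultimately show ?case by (simp only:)
    qed
    thus ?thesis by (simp add: q)
  qed
qed

lemma commutant_iff:
  "A \<in> commutant X N T \<longleftrightarrow> A \<in> bounded_operators X N \<and> (\<forall>f\<in>X. A (T f) = T (A f))"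
proof -
  have "compose X A T = compose X T A \<longleftrightarrow> (\<forall>f\<in>X. A (T f) = T (A f))"
    by (simp add: compose_def restrict_def fun_eq_iff Ball_def)
  thus ?thesis by (simp add: commutant_def)
qed

lemma operator_algebra_commutant:
  assumes T: "T \<in> bounded_operators X N"
  shows "operator_algebra X N (commutant X N T)"
  unfolding operator_algebra_def
proof (intro conjI ballI allI)
  note TX = bounded_operatorsD(1)[OF T]
  show "commutant X N T \<noteq> {}" using T commutant_iff by blast
  show "commutant X N T \<subseteq> bounded_operators X N" by (auto simp: commutant_def)
  fix A assume "A \<in> commutant X N T"
  hence A: "A \<in> bounded_operators X N" "\<And>f. f \<in> X \<Longrightarrow> A (T f) = T (A f)" using commutant_iff by auto
  show "(\<lambda>f\<in>X. \<lambda>z. c * A f z) \<in> commutant X N T" for c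
    unfolding commutant_iff
    using bounded_operators_scale[OF A(1)] TX A(2) bounded_operatorsD(3)[OF T bounded_operatorsD(1)[OF A(1)]]
    by simp
  fix B assume "B \<in> commutant X N T"
  hence B: "B \<in> bounded_operators X N" "\<And>f. f \<in> X \<Longrightarrow> B (T f) = T (B f)" using commutant_iff by auto
  show "(\<lambda>f\<in>X. \<lambda>z. A f z + B f z) \<in> commutant X N T"
    unfolding commutant_iff
    using bounded_operators_add[OF A(1) B(1)] TX A(2) B(2)
      bounded_operatorsD(2)[OF T bounded_operatorsD(1)[OF A(1)] bounded_operatorsD(1)[OF B(1)]]
    by simp
  show "compose X A B \<in> commutant X N T"
    unfolding commutant_iff
    using bounded_operators_compose[OF A(1) B(1)] TX A(2) B(2) bounded_operatorsD(1)[OF B(1)]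
    by (simp add: compose_eq)
qed

lemma poly_operator_eigenvector:
  assumes T: "T \<in> bounded_operators X N" and e: "e \<in> X" "T e = (\<lambda>z. c * e z)"
  shows "\<exists>d. poly_operator X q T e = (\<lambda>z. d * e z)"
proof (induction q rule: pCons_induct)
  case 0
  show ?case using e by (intro exI[of _ 0]) (simp add: poly_operator_def)
next
  case (pCons a q)
  then obtain d where d: "poly_operator X q T e = (\<lambda>z. d * e z)" by auto
  have "poly_operator X (pCons a q) T e = (\<lambda>z. (a + d * c) * e z)"
    unfolding poly_operator_pCons[OF T e(1)] d bounded_operatorsD(3)[OF T e(1)] e(2)
    by (simp add: algebra_simps)
  thus ?case by (rule exI)
qed

end

section \<open>Koenigs domains of parabolic semiflows\<close>

text \<open>Schwarz's lemma for \<open>f\<close> conjugated by the disc automorphisms that move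
  \<open>w\<close> and \<open>f w\<close> to \<open>0\<close>.\<close>

theorem Schwarz_Pick:
  assumes f: "f holomorphic_on \<D>" "\<And>z. z \<in> \<D> \<Longrightarrow> f z \<in> \<D>" and z: "z \<in> \<D>" "w \<in> \<D>"
  shows "norm (Moebius_function 0 (f w) (f z)) \<le> norm (Moebius_function 0 w z)"
proof -
  let ?m = "Moebius_function 0 (f w)" and ?n = "Moebius_function 0 (- w)"
  define g where "g \<zeta> = ?m (f (?n \<zeta>))" for \<zeta>
  have w: "norm w < 1" "norm (f w) < 1" using f(2)[OF z(2)] z(2) by auto
  have n: "norm (?n \<zeta>) < 1" if "norm \<zeta> < 1" for \<zeta>
    using Moebius_function_norm_lt_1[of "- w" \<zeta> 0] w that by simp
  have "(f \<circ> ?n) holomorphic_on \<D>"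
    by (rule holomorphic_on_compose_gen[OF Moebius_function_holomorphic f(1)]) (use w n in auto)
  hence "(?m \<circ> (f \<circ> ?n)) holomorphic_on \<D>"
    by (rule holomorphic_on_compose_gen[OF _ Moebius_function_holomorphic[OF w(2)]]) (use n f(2) in auto)
  hence g: "g holomorphic_on \<D>" by (simp add: g_def[abs_def] o_def)
  have g0: "g 0 = 0" by (simp add: g_def Moebius_function_of_zero Moebius_function_eq_zero)
  have g1: "norm (g \<zeta>) < 1" if "norm \<zeta> < 1" for \<zeta>
    unfolding g_def by (rule Moebius_function_norm_lt_1[OF w(2)]) (use f(2)[of "?n \<zeta>"] n[OF that] in simp)
  let ?\<xi> = "Moebius_function 0 w z"
  have "norm ?\<xi> < 1" using Moebius_function_norm_lt_1 w z by simp
  hence "norm (g ?\<xi>) \<le> norm ?\<xi>" using g1 by (intro Schwarz_Lemma(1)[OF g g0])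
  moreover have "?n ?\<xi> = z" using Moebius_function_compose[of "- w" w z] w z by simp
  ultimately show ?thesis by (simp add: g_def)
qed

lemma artanh_mono:
  fixes x y :: real
  assumes "0 \<le> x" "x \<le> y" "y < 1" shows "artanh x \<le> artanh y"
proof -
  have "(1 + x) / (1 - x) \<le> (1 + y) / (1 - y)" using assms by (intro frac_le) auto
  moreover have "0 < (1 + x) / (1 - x)" using assms by simp
  ultimately show ?thesis by (simp add: artanh_def)
qed

lemma artanh_pos:
  fixes x :: real
  assumes "0 < x" "x < 1" shows "0 < artanh x"
  using assms by (simp add: artanh_def)

locale koenigs_semiflow =
  fixes \<Phi> :: "real \<Rightarrow> complex \<Rightarrow> complex" and h :: "complex \<Rightarrow> complex"
  assumes semiflow: "holomorphic_semiflow \<Phi>" and koenigs: "koenigs_function \<Phi> h"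
begin

lemma h_holomorphic: "h holomorphic_on \<D>" and h_inj: "inj_on h \<D>"
  using koenigs by (auto simp: koenigs_function_def)

lemma flow_holomorphic: "0 \<le> t \<Longrightarrow> \<Phi> t holomorphic_on \<D>"
  and flow_image: "0 \<le> t \<Longrightarrow> \<Phi> t ` \<D> \<subseteq> \<D>"
  and flow_add: "0 \<le> t \<Longrightarrow> 0 \<le> s \<Longrightarrow> z \<in> \<D> \<Longrightarrow> \<Phi> (t + s) z = \<Phi> t (\<Phi> s z)"
  and flow_zero: "z \<in> \<D> \<Longrightarrow> \<Phi> 0 z = z"
  using semiflow by (auto simp: holomorphic_semiflow_def)

lemma flow_mem: "0 \<le> t \<Longrightarrow> z \<in> \<D> \<Longrightarrow> \<Phi> t z \<in> \<D>"
  using flow_image by blast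

lemma h_flow:
  assumes "0 \<le> t" "z \<in> \<D>" shows "h (\<Phi> t z) = h z + of_real t"
proof -
  have "h z + of_real t \<in> h ` \<D>" "\<Phi> t z = inv_into \<D> h (h z + of_real t)"
    using koenigs assms by (auto simp: koenigs_function_def)
  thus ?thesis by (simp add: f_inv_into_f)
qed

lemma range_translate: "w \<in> h ` \<D> \<Longrightarrow> 0 \<le> t \<Longrightarrow> w + of_real t \<in> h ` \<D>"
  using koenigs by (auto simp: koenigs_function_def)

lemma closure_range_translate:
  assumes "w \<in> closure (h ` \<D>)" "0 \<le> t" shows "w + of_real t \<in> closure (h ` \<D>)"
proof -
  have "w + of_real t \<in> closure ((\<lambda>w. w + of_real t) ` (h ` \<D>))"
    by (rule closure_image_isCont[OF assms(1)]) (intro continuous_intros)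
  moreover have "(\<lambda>w. w + of_real t) ` (h ` \<D>) \<subseteq> h ` \<D>" using range_translate assms(2) by blast
  ultimately show ?thesis using closure_mono by blast
qed

lemma open_range: "open (h ` \<D>)"
  by (rule open_mapping_thm3[OF h_holomorphic open_ball h_inj])

text \<open>The pseudo-hyperbolic distance between orbit points one time unit apart.
  \<open>Schwarz_Pick\<close> applies to it directly, and \<open>artanh\<close> turns it into the
  hyperbolic distance.\<close>

definition step :: "complex \<Rightarrow> real \<Rightarrow> real" where
  "step z t = norm (Moebius_function 0 (\<Phi> (t + 1) z) (\<Phi> t z))"

lemma step_less_1: "0 \<le> t \<Longrightarrow> z \<in> \<D> \<Longrightarrow> step z t < 1"
  unfolding step_def using flow_mem[of t z] flow_mem[of "t + 1" z]
  by (intro Moebius_function_norm_lt_1) auto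

lemma step_nonneg: "0 \<le> step z t"
  by (simp add: step_def)

lemma hyperbolic_distance_step: "hyperbolic_distance (\<Phi> t z) (\<Phi> (t + 1) z) = artanh (step z t)"
  by (simp add: hyperbolic_distance_def step_def)

text \<open>If the translates \<open>\<Omega> - t\<close> exhaust the plane then \<open>\<Omega>\<close> contains arbitrarily large discs around
  \<open>h z + t\<close>, so Schwarz--Pick forces zero hyperbolic step.\<close>
lemma positive_step_half_plane:
  assumes "positive_hyperbolic_step \<Phi>"
  shows "\<exists>a b. a \<noteq> 0 \<and> (\<forall>w\<in>h ` \<D>. a \<bullet> w < b)"
proof -
  obtain z L where z: "z \<in> \<D>" and L: "0 < L"
    and lim: "((\<lambda>t. hyperbolic_distance (\<Phi> t z) (\<Phi> (t + 1) z)) \<longlongrightarrow> L) at_top"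
    using assms by (auto simp: positive_hyperbolic_step_def)
  have "Im ` h ` \<D> \<noteq> UNIV"
  proof
    assume U: "Im ` h ` \<D> = UNIV"
    define \<tau> where "\<tau> = tanh (L / 2)"
    have \<tau>: "0 < \<tau>" "\<tau> < 1" using L by (auto simp: \<tau>_def tanh_real_lt_1)
    \<comment> \<open>Ensures \<open>1 / R < \<tau>\<close>, where \<open>\<tau>\<close> is the
      pseudo-hyperbolic distance that corresponds to \<open>L / 2\<close>.\<close>
    define R where "R = 1 / \<tau> + 1"
    have R: "1 < R" "1 / R < \<tau>" using \<tau> by (auto simp: R_def field_simps add_pos_pos)
    define A where "A n = {u. u + of_nat n \<in> h ` \<D>}" for n :: nat
    have Aopen: "open (A n)" for n
    proof -
      have "A n = (\<lambda>u. u + of_nat n) -` (h ` \<D>)" by (auto simp: A_def)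
      thus ?thesis by (simp only:) (intro open_vimage open_range continuous_intros)
    qed
    have Amono: "A m \<subseteq> A n" if "m \<le> n" for m n
    proof
      fix u assume "u \<in> A m"
      hence "(u + of_nat m) + of_real (real (n - m)) \<in> h ` \<D>" unfolding A_def by (intro range_translate) auto
      moreover have "(u + of_nat m) + of_real (real (n - m)) = u + of_nat n" using that by (simp add: of_nat_diff)
      ultimately show "u \<in> A n" by (simp only: A_def mem_Collect_eq)
    qed
    \<comment> \<open>A point enters the range of \<open>h\<close> after a long enough translation
      to the right if its horizontal line meets that range; under the assumption \<open>U\<close>
      every line does.\<close>
    have "cball (h z) R \<subseteq> (\<Union>n\<in>UNIV. A n)"
    proof
      fix u assume "u \<in> cball (h z) R"
      have "Im u \<in> Im ` h ` \<D>" using U by simp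
      then obtain y where y: "Im u = Im y" "y \<in> h ` \<D>" by (rule imageE)
      obtain n :: nat where n: "Re y - Re u \<le> real n" using real_arch_simple by blast
      have "y + of_real (real n + Re u - Re y) \<in> h ` \<D>" using n by (intro range_translate y(2)) auto
      moreover have "y + of_real (real n + Re u - Re y) = u + of_nat n" using y(1) by (simp add: complex_eq_iff)
      ultimately have "u \<in> A n" by (simp only: A_def mem_Collect_eq)
      thus "u \<in> (\<Union>n\<in>UNIV. A n)" by blast
    qed
    then obtain C where C: "finite C" "cball (h z) R \<subseteq> (\<Union>n\<in>C. A n)"
      by (rule compactE_image[OF compact_cball Aopen])
    define n where "n = Max (insert 0 C)"
    have n: "cball (h z) R \<subseteq> A n"
    proof
      fix u assume "u \<in> cball (h z) R"
      then obtain m where "m \<in> C" "u \<in> A m" using C(2) by blast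
      moreover from this have "m \<le> n" unfolding n_def using C(1) by (intro Max_ge) auto
      ultimately show "u \<in> A n" using Amono by blast
    qed
    have small: "step z t \<le> 1 / R" if t: "real n \<le> t" for t
    proof -
      have t0: "0 \<le> t" using t of_nat_0_le_iff[of n] by linarith
      obtain g where g: "g holomorphic_on (h ` \<D>)" "\<And>z. z \<in> \<D> \<Longrightarrow> g (h z) = z"
        by (rule holomorphic_has_inverse[OF h_holomorphic open_ball h_inj]) blast
      \<comment> \<open>A holomorphic self-map of the disc that sends \<open>0\<close> and
        \<open>1 / R\<close> to the orbit points at times \<open>t\<close> and \<open>t + 1\<close>,
        which are thus at pseudo-hyperbolic distance at most \<open>1 / R\<close>.\<close>
      define f where "f \<zeta> = g (h z + of_real t + of_real R * \<zeta>)" for \<zeta>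
      have arg: "h z + of_real t + of_real R * \<zeta> \<in> h ` \<D>" if "\<zeta> \<in> \<D>" for \<zeta>
      proof -
        have "h z + of_real R * \<zeta> \<in> cball (h z) R" using that R(1) by (simp add: dist_norm norm_mult mult_left_le)
        hence "h z + of_real R * \<zeta> + of_nat n \<in> h ` \<D>" using n by (auto simp: A_def)
        hence "(h z + of_real R * \<zeta> + of_nat n) + of_real (t - real n) \<in> h ` \<D>" using t by (intro range_translate) auto
        thus ?thesis by (simp add: algebra_simps)
      qed
      have "(g \<circ> (\<lambda>\<zeta>. h z + of_real t + of_real R * \<zeta>)) holomorphic_on \<D>"
        by (rule holomorphic_on_compose_gen[OF _ g(1)]) (use arg in \<open>auto intro!: holomorphic_intros\<close>)
      hence fh: "f holomorphic_on \<D>" by (simp add: f_def[abs_def] o_def)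
      have fD: "f \<zeta> \<in> \<D>" if "\<zeta> \<in> \<D>" for \<zeta> using arg[OF that] g(2) by (auto simp: f_def)
      have flow: "g (h z + of_real s) = \<Phi> s z" if "0 \<le> s" for s
        using g(2)[OF flow_mem[OF that z]] h_flow[OF that z] by simp
      have f0: "f 0 = \<Phi> t z" using flow[OF t0] by (simp add: f_def)
      have f1: "f (1 / of_real R) = \<Phi> (t + 1) z" using flow[of "t + 1"] t0 R(1) by (simp add: f_def add.assoc)
      have rD: "1 / complex_of_real R \<in> \<D>" using R(1) by (simp add: norm_divide)
      have "norm (Moebius_function 0 (f (1 / of_real R)) (f 0)) \<le> norm (Moebius_function 0 (1 / of_real R) 0)"
        by (rule Schwarz_Pick[OF fh fD _ rD]) auto
      thus ?thesis unfolding f0 f1 using R(1) by (simp add: step_def Moebius_function_of_zero norm_divide)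
    qed
    have "L / 2 < L" using L by simp
    from order_tendstoD(1)[OF lim this] obtain t0 where t0: "\<And>t. t0 \<le> t \<Longrightarrow> L / 2 < artanh (step z t)"
      unfolding eventually_at_top_linorder hyperbolic_distance_step by auto
    define t where "t = max t0 (real n)"
    have "artanh (step z t) \<le> artanh \<tau>"
      using small[of t] R(2) \<tau> step_nonneg[of z t] by (intro artanh_mono) (auto simp: t_def)
    moreover have "artanh \<tau> = L / 2" by (simp add: \<tau>_def artanh_tanh_real)
    moreover have "L / 2 < artanh (step z t)" by (rule t0) (simp add: t_def)
    ultimately show False by simp
  qed
  then obtain y0 where y0: "y0 \<notin> Im ` h ` \<D>" by blast
  \<comment> \<open>The imaginary parts form an interval that omits \<open>y0\<close>, so the domain
    lies strictly above or strictly below the line at this height.\<close>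
  have "connected (Im ` h ` \<D>)"
    by (intro connected_continuous_image holomorphic_on_imp_continuous_on h_holomorphic continuous_intros) simp
  from connectedD[OF this, of "{..<y0}" "{y0<..}"]
  have "{..<y0} \<inter> Im ` h ` \<D> = {} \<or> {y0<..} \<inter> Im ` h ` \<D> = {}" using y0 by force
  thus ?thesis
  proof
    assume *: "{..<y0} \<inter> Im ` h ` \<D> = {}"
    have "(- \<i>) \<bullet> w < - y0" if w: "w \<in> h ` \<D>" for w
    proof -
      have "Im w \<in> Im ` h ` \<D>" using w by blast
      hence "y0 < Im w" using * y0 by (metis IntI emptyE lessThan_iff linorder_cases)
      thus ?thesis by (simp add: inner_complex_def)
    qed
    thus ?thesis by (intro exI[of _ "- \<i>"] exI[of _ "- y0"]) auto
  next
    assume *: "{y0<..} \<inter> Im ` h ` \<D> = {}"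
    have "\<i> \<bullet> w < y0" if w: "w \<in> h ` \<D>" for w
    proof -
      have "Im w \<in> Im ` h ` \<D>" using w by blast
      hence "Im w < y0" using * y0 by (metis IntI emptyE greaterThan_iff linorder_cases)
      thus ?thesis by (simp add: inner_complex_def)
    qed
    thus ?thesis by (intro exI[of _ "\<i>"] exI[of _ y0]) auto
  qed
qed

section \<open>Horizontal half-planes and the exterior for zero step\<close>

text \<open>The flow for time \<open>s - t\<close> is a holomorphic self-map of the disc and cannot
  increase distances.\<close>

lemma step_antimono:
  assumes z: "z \<in> \<D>" and "0 \<le> t" "t \<le> s" shows "step z s \<le> step z t"
proof -
  have "\<Phi> s z = \<Phi> (s - t) (\<Phi> t z)" "\<Phi> (s + 1) z = \<Phi> (s - t) (\<Phi> (t + 1) z)"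
    using flow_add[of "s - t" t z] flow_add[of "s - t" "t + 1" z] assms by (simp_all add: algebra_simps)
  thus ?thesis unfolding step_def
    using Schwarz_Pick[OF flow_holomorphic[of "s - t"] flow_mem[of "s - t"] flow_mem[of t z] flow_mem[of "t + 1" z]] assms
    by simp
qed

text \<open>For imaginary \<open>a\<close> real translations move \<open>q\<close> parallel to the
  boundary of the right half-plane, so in that half-plane a unit step has constant pseudo-hyperbolic
  length \<open>c\<close>. Holomorphic maps do not increase distances, hence the step in the disc is
  at least \<open>c\<close>.\<close>

lemma horizontal_half_plane_positive_step:
  assumes a: "a \<noteq> 0" "Re a = 0" and sub: "\<And>w. w \<in> h ` \<D> \<Longrightarrow> a \<bullet> w < b"
  shows "positive_hyperbolic_step \<Phi>"
proof -
  have z: "(0::complex) \<in> \<D>" by simp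
  define q where "q w = of_real b - cnj a * w" for w
  have Re_q: "Re (q w) = b - a \<bullet> w" for w by (simp add: q_def inner_complex_def)
  have qpos: "0 < Re (q w)" if "w \<in> h ` \<D>" for w using sub[OF that] by (simp add: Re_q)
  define s where "s = Re (q (h 0))"
  define c where "c = norm a / norm (of_real (2 * s) - a)"
  have s: "0 < s" using qpos[of "h 0"] z unfolding s_def by blast
  have "norm (of_real (2 * s) - a) > 0" using s a(2) by (auto simp: complex_eq_iff)
  hence c: "0 < c" using a(1) by (simp add: c_def)
  have low: "c \<le> step 0 t" if t: "0 \<le> t" for t
  proof -
    let ?q1 = "q (h 0 + of_real t)" and ?q2 = "q (h 0 + of_real (t + 1))"
    \<comment> \<open>The map \<open>q \<circ> h\<close> into the right half-plane, followed by the
      Cayley transform that sends \<open>?q2\<close> to \<open>0\<close>.\<close>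
    define f where "f \<zeta> = (q (h \<zeta>) - ?q2) / (q (h \<zeta>) + cnj ?q2)" for \<zeta>
    have q2: "0 < Re ?q2" by (rule qpos[OF range_translate[OF imageI[OF z]]]) (use t in simp)
    have den: "q (h \<zeta>) + cnj ?q2 \<noteq> 0" if "\<zeta> \<in> \<D>" for \<zeta>
    proof
      assume "q (h \<zeta>) + cnj ?q2 = 0"
      hence "Re (q (h \<zeta>)) + Re ?q2 = 0" by (metis complex_cnj(1) cnj.sel(1) plus_complex.sel(1) zero_complex.sel(1))
      moreover have "0 < Re (q (h \<zeta>))" using that by (intro qpos) blast
      ultimately show False using q2 by simp
    qed
    have fh: "f holomorphic_on \<D>"
      unfolding f_def q_def using den unfolding q_def by (intro holomorphic_intros h_holomorphic) auto
    have fD: "f \<zeta> \<in> \<D>" if \<zeta>: "\<zeta> \<in> \<D>" for \<zeta>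
    proof -
      have "0 < Re (q (h \<zeta>))" using \<zeta> by (intro qpos) blast
      hence "0 < Re (q (h \<zeta>)) * Re ?q2" using q2 by simp
      hence "(norm (q (h \<zeta>) - ?q2))\<^sup>2 < (norm (q (h \<zeta>) + cnj ?q2))\<^sup>2"
        unfolding cmod_power2 by (simp add: power2_eq_square algebra_simps)
      hence "norm (q (h \<zeta>) - ?q2) < norm (q (h \<zeta>) + cnj ?q2)" by (rule power2_less_imp_less) simp
      thus ?thesis using den[OF \<zeta>] by (simp add: f_def norm_divide divide_less_eq)
    qed
    have f2: "f (\<Phi> (t + 1) 0) = 0" using h_flow[of "t + 1" 0] t by (simp add: f_def)
    have "?q1 - ?q2 = cnj a" by (simp add: q_def algebra_simps)
    moreover have "?q1 + cnj ?q2 = of_real (2 * s) - a"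
      using a(2) by (simp add: q_def s_def complex_eq_iff algebra_simps)
    ultimately have f1: "f (\<Phi> t 0) = cnj a / (of_real (2 * s) - a)" using h_flow[of t 0] t by (simp add: f_def)
    have "norm (Moebius_function 0 (f (\<Phi> (t + 1) 0)) (f (\<Phi> t 0))) \<le> step 0 t"
      unfolding step_def by (rule Schwarz_Pick[OF fh fD]) (use t flow_mem z in auto)
    thus ?thesis unfolding f2 f1 by (simp add: Moebius_function_simple norm_divide c_def)
  qed
  \<comment> \<open>The step is decreasing in \<open>t\<close>, so it converges to its infimum,
    which is at least \<open>c\<close> and below \<open>1\<close>.\<close>
  define l where "l = (INF t\<in>{0..}. step 0 t)"
  have bdd: "bdd_below (step 0 ` {0..})" using step_nonneg by (intro bdd_belowI[of _ 0]) auto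
  have lc: "c \<le> l" unfolding l_def by (rule cINF_greatest) (use low in auto)
  have l1: "l < 1" using cINF_lower[OF bdd, of 0] step_less_1[of 0 0] by (simp add: l_def)
  have "((\<lambda>t. step 0 t) \<longlongrightarrow> l) at_top"
  proof (rule order_tendstoI)
    fix x assume "x < l"
    thus "eventually (\<lambda>t. x < step 0 t) at_top"
      unfolding eventually_at_top_linorder using cINF_lower[OF bdd] unfolding l_def
      by (intro exI[of _ 0]) (auto intro: less_le_trans)
  next
    fix x assume "l < x"
    then obtain t where "0 \<le> t" "step 0 t < x" unfolding l_def by (subst (asm) cINF_less_iff[OF _ bdd]) auto
    thus "eventually (\<lambda>t. step 0 t < x) at_top"
      unfolding eventually_at_top_linorder using step_antimono[OF z]
      by (intro exI[of _ t]) (auto intro: le_less_trans)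
  qed
  hence "((\<lambda>t. artanh (step 0 t)) \<longlongrightarrow> artanh l) at_top"
    by (rule isCont_tendsto_compose[rotated]) (use lc c l1 in \<open>auto intro!: continuous_intros\<close>)
  moreover have "0 < artanh l" using lc c l1 by (intro artanh_pos) auto
  ultimately show ?thesis
    unfolding positive_hyperbolic_step_def hyperbolic_distance_step using z by blast
qed

text \<open>The closure of the domain is invariant under translation to the right, so its complement
  is invariant under translation to the left. \<open>Re a\<close> is negative: zero would give a
  positive step, and a positive value would push orbits out of the half-plane. Leftward rays from
  exterior points therefore all reach the opposite open half-plane \<open>S\<close>, which joins
  them.\<close>

lemma connected_Compl_closure:
  assumes a: "a \<noteq> 0" and sub: "\<And>w. w \<in> h ` \<D> \<Longrightarrow> a \<bullet> w < b" and ns: "\<not> positive_hyperbolic_step \<Phi>"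
  shows "connected (- closure (h ` \<D>))"
proof -
  let ?O = "- closure (h ` \<D>)"
  have "Re a \<noteq> 0" using horizontal_half_plane_positive_step[OF a _ sub] ns by blast
  moreover have "Re a \<le> 0"
  proof (rule ccontr)
    assume "\<not> Re a \<le> 0"
    hence ra: "0 < Re a" by simp
    define t where "t = \<bar>b - a \<bullet> h 0\<bar> / Re a"
    have "h 0 + of_real t \<in> h ` \<D>" using ra by (intro range_translate) (auto simp: t_def)
    from sub[OF this] have "a \<bullet> h 0 + t * Re a < b" by (simp add: inner_complex_def algebra_simps)
    moreover have "t * Re a = \<bar>b - a \<bullet> h 0\<bar>" using ra by (simp add: t_def)
    ultimately show False by linarith
  qed
  ultimately have ra: "Re a < 0" by simp
  define S where "S = {w. b < a \<bullet> w}"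
  have "closure (h ` \<D>) \<subseteq> {w. a \<bullet> w \<le> b}"
    by (rule closure_minimal) (use sub less_imp_le in \<open>auto simp: closed_halfspace_le\<close>)
  hence SO: "S \<subseteq> ?O" by (auto simp: S_def)
  have Sc: "connected S" unfolding S_def by (intro convex_connected convex_halfspace_gt)
  define L where "L w = (\<lambda>t. w - of_real t) ` {0::real..}" for w :: complex
  have Lc: "connected (L w)" for w
    unfolding L_def by (intro connected_continuous_image continuous_intros convex_connected) simp
  have LO: "L w \<subseteq> ?O" if "w \<in> ?O" for w
  proof
    fix u assume "u \<in> L w"
    then obtain t where t: "0 \<le> t" "u = w - of_real t" by (auto simp: L_def)
    thus "u \<in> ?O" using closure_range_translate[of u t] that by auto
  qed
  have LS: "L w \<inter> S \<noteq> {}" for w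
  proof -
    define t where "t = (\<bar>b - a \<bullet> w\<bar> + 1) / (- Re a)"
    have t: "t * (- Re a) = \<bar>b - a \<bullet> w\<bar> + 1" using ra by (simp add: t_def)
    have t0: "0 \<le> t" unfolding t_def by (rule divide_nonneg_pos) (use ra in auto)
    have "a \<bullet> (w - of_real t) = a \<bullet> w + t * (- Re a)" by (simp add: inner_complex_def algebra_simps)
    hence "w - of_real t \<in> S" using t by (simp add: S_def)
    moreover have "w - of_real t \<in> L w" using t0 by (simp add: L_def)
    ultimately show ?thesis by blast
  qed
  have "connected (\<Union> ((\<lambda>w. L w \<union> S) ` ?O))"
  proof (rule connected_Union)
    fix P assume "P \<in> (\<lambda>w. L w \<union> S) ` ?O"
    then obtain w where "P = L w \<union> S" by auto
    thus "connected P" using connected_Un[OF Lc Sc LS] by simp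
  next
    have "S \<subseteq> \<Inter> ((\<lambda>w. L w \<union> S) ` ?O)" by blast
    moreover have "S \<noteq> {}" using LS by blast
    ultimately show "\<Inter> ((\<lambda>w. L w \<union> S) ` ?O) \<noteq> {}" by blast
  qed
  moreover have "\<Union> ((\<lambda>w. L w \<union> S) ` ?O) = ?O"
  proof (intro equalityI subsetI)
    fix u assume "u \<in> \<Union> ((\<lambda>w. L w \<union> S) ` ?O)"
    thus "u \<in> ?O" using LO SO by blast
  next
    fix u assume u: "u \<in> ?O"
    have "u \<in> L u" unfolding L_def by (rule image_eqI[of _ _ 0]) auto
    thus "u \<in> \<Union> ((\<lambda>w. L w \<union> S) ` ?O)" using u by blast
  qed
  ultimately show ?thesis by simp
qed

text \<open>The real part of \<open>cnj a * w\<close> is \<open>a \<bullet> w\<close>, so the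
  half-plane becomes the right one. The affine bijection \<open>T\<close> commutes with closure,
  interior and complement, and the image is unbounded because translation along the orbit of
  \<open>0\<close> moves it arbitrarily far.\<close>

lemma univalent_right_half_plane_affine:
  assumes p: "1 \<le> p" and a: "a \<noteq> 0" and sub: "\<And>w. w \<in> h ` \<D> \<Longrightarrow> a \<bullet> w < b"
    and int: "interior (closure (h ` \<D>)) = h ` \<D>" and conn: "connected (- closure (h ` \<D>))"
  shows "univalent_right_half_plane p (\<lambda>z. of_real b - cnj a * h z)"
proof -
  let ?F = "\<lambda>z. of_real b - cnj a * h z"
  define l where "l w = - cnj a * w" for w
  define T where "T w = of_real b + l w" for w
  have l: "linear l" "inj l" using a by (auto simp: l_def inj_def intro!: linearI simp: algebra_simps)
  have FT: "?F ` \<D> = T ` (h ` \<D>)" by (simp add: T_def l_def image_image)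
  have Timg: "T ` S = (\<lambda>x. of_real b + x) ` (l ` S)" for S by (simp add: T_def image_image)
  have cl: "closure (T ` S) = T ` closure S" for S
    unfolding Timg closure_translation closure_injective_linear_image[OF l] ..
  have it: "interior (T ` S) = T ` interior S" for S
    unfolding Timg interior_translation interior_injective_linear_image[OF l] ..
  have "bij T"
  proof (rule bijI)
    show "inj T" using l(2) by (simp add: T_def inj_def)
    show "surj T"
      by (rule surjI[of _ "\<lambda>v. (of_real b - v) / cnj a"]) (use a in \<open>simp add: T_def l_def\<close>)
  qed
  hence Tc: "- (T ` S) = T ` (- S)" for S by (simp add: bij_image_Compl_eq)
  show ?thesis
  proof
    show "?F holomorphic_on \<D>" by (intro holomorphic_intros h_holomorphic)
    show "inj_on ?F \<D>" using h_inj a by (auto simp: inj_on_def)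
    show "0 < Re (?F z)" if "z \<in> \<D>" for z using sub[of "h z"] that by (simp add: inner_complex_def)
    show "interior (closure (?F ` \<D>)) = ?F ` \<D>" unfolding FT cl it int ..
    show "connected (- closure (?F ` \<D>))"
      unfolding FT cl Tc by (intro connected_continuous_image conn) (auto simp: T_def l_def intro!: continuous_intros)
    show "\<not> bounded (?F ` \<D>)"
    proof
      assume "bounded (?F ` \<D>)"
      then obtain B where "\<forall>x\<in>?F ` \<D>. norm x \<le> B" unfolding bounded_iff by (rule exE)
      hence B: "norm (?F z) \<le> B" if "z \<in> \<D>" for z using that by blast
      obtain n :: nat where n: "(B + norm (?F 0)) / norm a < real n" using reals_Archimedean2 by blast
      have eq: "?F (\<Phi> (real n) 0) = ?F 0 - cnj a * of_nat n" using h_flow[of "real n" 0] by (simp add: algebra_simps)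
      have "norm (cnj a * of_nat n) - norm (?F 0) \<le> norm (?F (\<Phi> (real n) 0))"
        unfolding eq using norm_triangle_ineq2[of "cnj a * of_nat n" "?F 0"] by (simp only: norm_minus_commute)
      also have "\<dots> \<le> B" by (rule B) (use flow_mem in auto)
      finally have "real n * norm a \<le> B + norm (?F 0)" by (simp add: norm_mult mult.commute algebra_simps)
      moreover have "B + norm (?F 0) < real n * norm a" using n a by (simp add: divide_less_eq)
      ultimately show False by simp
    qed
  qed fact
qed

text \<open>A coincidence at times \<open>m < n\<close> is a fixed point of the flow at time
  \<open>n - m\<close>.\<close>

lemma flow_orbit_inj:
  assumes "\<not> elliptic \<Phi>" shows "inj_on (\<lambda>n::nat. \<Phi> (real n) 0) {1..}"
proof -
  have "\<Phi> (real m) 0 \<noteq> \<Phi> (real n) 0" if "m < n" for m n :: nat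
  proof
    assume eq: "\<Phi> (real m) 0 = \<Phi> (real n) 0"
    have "\<Phi> (real n) 0 = \<Phi> (real n - real m) (\<Phi> (real m) 0)"
      using flow_add[of "real n - real m" "real m" 0] that by simp
    hence "elliptic \<Phi>" unfolding elliptic_def using eq that flow_mem[of "real m" 0]
      by (intro exI[of _ "real n - real m"] conjI bexI[of _ "\<Phi> (real m) 0"]) auto
    thus False using assms by simp
  qed
  thus ?thesis by (intro inj_onI) (metis linorder_neqE_nat)
qed

end

section \<open>The main theorem\<close>

lemma composition_eigenspace_one_dim:
  assumes p: "1 \<le> p" and f: "f \<in> hardy_space p" and e: "e \<in> hardy_space p" "e 0 \<noteq> 0"
    and eig: "\<And>z. z \<in> \<D> \<Longrightarrow> f (\<phi> z) = c * f z" "\<And>z. z \<in> \<D> \<Longrightarrow> e (\<phi> z) = c * e z"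
    and orbit: "a 0 = 0" "\<And>n. a n \<in> \<D>" "\<And>n. a (Suc n) = \<phi> (a n)" "inj_on a {1..}"
    and div: "filterlim (\<lambda>N. \<Sum>n=1..N. 1 - norm (a n)) at_top sequentially"
  shows "f = (\<lambda>z. f 0 / e 0 * e z)"
proof
  define k where "k z = f z - f 0 / e 0 * e z" for z
  have k: "k \<in> hardy_space p"
    unfolding k_def by (intro hardy_space_diff hardy_space_scale f e(1) p)
  \<comment> \<open>A solution of \<open>u (\<phi> z) = c * u z\<close> is multiplied by
    \<open>c\<close> at each step of the orbit, so the combination \<open>k\<close>, which vanishes
    at \<open>0\<close>, vanishes on the whole orbit.\<close>
  have orb: "u (a n) = c ^ n * u 0" if "\<And>z. z \<in> \<D> \<Longrightarrow> u (\<phi> z) = c * u z" for u :: "complex \<Rightarrow> complex" and n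
    by (induction n) (use that orbit(1-3) in auto)
  have zero: "k (a n) = 0" for n
  proof -
    have "f (a n) = c ^ n * f 0" "e (a n) = c ^ n * e 0"
      using orb[where u = f and n = n] orb[where u = e and n = n] eig by simp_all
    thus ?thesis using e(2) by (simp add: k_def)
  qed
  have b: "hardy_bound p k (hardy_norm p k powr p)"
    using hardy_mean_le_norm[OF k] p by (simp add: hardy_bound_def)
  fix z
  have "k z = 0"
  proof (cases "z \<in> \<D>")
    case True
    show ?thesis
      by (rule hardy_zero_of_non_Blaschke[OF hardy_spaceD(1)[OF k] b p orbit(4,2) zero div True])
  qed (use hardy_spaceD(2)[OF k] in auto)
  thus "f z = f 0 / e 0 * e z" by (simp add: k_def)
qed

theorem theorem4p12:
  fixes p :: real
    and \<phi> :: "complex \<Rightarrow> complex"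
    and \<Phi> :: "real \<Rightarrow> complex \<Rightarrow> complex"
    and h :: "complex \<Rightarrow> complex"
    and \<Omega> :: "complex set"
  assumes "1 \<le> p"
    and "\<phi> holomorphic_on \<D>" and "\<phi> ` \<D> \<subseteq> \<D>"
    and "parabolic_semiflow \<Phi>"
    and "\<And>z. z \<in> \<D> \<Longrightarrow> \<phi> z = \<Phi> 1 z"
    and "koenigs_function \<Phi> h" and "\<Omega> = h ` \<D>"
    and "(positive_hyperbolic_step \<Phi> \<and> interior (closure \<Omega>) = \<Omega> \<and> connected (- closure \<Omega>)) \<or>
         (zero_hyperbolic_step \<Phi> \<and> (\<exists>H. half_plane H \<and> \<Omega> \<subseteq> H) \<and> interior (closure \<Omega>) = \<Omega>)"
  shows "strongly_compact_operator (hardy_space p) (hardy_norm p) (composition_operator p \<phi>) \<and>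
    (filterlim (\<lambda>N. \<Sum>n=1..N. 1 - norm (\<Phi> (real n) 0)) at_top sequentially \<longrightarrow>
      strongly_compact_algebra (hardy_space p) (hardy_norm p)
        (commutant (hardy_space p) (hardy_norm p) (composition_operator p \<phi>)))"
proof -
  note p = assms(1)
  have p0: "0 < p" using p by simp
  interpret B: banach_function_space "hardy_space p" "hardy_norm p"
    by (rule banach_function_space_hardy[OF p])
  have semi: "holomorphic_semiflow \<Phi>" and nell: "\<not> elliptic \<Phi>"
    using assms(4) by (auto simp: parabolic_semiflow_def)
  interpret K: koenigs_semiflow \<Phi> h
    by unfold_locales (fact semi, fact assms(6))
  let ?T = "composition_operator p \<phi>"
  have T: "?T \<in> bounded_operators (hardy_space p) (hardy_norm p)"
    by (rule composition_operator_bounded[OF assms(1-3)])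
  have \<phi>D: "\<phi> z \<in> \<D>" if "z \<in> \<D>" for z using assms(3) that by blast
  have h\<phi>: "h (\<phi> z) = h z + 1" if "z \<in> \<D>" for z
    using K.h_flow[of 1 z] assms(5)[OF that] that by simp
  have int: "interior (closure (h ` \<D>)) = h ` \<D>" using assms(7,8) by auto
  obtain a b where a: "a \<noteq> 0" "\<And>w. w \<in> h ` \<D> \<Longrightarrow> a \<bullet> w < b" and conn: "connected (- closure (h ` \<D>))"
    using assms(8)
  proof
    assume *: "positive_hyperbolic_step \<Phi> \<and> interior (closure \<Omega>) = \<Omega> \<and> connected (- closure \<Omega>)"
    obtain a b where "a \<noteq> 0" "\<forall>w\<in>h ` \<D>. a \<bullet> w < b" using K.positive_step_half_plane * by auto
    moreover have "connected (- closure (h ` \<D>))" using * assms(7) by simp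
    ultimately show thesis using that by blast
  next
    assume *: "zero_hyperbolic_step \<Phi> \<and> (\<exists>H. half_plane H \<and> \<Omega> \<subseteq> H) \<and> interior (closure \<Omega>) = \<Omega>"
    then obtain a b where ab: "a \<noteq> 0" "h ` \<D> \<subseteq> {w. a \<bullet> w < b}" using assms(7) by (auto simp: half_plane_def)
    have sub: "a \<bullet> w < b" if "w \<in> h ` \<D>" for w using ab(2) that by blast
    have "connected (- closure (h ` \<D>))"
      by (rule K.connected_Compl_closure[OF ab(1) sub]) (use * in auto)
    thus thesis using that[OF ab(1) sub] by blast
  qed
  define F where "F z = of_real b - cnj a * h z" for z
  interpret U: univalent_right_half_plane p F
    unfolding F_def by (rule K.univalent_right_half_plane_affine[OF p a int conn])
  \<comment> \<open>Elements of \<open>hardy_space\<close> vanish off the disc, while the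
    exponentials in \<open>U.E\<close> do not; extension by zero mediates.\<close>
  define ext where "ext f = (\<lambda>z. if z \<in> \<D> then f z else 0)" for f :: "complex \<Rightarrow> complex"
  define e where "e l = ext (\<lambda>z. exp (- (of_real l * F z)))" for l :: real
  define E where "E = e ` {0..}"
  have bounded_ext: "hardy_bound p (ext f) C" if "hardy_bound p f C" for f C
    by (rule hardy_bound_cong[OF _ that]) (simp add: ext_def)
  have E_X: "E \<subseteq> hardy_space p"
    unfolding E_def
  proof (rule image_subsetI)
    fix l :: real assume "l \<in> {0..}"
    hence mem: "(\<lambda>z. exp (- (of_real l * F z))) \<in> U.E" by (intro U.E_exp) simp
    obtain C where "\<forall>z\<in>\<D>. norm (exp (- (of_real l * F z))) \<le> C" using U.E_bounded[OF mem] by auto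
    hence "hardy_bound p (\<lambda>z. exp (- (of_real l * F z))) (2 * pi * C powr p)"
      by (intro hardy_bound_uniform[OF U.E_holomorphic[OF mem] _ p0]) simp
    from bounded_ext[OF this] have b: "hardy_bound p (e l) (2 * pi * C powr p)" by (simp add: e_def)
    show "e l \<in> hardy_space p"
    proof (rule hardy_spaceI[OF _ _ hardy_boundD[OF b]])
      show "e l holomorphic_on \<D>"
        unfolding e_def ext_def by (rule holomorphic_transform[OF U.E_holomorphic[OF mem]]) simp
    qed (simp_all add: e_def ext_def)
  qed
  have T_apply: "?T f = ext (\<lambda>z. f (\<phi> z))" if "f \<in> hardy_space p" for f
    using that by (simp add: composition_operator_def ext_def)
  \<comment> \<open>Since \<open>h\<close> increases by \<open>1\<close> along
    \<open>\<phi>\<close>, \<open>F\<close> decreases by \<open>cnj a\<close>, which gives the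
    eigenvalue \<open>exp (of_real l * cnj a)\<close>.\<close>
  have T_e: "?T (e l) = (\<lambda>z. exp (of_real l * cnj a) * e l z)" if "0 \<le> l" for l
  proof
    fix z
    have mem: "e l \<in> hardy_space p" using E_X that by (auto simp: E_def)
    show "?T (e l) z = exp (of_real l * cnj a) * e l z"
    proof (cases "z \<in> \<D>")
      case True
      have F\<phi>: "F (\<phi> z) = F z - cnj a" using h\<phi>[OF True] by (simp add: F_def algebra_simps)
      have "exp (- (of_real l * F (\<phi> z))) = exp (of_real l * cnj a) * exp (- (of_real l * F z))"
        unfolding F\<phi> by (simp add: algebra_simps flip: exp_add)
      thus ?thesis unfolding T_apply[OF mem] unfolding e_def ext_def using True \<phi>D[OF True] by simp
    next
      case False
      thus ?thesis unfolding T_apply[OF mem] unfolding e_def ext_def by simp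
    qed
  qed
  have span: "ext g \<in> fun_span E" if "g \<in> U.E" for g
    using that
  proof (induction rule: U.E_induct)
    case zero
    have "ext (\<lambda>z. 0) = (\<lambda>z. 0)" by (simp add: ext_def)
    thus ?case using fun_span.zero by simp
  next
    case (exp l)
    hence "e l \<in> E" by (simp add: E_def)
    thus ?case using fun_span.base by (simp add: e_def)
  next
    case (add f g)
    have "ext (\<lambda>z. f z + g z) = (\<lambda>z. ext f z + ext g z)" by (auto simp: ext_def)
    thus ?case using fun_span.add[OF add.IH] by (simp only:)
  next
    case (scale f c)
    have "ext (\<lambda>z. c * f z) = (\<lambda>z. c * ext f z)" by (auto simp: ext_def)
    thus ?case using fun_span.scale[OF scale.IH, of c] by (simp only:)
  qed
  have total: "\<exists>g\<in>fun_span E. hardy_norm p (\<lambda>z. f z - g z) < \<epsilon>"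
    if f: "f \<in> hardy_space p" and \<epsilon>: "0 < \<epsilon>" for f \<epsilon>
  proof -
    have "hardy_bound p f (hardy_norm p f powr p)"
      using hardy_mean_le_norm[OF f] p0 by (simp add: hardy_bound_def)
    moreover have "0 < (\<epsilon> / 2) powr p" using \<epsilon> by simp
    ultimately obtain g where g: "g \<in> U.E" "hardy_bound p (\<lambda>z. f z - g z) ((\<epsilon> / 2) powr p)"
      using U.exponentials_total[OF hardy_spaceD(1)[OF f]] by blast
    have "hardy_bound p (\<lambda>z. f z - ext g z) ((\<epsilon> / 2) powr p)"
      by (rule hardy_bound_cong[OF _ g(2)]) (simp add: ext_def)
    hence "hardy_norm p (\<lambda>z. f z - ext g z) \<le> \<epsilon> / 2"
      using \<epsilon> p0 by (intro hardy_norm_le hardy_boundD) auto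
    hence "hardy_norm p (\<lambda>z. f z - ext g z) < \<epsilon>" using \<epsilon> by linarith
    thus ?thesis using span[OF g(1)] by (rule bexI[where x = "ext g"])
  qed
  have sc: "strongly_compact_operator (hardy_space p) (hardy_norm p) ?T"
    unfolding strongly_compact_operator_def
  proof (intro conjI T B.strongly_compact_algebra_common_eigenvectors[OF B.operator_algebra_generated[OF T] E_X _ total])
    fix A u assume A: "A \<in> generated_algebra (hardy_space p) ?T" and u: "u \<in> E"
    obtain q where q: "A = poly_operator (hardy_space p) q ?T"
      by (rule rangeE[OF A[unfolded generated_algebra_def]])
    obtain l where l: "0 \<le> l" "u = e l" using u by (auto simp: E_def)
    have "e l \<in> hardy_space p" using E_X u l by auto
    from B.poly_operator_eigenvector[OF T this T_e[OF l(1)]]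
    show "\<exists>c. A u = (\<lambda>z. c * u z)" unfolding q l(2) .
  qed
  have comm: "strongly_compact_algebra (hardy_space p) (hardy_norm p) (commutant (hardy_space p) (hardy_norm p) ?T)"
    if div: "filterlim (\<lambda>N. \<Sum>n=1..N. 1 - norm (\<Phi> (real n) 0)) at_top sequentially"
  proof (rule B.strongly_compact_algebra_common_eigenvectors[OF B.operator_algebra_commutant[OF T] E_X _ total])
    fix A u assume A: "A \<in> commutant (hardy_space p) (hardy_norm p) ?T" and u: "u \<in> E"
    obtain l where l: "0 \<le> l" "u = e l" using u by (auto simp: E_def)
    have uX: "u \<in> hardy_space p" using E_X u by auto
    have AB: "A \<in> bounded_operators (hardy_space p) (hardy_norm p)" and AT: "A (?T u) = ?T (A u)"
      using A uX B.commutant_iff by auto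
    have AuX: "A u \<in> hardy_space p" by (rule B.bounded_operatorsD(1)[OF AB uX])
    let ?c = "exp (of_real l * cnj a)"
    have Tu: "?T u = (\<lambda>z. ?c * u z)" unfolding l(2) by (rule T_e[OF l(1)])
    have TAu: "?T (A u) = (\<lambda>z. ?c * A u z)"
      unfolding AT[symmetric] Tu by (rule B.bounded_operatorsD(3)[OF AB uX])
    have eig: "v (\<phi> z) = ?c * v z" if "v \<in> hardy_space p" "?T v = (\<lambda>z. ?c * v z)" "z \<in> \<D>" for v z
      using fun_cong[OF that(2), of z] T_apply[OF that(1)] that(3) by (simp add: ext_def)
    \<comment> \<open>Because \<open>A\<close> commutes with the operator, \<open>A u\<close>
      satisfies the eigenvalue equation of \<open>u\<close> with the same eigenvalue;
      \<open>u 0\<close> is nonzero as a value of the exponential function.\<close>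
    have "A u = (\<lambda>z. A u 0 / u 0 * u z)"
    proof (rule composition_eigenspace_one_dim[OF p AuX uX _ eig[OF AuX TAu] eig[OF uX Tu],
          where a = "\<lambda>n. \<Phi> (real n) 0"])
      show "u 0 \<noteq> 0" by (simp add: l(2) e_def ext_def)
      show "\<Phi> (real 0) 0 = 0" using K.flow_zero[of 0] by simp
      show mem: "\<Phi> (real n) 0 \<in> \<D>" for n by (rule K.flow_mem) auto
      show "\<Phi> (real (Suc n)) 0 = \<phi> (\<Phi> (real n) 0)" for n
        using K.flow_add[of 1 "real n" 0] assms(5)[OF mem[of n]] by (simp add: add.commute)
      show "inj_on (\<lambda>n. \<Phi> (real n) 0) {1..}" by (rule K.flow_orbit_inj[OF nell])
    qed (use div in auto)
    thus "\<exists>c. A u = (\<lambda>z. c * u z)" by (rule exI)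
  qed
  show ?thesis using sc comm by blast
qed

end
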